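(* Let $n\ge1$, $\alpha>0$, let $\mu$ be a positive Borel measure on $\mathbb C^n$, and let $\Phi$ be a symmetric norming function with associated ideal $\mathcal I_\Phi$. The Toeplitz form $q_\mu$ is bounded on $F^2_\alpha$ with $T_\mu\in\mathcal I_\Phi$ if and only if $q_\mu$ is bounded on $\mathrm{PH}^2_\alpha$ with $T_\mu^{\mathrm{ph}}\in\mathcal I_\Phi$. Whenever these conditions hold, $$\|T_\mu\|_\Phi\le\|T_\mu^{\mathrm{ph}}\|_\Phi\le 2\|T_\mu\|_\Phi .$$ More precisely, for every $N\ge1$, $$\sum_{k=1}^N s_k(T_\mu^{\mathrm{ph}})\le 2\sum_{k=1}^N s_k(T_\mu).$$ Both constants ($1$ and $2$) in the two-sided estimate $\|T_\mu\|_\Phi\le\|T_\mu^{\mathrm{ph}}\|_\Phi\le 2\|T_\mu\|_\Phi$ are optimal, i.e. neither inequality holds for all such $\mu$ with a better constant.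
   Context: $dV$ is Lebesgue measure on $\mathbb C^n$ and $d\mu_\alpha(z)=(\pi\alpha)^{-n}e^{-|z|^2/\alpha}\,dV(z)$. $F^2_\alpha$ is the closed subspace of $L^2(\mathbb C^n,d\mu_\alpha)$ of entire functions; $\mathrm{PH}^2_\alpha$ is the closed subspace of $L^2(\mathbb C^n,d\mu_\alpha)$ of pluriharmonic functions, i.e. complex-valued $C^2$ functions $f$ with $\partial^2 f/\partial z_j\partial\overline z_k=0$ for all $1\le j,k\le n$. Inner products are linear in the first variable. For a positive Borel measure $\mu$ the Toeplitz form is $q_\mu(f,g)=\int_{\mathbb C^n}f\,\overline{g}\,e^{-|z|^2/\alpha}\,d\mu(z)$. It is bounded on a Hilbert space $H$ of functions if the integral converges absolutely for all $f,g\in H$ and $|q_\mu(f,g)|\le C\|f\|_H\|g\|_H$ for some $C$; it is then represented by a unique bounded positive operator $T$ on $H$, $\langle Tf,g\rangle=q_\mu(f,g)$, denoted $T_\mu$ for $H=F^2_\alpha$ and $T_\mu^{\mathrm{ph}}$ for $H=\mathrm{PH}^2_\alpha$. $s_1(T)\ge s_2(T)\ge\cdots$ are the singular values of a compact operator $T$. A symmetric norming function $\Phi$ is a norm on finitely supported sequences, normalized by $\Phi(1,0,\ldots)=1$, that is unchanged when the entries are permuted or replaced by their absolute values. For compact $T$, $\|T\|_\Phi=\sup_{N\ge1}\Phi(s_1(T),\ldots,s_N(T),0,\ldots)$, and the symmetrically normed ideal $\mathcal I_\Phi$ consists of the compact operators $T$ with $\|T\|_\Phi<\infty$. *)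

theory Defs
  imports "HOL-Analysis.Analysis" "HOL-Library.Function_Algebras"
begin

text \<open>
  Spaces of functions are sets of genuine functions, not of almost-everywhere classes: a Toeplitz
  form integrates pointwise values against an arbitrary Borel measure. The elements of both spaces
  below are continuous and Gaussian measure has full support, so each class contains at most one
  such function and the seminorm \<open>l2_norm\<close> is a norm on them.
\<close>

definition l2_inner :: "'a measure \<Rightarrow> ('a \<Rightarrow> complex) \<Rightarrow> ('a \<Rightarrow> complex) \<Rightarrow> complex" where
  "l2_inner M f g = (\<integral>z. f z * cnj (g z) \<partial>M)"

definition l2_norm :: "'a measure \<Rightarrow> ('a \<Rightarrow> complex) \<Rightarrow> real" where
  "l2_norm M f = sqrt (\<integral>z. (cmod (f z))\<^sup>2 \<partial>M)"

definition square_integrable :: "'a measure \<Rightarrow> ('a \<Rightarrow> complex) \<Rightarrow> bool" where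
  "square_integrable M f \<longleftrightarrow>
     f \<in> borel_measurable M \<and> integrable M (\<lambda>z. (cmod (f z))\<^sup>2)"

definition gauss_measure :: "real \<Rightarrow> (complex ^ 'n) measure" where
  "gauss_measure \<alpha> = density lborel
     (\<lambda>z. ennreal (exp (- (norm z)\<^sup>2 / \<alpha>) / (pi * \<alpha>) ^ CARD('n)))"

definition entire :: "(complex ^ 'n \<Rightarrow> complex) \<Rightarrow> bool" where
  "entire f \<longleftrightarrow>
     (\<forall>z. \<exists>D. (f has_derivative D) (at z) \<and> (\<forall>c v. D (c *s v) = c * D v))"

definition C1 :: "(complex ^ 'n \<Rightarrow> complex) \<Rightarrow> bool" where
  "C1 f \<longleftrightarrow> (\<forall>z. f differentiable (at z)) \<and>
     (\<forall>v. continuous_on UNIV (\<lambda>z. frechet_derivative f (at z) v))"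

definition C2 :: "(complex ^ 'n \<Rightarrow> complex) \<Rightarrow> bool" where
  "C2 f \<longleftrightarrow> C1 f \<and> (\<forall>v. C1 (\<lambda>z. frechet_derivative f (at z) v))"

text \<open>
  Wirtinger derivatives: with \<open>z\<^sub>j = x\<^sub>j + \<i> y\<^sub>j\<close>, the vectors \<open>axis j 1\<close> and \<open>axis j \<i>\<close> are the
  directions of \<open>x\<^sub>j\<close> and \<open>y\<^sub>j\<close>.
\<close>

definition d_z :: "'n \<Rightarrow> (complex ^ 'n \<Rightarrow> complex) \<Rightarrow> complex ^ 'n \<Rightarrow> complex" where
  "d_z j f z = (frechet_derivative f (at z) (axis j 1)
                - \<i> * frechet_derivative f (at z) (axis j \<i>)) / 2"

definition d_zbar :: "'n \<Rightarrow> (complex ^ 'n \<Rightarrow> complex) \<Rightarrow> complex ^ 'n \<Rightarrow> complex" where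
  "d_zbar j f z = (frechet_derivative f (at z) (axis j 1)
                   + \<i> * frechet_derivative f (at z) (axis j \<i>)) / 2"

definition pluriharmonic :: "(complex ^ 'n \<Rightarrow> complex) \<Rightarrow> bool" where
  "pluriharmonic f \<longleftrightarrow> C2 f \<and> (\<forall>j k z. d_z j (d_zbar k f) z = 0)"

definition fock_space :: "real \<Rightarrow> (complex ^ 'n \<Rightarrow> complex) set" where
  "fock_space \<alpha> = {f. entire f \<and> square_integrable (gauss_measure \<alpha>) f}"

definition ph_space :: "real \<Rightarrow> (complex ^ 'n \<Rightarrow> complex) set" where
  "ph_space \<alpha> = {f. pluriharmonic f \<and> square_integrable (gauss_measure \<alpha>) f}"

text \<open>
  Operators on a space \<open>H\<close> are total functions of which only the values on \<open>H\<close> matter. Everywhere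
  below, the inner product of \<open>H\<close> is that of \<open>L\<^sup>2(M)\<close>.
\<close>

definition bounded_operator ::
    "'a measure \<Rightarrow> ('a \<Rightarrow> complex) set \<Rightarrow> (('a \<Rightarrow> complex) \<Rightarrow> 'a \<Rightarrow> complex) \<Rightarrow> bool" where
  "bounded_operator M H T \<longleftrightarrow>
     (\<forall>f\<in>H. T f \<in> H) \<and>
     (\<forall>f\<in>H. \<forall>g\<in>H. T (\<lambda>z. f z + g z) = (\<lambda>z. T f z + T g z)) \<and>
     (\<forall>c. \<forall>f\<in>H. T (\<lambda>z. c * f z) = (\<lambda>z. c * T f z)) \<and>
     (\<exists>C. \<forall>f\<in>H. l2_norm M (T f) \<le> C * l2_norm M f)"

definition compact_operator ::
    "'a measure \<Rightarrow> ('a \<Rightarrow> complex) set \<Rightarrow> (('a \<Rightarrow> complex) \<Rightarrow> 'a \<Rightarrow> complex) \<Rightarrow> bool" where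
  "compact_operator M H T \<longleftrightarrow> bounded_operator M H T \<and>
     (\<forall>F :: nat \<Rightarrow> 'a \<Rightarrow> complex.
        (\<forall>k. F k \<in> H) \<and> (\<exists>B. \<forall>k. l2_norm M (F k) \<le> B) \<longrightarrow>
        (\<exists>g\<in>H. \<exists>r :: nat \<Rightarrow> nat. strict_mono r \<and>
           (\<lambda>k. l2_norm M (\<lambda>z. T (F (r k)) z - g z)) \<longlonglongrightarrow> 0))"

definition adjoint_operator ::
    "'a measure \<Rightarrow> ('a \<Rightarrow> complex) set \<Rightarrow> (('a \<Rightarrow> complex) \<Rightarrow> 'a \<Rightarrow> complex)
       \<Rightarrow> ('a \<Rightarrow> complex) \<Rightarrow> 'a \<Rightarrow> complex" where
  "adjoint_operator M H T g =
     (THE h. h \<in> H \<and> (\<forall>f\<in>H. l2_inner M (T f) g = l2_inner M f h))"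

text \<open>The complex vector space of all functions, in which the eigenspaces below live.\<close>

abbreviation fun_scale :: "complex \<Rightarrow> ('a \<Rightarrow> complex) \<Rightarrow> 'a \<Rightarrow> complex" where
  "fun_scale c f \<equiv> (\<lambda>z. c * f z)"

lemma vector_space_fun_scale:
  "vector_space (fun_scale :: complex \<Rightarrow> ('a \<Rightarrow> complex) \<Rightarrow> 'a \<Rightarrow> complex)"
  by unfold_locales (auto simp: fun_eq_iff algebra_simps)

text \<open>
  Eigenspace of \<open>T\<^sup>* T\<close> for the eigenvalue \<open>t\<^sup>2\<close>, i.e. (for \<open>t \<ge> 0\<close>) of \<open>(T\<^sup>* T)\<^sup>1\<^sup>/\<^sup>2\<close> for \<open>t\<close>.
\<close>

definition singular_space ::
    "'a measure \<Rightarrow> ('a \<Rightarrow> complex) set \<Rightarrow> (('a \<Rightarrow> complex) \<Rightarrow> 'a \<Rightarrow> complex) \<Rightarrow> real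
       \<Rightarrow> ('a \<Rightarrow> complex) set" where
  "singular_space M H T t =
     {f \<in> H. adjoint_operator M H T (T f) = fun_scale (complex_of_real (t\<^sup>2)) f}"

text \<open>
  The positive eigenvalues of \<open>(T\<^sup>* T)\<^sup>1\<^sup>/\<^sup>2\<close> in decreasing order, repeated according to multiplicity,
  followed by zeros if there are only finitely many. Indices start at 0, so
  \<open>singular_values M H T k\<close> is \<open>s\<^bsub>k+1\<^esub>(T)\<close>. Meaningful for compact \<open>T\<close>: then all
  multiplicities are finite and exactly one sequence has these properties.
\<close>

definition singular_values ::
    "'a measure \<Rightarrow> ('a \<Rightarrow> complex) set \<Rightarrow> (('a \<Rightarrow> complex) \<Rightarrow> 'a \<Rightarrow> complex) \<Rightarrow> nat \<Rightarrow> real" where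
  "singular_values M H T = (THE s. decseq s \<and> s \<longlonglongrightarrow> 0 \<and>
     (\<forall>t>0. card {k. s k = t} = vector_space.dim fun_scale (singular_space M H T t)))"

definition fin_supp :: "(nat \<Rightarrow> real) set" where
  "fin_supp = {x. finite {k. x k \<noteq> 0}}"

definition symmetric_norming :: "((nat \<Rightarrow> real) \<Rightarrow> real) \<Rightarrow> bool" where
  "symmetric_norming \<Phi> \<longleftrightarrow>
     (\<forall>x\<in>fin_supp. 0 \<le> \<Phi> x \<and> (\<Phi> x = 0 \<longleftrightarrow> x = (\<lambda>k. 0))) \<and>
     (\<forall>c. \<forall>x\<in>fin_supp. \<Phi> (\<lambda>k. c * x k) = \<bar>c\<bar> * \<Phi> x) \<and>
     (\<forall>x\<in>fin_supp. \<forall>y\<in>fin_supp. \<Phi> (\<lambda>k. x k + y k) \<le> \<Phi> x + \<Phi> y) \<and>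
     \<Phi> (\<lambda>k. if k = 0 then 1 else 0) = 1 \<and>
     (\<forall>x\<in>fin_supp. \<forall>p. bij p \<longrightarrow> \<Phi> (\<lambda>k. x (p k)) = \<Phi> x) \<and>
     (\<forall>x\<in>fin_supp. \<Phi> (\<lambda>k. \<bar>x k\<bar>) = \<Phi> x)"

definition ideal_norm ::
    "((nat \<Rightarrow> real) \<Rightarrow> real) \<Rightarrow> 'a measure \<Rightarrow> ('a \<Rightarrow> complex) set
       \<Rightarrow> (('a \<Rightarrow> complex) \<Rightarrow> 'a \<Rightarrow> complex) \<Rightarrow> ereal" where
  "ideal_norm \<Phi> M H T =
     (SUP N\<in>{1..}. ereal (\<Phi> (\<lambda>k. if k < N then singular_values M H T k else 0)))"

definition symm_ideal ::
    "((nat \<Rightarrow> real) \<Rightarrow> real) \<Rightarrow> 'a measure \<Rightarrow> ('a \<Rightarrow> complex) set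
       \<Rightarrow> (('a \<Rightarrow> complex) \<Rightarrow> 'a \<Rightarrow> complex) set" where
  "symm_ideal \<Phi> M H = {T. compact_operator M H T \<and> ideal_norm \<Phi> M H T < \<infinity>}"

definition toeplitz_form ::
    "real \<Rightarrow> (complex ^ 'n) measure \<Rightarrow> (complex ^ 'n \<Rightarrow> complex) \<Rightarrow> (complex ^ 'n \<Rightarrow> complex)
       \<Rightarrow> complex" where
  "toeplitz_form \<alpha> \<mu> f g = (\<integral>z. f z * cnj (g z) * of_real (exp (- (norm z)\<^sup>2 / \<alpha>)) \<partial>\<mu>)"

definition toeplitz_bounded ::
    "real \<Rightarrow> (complex ^ 'n \<Rightarrow> complex) set \<Rightarrow> (complex ^ 'n) measure \<Rightarrow> bool" where
  "toeplitz_bounded \<alpha> H \<mu> \<longleftrightarrow>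
     (\<forall>f\<in>H. \<forall>g\<in>H.
        integrable \<mu> (\<lambda>z. f z * cnj (g z) * of_real (exp (- (norm z)\<^sup>2 / \<alpha>)))) \<and>
     (\<exists>C. \<forall>f\<in>H. \<forall>g\<in>H. cmod (toeplitz_form \<alpha> \<mu> f g)
        \<le> C * l2_norm (gauss_measure \<alpha>) f * l2_norm (gauss_measure \<alpha>) g)"

text \<open>Meaningful when the form is bounded on the Hilbert space \<open>H\<close> (Riesz representation).\<close>

definition toeplitz_op ::
    "real \<Rightarrow> (complex ^ 'n \<Rightarrow> complex) set \<Rightarrow> (complex ^ 'n) measure
       \<Rightarrow> (complex ^ 'n \<Rightarrow> complex) \<Rightarrow> complex ^ 'n \<Rightarrow> complex" where
  "toeplitz_op \<alpha> H \<mu> f =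
     (THE h. h \<in> H \<and> (\<forall>g\<in>H. l2_inner (gauss_measure \<alpha>) h g = toeplitz_form \<alpha> \<mu> f g))"

definition toeplitz_in_ideal ::
    "((nat \<Rightarrow> real) \<Rightarrow> real) \<Rightarrow> real \<Rightarrow> (complex ^ 'n \<Rightarrow> complex) set \<Rightarrow> (complex ^ 'n) measure
       \<Rightarrow> bool" where
  "toeplitz_in_ideal \<Phi> \<alpha> H \<mu> \<longleftrightarrow>
     toeplitz_bounded \<alpha> H \<mu> \<and> toeplitz_op \<alpha> H \<mu> \<in> symm_ideal \<Phi> (gauss_measure \<alpha>) H"

definition toeplitz_norm ::
    "((nat \<Rightarrow> real) \<Rightarrow> real) \<Rightarrow> real \<Rightarrow> (complex ^ 'n \<Rightarrow> complex) set \<Rightarrow> (complex ^ 'n) measure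
       \<Rightarrow> ereal" where
  "toeplitz_norm \<Phi> \<alpha> H \<mu> = ideal_norm \<Phi> (gauss_measure \<alpha>) H (toeplitz_op \<alpha> H \<mu>)"

definition toeplitz_sv ::
    "real \<Rightarrow> (complex ^ 'n \<Rightarrow> complex) set \<Rightarrow> (complex ^ 'n) measure \<Rightarrow> nat \<Rightarrow> real" where
  "toeplitz_sv \<alpha> H \<mu> = singular_values (gauss_measure \<alpha>) H (toeplitz_op \<alpha> H \<mu>)"

end

theory Submission
  imports Defs "HOL-Complex_Analysis.Complex_Analysis" "HOL-Probability.Probability"
begin

text \<open>
  A pluriharmonic function splits as \<open>g + cnj h\<close> with \<open>g\<close>, \<open>h\<close> entire and \<open>h 0 = 0\<close>, and the two
  summands are orthogonal in \<open>L\<^sup>2\<close> of the Gaussian measure by the mean value property. Hence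
  \<open>PH\<^sup>2 = F\<^sup>2 + cnj F\<^sup>2\<close>. Let \<open>J\<close> be the embedding of \<open>PH\<^sup>2\<close> into \<open>L\<^sup>2\<close> of the measure
  \<open>exp (-|z|\<^sup>2/\<alpha>) d\<mu>\<close>, and \<open>J\<^sub>1\<close>, \<open>J\<^sub>2\<close> its restrictions to \<open>F\<^sup>2\<close> and \<open>cnj F\<^sup>2\<close>. The pluriharmonic
  Toeplitz operator \<open>J\<^sup>* J\<close> has the nonzero eigenvalues of \<open>J J\<^sup>* \<le> J\<^sub>1 J\<^sub>1\<^sup>* + J\<^sub>2 J\<^sub>2\<^sup>*\<close>, and both terms on
  the right have those of \<open>T\<^sub>\<mu> = J\<^sub>1\<^sup>* J\<^sub>1\<close>. Ky Fan's inequality yields the factor 2 for partial sums of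
  singular values, and his dominance principle carries it over to symmetric norms; the lower bound holds
  because \<open>T\<^sub>\<mu>\<close> is a compression. Everything is expressed through the sesquilinear forms \<open>\<langle>f, g\<rangle>\<close> and
  \<open>q\<^sub>\<mu>(f, g)\<close>. For a point mass at \<open>a\<close> both operators have rank one, and the ratio of their norms is
  \<open>2 - exp (-|a|\<^sup>2/\<alpha>)\<close>, which is 1 for \<open>a = 0\<close> and tends to 2.
\<close>

section \<open>Positive semidefinite forms\<close>

text \<open>The measure \<open>\<mu>\<close> is arbitrary, so nonzero functions may vanish almost
  everywhere and q is only semidefinite. Hence there are two forms on one carrier set of functions,
  a complete definite \<open>ip\<close> and a possibly degenerate \<open>q\<close>, and J becomes
  the identity map between their seminorms. The operator J J^* itself is never formed: that g is the
  image of v under the adjoint of J is stated as q v w = ip g w for all w. Eigenvectors come from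
  maximizing q on unit balls of successive orthogonal complements; the same construction, applied to
  a form of rank one, yields the Riesz representation theorem. The comparison of J J^* with J1 J1^*
  + J2 J2^* is not an equality, because the constants lie in both F^2 and cnj F^2 and are counted
  twice. Taking all of cnj F^2, rather than only its functions vanishing at 0, is what gives both
  summands the nonzero eigenvalues of the Fock Toeplitz operator: pointwise conjugation then maps
  one space onto the other and leaves |f|^2, hence both quadratic forms, unchanged.\<close>

locale psd_form = vector_space scl for scl :: "complex \<Rightarrow> 'v::ab_group_add \<Rightarrow> 'v" (infixr "\<cdot>" 75) +
  fixes V :: "'v set" and B :: "'v \<Rightarrow> 'v \<Rightarrow> complex"
  assumes subspace_V: "subspace V"
    and add_left: "\<And>x y z. \<lbrakk>x \<in> V; y \<in> V; z \<in> V\<rbrakk> \<Longrightarrow> B (x + y) z = B x z + B y z"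
    and scale_left: "\<And>c x z. \<lbrakk>x \<in> V; z \<in> V\<rbrakk> \<Longrightarrow> B (c \<cdot> x) z = c * B x z"
    and sym: "\<And>x y. \<lbrakk>x \<in> V; y \<in> V\<rbrakk> \<Longrightarrow> B y x = cnj (B x y)"
    and nonneg: "\<And>x. x \<in> V \<Longrightarrow> 0 \<le> Re (B x x)"
begin

abbreviation nq :: "'v \<Rightarrow> real" where "nq x \<equiv> Re (B x x)"

lemma zero_V [simp]: "0 \<in> V"
  and add_V [simp]: "\<lbrakk>x \<in> V; y \<in> V\<rbrakk> \<Longrightarrow> x + y \<in> V"
  and diff_V [simp]: "\<lbrakk>x \<in> V; y \<in> V\<rbrakk> \<Longrightarrow> x - y \<in> V"
  and scale_V [simp]: "x \<in> V \<Longrightarrow> c \<cdot> x \<in> V"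
  and uminus_V [simp]: "x \<in> V \<Longrightarrow> - x \<in> V"
  and sum_V [simp]: "(\<And>i. i \<in> A \<Longrightarrow> f i \<in> V) \<Longrightarrow> sum f A \<in> V"
  using subspace_V
  by (auto simp: subspace_0 subspace_add subspace_diff subspace_scale subspace_neg intro: subspace_sum)

lemma add_right: "\<lbrakk>x \<in> V; y \<in> V; z \<in> V\<rbrakk> \<Longrightarrow> B z (x + y) = B z x + B z y"
  by (metis add_V add_left complex_cnj_add sym)

lemma scale_right: "\<lbrakk>x \<in> V; z \<in> V\<rbrakk> \<Longrightarrow> B z (c \<cdot> x) = cnj c * B z x"
  by (metis complex_cnj_mult scale_V scale_left sym)

lemma zero_left [simp]: "z \<in> V \<Longrightarrow> B 0 z = 0"
  using scale_left[of 0 z 0] by simp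

lemma zero_right [simp]: "z \<in> V \<Longrightarrow> B z 0 = 0"
  using scale_right[of 0 z 0] by simp

lemma uminus_left: "\<lbrakk>x \<in> V; z \<in> V\<rbrakk> \<Longrightarrow> B (- x) z = - B x z"
  using scale_left[of x z "-1"] by simp

lemma uminus_right: "\<lbrakk>x \<in> V; z \<in> V\<rbrakk> \<Longrightarrow> B z (- x) = - B z x"
  using scale_right[of x z "-1"] by simp

lemma diff_left: "\<lbrakk>x \<in> V; y \<in> V; z \<in> V\<rbrakk> \<Longrightarrow> B (x - y) z = B x z - B y z"
  using add_left[of x "- y" z] by (simp add: uminus_left)

lemma diff_right: "\<lbrakk>x \<in> V; y \<in> V; z \<in> V\<rbrakk> \<Longrightarrow> B z (x - y) = B z x - B z y"
  using add_right[of x "- y" z] by (simp add: uminus_right)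

lemma sum_left:
  assumes "\<And>i. i \<in> A \<Longrightarrow> f i \<in> V" "z \<in> V"
  shows "B (\<Sum>i\<in>A. f i) z = (\<Sum>i\<in>A. B (f i) z)"
  using assms by (induction A rule: infinite_finite_induct) (auto simp: add_left)

lemma sum_right:
  assumes "\<And>i. i \<in> A \<Longrightarrow> f i \<in> V" "z \<in> V"
  shows "B z (\<Sum>i\<in>A. f i) = (\<Sum>i\<in>A. B z (f i))"
  using assms by (induction A rule: infinite_finite_induct) (auto simp: add_right)

lemma self_real: "x \<in> V \<Longrightarrow> B x x = complex_of_real (nq x)"
  using sym[of x x] by (simp add: complex_eq_iff)

lemma nq_scale: "x \<in> V \<Longrightarrow> nq (c \<cdot> x) = (cmod c)\<^sup>2 * nq x"
proof -
  assume x: "x \<in> V"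
  have "B (c \<cdot> x) (c \<cdot> x) = (c * cnj c) * B x x"
    using x by (simp add: scale_left scale_right)
  also have "\<dots> = of_real ((cmod c)\<^sup>2 * nq x)"
    by (subst self_real[OF x]) (simp only: complex_norm_square[symmetric] of_real_mult)
  finally show ?thesis by (simp only: Re_complex_of_real)
qed

lemma nq_add: "\<lbrakk>x \<in> V; y \<in> V\<rbrakk> \<Longrightarrow> nq (x + y) = nq x + nq y + 2 * Re (B x y)"
  using sym[of x y] by (simp add: add_left add_right)

lemma nq_diff: "\<lbrakk>x \<in> V; y \<in> V\<rbrakk> \<Longrightarrow> nq (x - y) = nq x + nq y - 2 * Re (B x y)"
  using sym[of x y] by (simp add: diff_left diff_right)

lemma nq_minus_commute: "\<lbrakk>x \<in> V; y \<in> V\<rbrakk> \<Longrightarrow> nq (x - y) = nq (y - x)"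
  using sym[of x y] by (simp add: nq_diff)

lemma nq_add_le: "\<lbrakk>x \<in> V; y \<in> V\<rbrakk> \<Longrightarrow> nq (x + y) \<le> 2 * nq x + 2 * nq y"
  using nonneg[of "x - y"] by (simp add: nq_add nq_diff)

lemma nq_diff_le: "\<lbrakk>x \<in> V; y \<in> V\<rbrakk> \<Longrightarrow> nq (x - y) \<le> 2 * nq x + 2 * nq y"
  using nonneg[of "x + y"] by (simp add: nq_add nq_diff)

lemma cauchy_schwarz:
  assumes x: "x \<in> V" and y: "y \<in> V"
  shows "(cmod (B x y))\<^sup>2 \<le> nq x * nq y"
proof -
  define b where "b = (cmod (B x y))\<^sup>2"
  have key: "0 \<le> nq x - 2 * t * b + t\<^sup>2 * b * nq y" for t :: real
  proof -
    \<comment> \<open>This phase turns B x (c y) into t |B x y|^2, so that nonnegativity of the form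
      at x - c y becomes a real quadratic inequality in t.\<close>
    define c where "c = of_real t * B x y"
    have "Re (B x (c \<cdot> y)) = t * b"
      using x y
      by (simp add: scale_right c_def b_def mult.assoc cmod_power2 power2_eq_square[of "Re _"] power2_eq_square[of "Im _"])
    moreover have "(cmod c)\<^sup>2 = t\<^sup>2 * b"
      by (simp add: c_def b_def norm_mult power_mult_distrib)
    ultimately show ?thesis
      using nonneg[of "x - c \<cdot> y"] x y by (simp add: nq_diff nq_scale)
  qed
  show ?thesis
  proof (cases "nq y = 0")
    case True
    have "b = 0"
    proof (rule ccontr)
      assume "b \<noteq> 0"
      then have "0 < b" by (simp add: b_def)
      \<comment> \<open>With nq y = 0 the inequality \<open>key\<close> is affine in t, and this
        value of t makes its right side -nq x - 2 < 0.\<close>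
      have "2 * ((nq x + 1) / b) * b = 2 * nq x + 2"
        using \<open>0 < b\<close> by (simp add: field_simps)
      then show False
        using key[of "(nq x + 1) / b"] True nonneg[OF x] by simp
    qed
    then show ?thesis using True by (simp add: b_def)
  next
    case False
    then have p: "0 < nq y" using nonneg[OF y] by simp
    have "(1 / nq y)\<^sup>2 * b * nq y = b / nq y"
      using p by (simp add: field_simps power2_eq_square)
    then have "0 \<le> nq x - b / nq y" using key[of "1 / nq y"] by simp
    then have "b / nq y \<le> nq x" by simp
    then show ?thesis using p by (simp add: b_def pos_divide_le_eq)
  qed
qed

lemma cmod_le: "\<lbrakk>x \<in> V; y \<in> V\<rbrakk> \<Longrightarrow> cmod (B x y) \<le> sqrt (nq x) * sqrt (nq y)"
  using cauchy_schwarz[of x y] by (metis real_le_rsqrt real_sqrt_mult)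

lemma null_left: "\<lbrakk>x \<in> V; y \<in> V; nq x = 0\<rbrakk> \<Longrightarrow> B x y = 0"
  using cauchy_schwarz[of x y] by simp

lemma null_right: "\<lbrakk>x \<in> V; y \<in> V; nq y = 0\<rbrakk> \<Longrightarrow> B x y = 0"
  using cauchy_schwarz[of x y] by simp

lemma sqrt_nq_triangle:
  assumes x: "x \<in> V" and y: "y \<in> V"
  shows "sqrt (nq (x + y)) \<le> sqrt (nq x) + sqrt (nq y)"
proof (rule real_le_lsqrt)
  have "Re (B x y) \<le> sqrt (nq x) * sqrt (nq y)"
    using cmod_le[OF x y] complex_Re_le_cmod[of "B x y"] by linarith
  then show "nq (x + y) \<le> (sqrt (nq x) + sqrt (nq y))\<^sup>2"
    using nonneg x y by (simp add: nq_add power2_sum)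
qed (use nonneg x y in auto)

lemma sqrt_nq_triangle_sub:
  assumes x: "x \<in> V" and y: "y \<in> V"
  shows "sqrt (nq x) \<le> sqrt (nq y) + sqrt (nq (x - y))"
  using sqrt_nq_triangle[of y "x - y"] assms by simp

lemma psd_form_subspace:
  assumes "W \<subseteq> V" "subspace W"
  shows "psd_form scl W B"
  using assms by unfold_locales (auto simp: subsetD add_left scale_left intro!: nonneg sym)

definition orthonormal_or_zero :: "'i set \<Rightarrow> ('i \<Rightarrow> 'v) \<Rightarrow> bool" where
  "orthonormal_or_zero A w \<longleftrightarrow> (\<forall>i\<in>A. w i \<in> V \<and> nq (w i) \<in> {0, 1}) \<and>
     (\<forall>i\<in>A. \<forall>j\<in>A. i \<noteq> j \<longrightarrow> B (w i) (w j) = 0)"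

lemma orthonormal_residual:
  assumes "finite A" and w: "orthonormal_or_zero A w" and x: "x \<in> V"
  defines "x' \<equiv> x - (\<Sum>i\<in>A. B x (w i) \<cdot> w i)"
  shows "x' \<in> V" "\<And>i. i \<in> A \<Longrightarrow> B x' (w i) = 0"
    and "nq x' = nq x - (\<Sum>i\<in>A. (cmod (B x (w i)))\<^sup>2)"
proof -
  have A: "finite A" "\<And>i. i \<in> A \<Longrightarrow> w i \<in> V"
    and orth: "\<And>i j. \<lbrakk>i \<in> A; j \<in> A; i \<noteq> j\<rbrakk> \<Longrightarrow> B (w i) (w j) = 0"
    and unit: "\<And>i. i \<in> A \<Longrightarrow> nq (w i) \<in> {0, 1}"
    using assms by (simp_all add: orthonormal_or_zero_def)
  have s: "(\<Sum>i\<in>A. B x (w i) \<cdot> w i) \<in> V" using A by simp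
  show x': "x' \<in> V" using s x by (simp add: x'_def)
  show o: "B x' (w i) = 0" if i: "i \<in> A" for i
  proof -
    have "B (\<Sum>j\<in>A. B x (w j) \<cdot> w j) (w i) = (\<Sum>j\<in>A. B x (w j) * B (w j) (w i))"
      using A i by (simp add: sum_left scale_left)
    also have "\<dots> = (\<Sum>j\<in>A. if j = i then B x (w i) * B (w i) (w i) else 0)"
      using orth i by (intro sum.cong) auto
    also have "\<dots> = B x (w i) * B (w i) (w i)"
      using A i by simp
    \<comment> \<open>If w i is a unit vector the factor B (w i) (w i) is 1; if it is null, both
      sides vanish.\<close>
    also have "\<dots> = B x (w i)"
      using unit[OF i] self_real[of "w i"] null_right[of x "w i"] A(2)[OF i] x by auto
    finally show ?thesis
      using s x A(2)[OF i] by (simp add: x'_def diff_left)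
  qed
  have "B x' x' = B x' x - B x' (\<Sum>i\<in>A. B x (w i) \<cdot> w i)"
    using diff_right[OF x s x'] by (simp add: x'_def)
  also have "B x' (\<Sum>i\<in>A. B x (w i) \<cdot> w i) = 0"
    using A x' o by (simp add: sum_right scale_right)
  also have "B x' x = B x x - (\<Sum>i\<in>A. B x (w i) * B (w i) x)"
    using s x A by (simp add: x'_def diff_left sum_left scale_left)
  also have "(\<Sum>i\<in>A. B x (w i) * B (w i) x) = (\<Sum>i\<in>A. of_real ((cmod (B x (w i)))\<^sup>2))"
  proof (intro sum.cong refl)
    fix i assume "i \<in> A"
    then have "B (w i) x = cnj (B x (w i))" using A x sym by blast
    then show "B x (w i) * B (w i) x = of_real ((cmod (B x (w i)))\<^sup>2)"
      by (simp only: complex_norm_square)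
  qed
  finally show "nq x' = nq x - (\<Sum>i\<in>A. (cmod (B x (w i)))\<^sup>2)" by simp
qed

lemma bessel:
  assumes "finite A" "orthonormal_or_zero A w" "x \<in> V"
  shows "(\<Sum>i\<in>A. (cmod (B x (w i)))\<^sup>2) \<le> nq x"
  using orthonormal_residual(1,3)[OF assms] nonneg by fastforce

end

section \<open>Complete forms, relative compactness and the variational eigensystem\<close>

locale hilbert_form = psd_form scl V B
  for scl :: "complex \<Rightarrow> 'v::ab_group_add \<Rightarrow> 'v" (infixr "\<cdot>" 75) and V B +
  assumes definite: "\<And>x. \<lbrakk>x \<in> V; nq x = 0\<rbrakk> \<Longrightarrow> x = 0"
    and complete: "\<And>F :: nat \<Rightarrow> 'v. \<lbrakk>\<And>k. F k \<in> V;
        \<And>e. e > 0 \<Longrightarrow> \<exists>N. \<forall>m\<ge>N. \<forall>n\<ge>N. nq (F m - F n) < e\<rbrakk>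
        \<Longrightarrow> \<exists>g\<in>V. (\<lambda>k. nq (F k - g)) \<longlonglongrightarrow> 0"

text \<open>Compactness of the identity map J from the seminorm of \<open>ip\<close> to that of
  \<open>q\<close>. Cauchy subsequences replace convergent ones because the carrier is in general
  not complete for \<open>q\<close>.\<close>

definition form_compact ::
    "'v::ab_group_add set \<Rightarrow> ('v \<Rightarrow> 'v \<Rightarrow> complex) \<Rightarrow> ('v \<Rightarrow> 'v \<Rightarrow> complex) \<Rightarrow> bool" where
  "form_compact V ip q \<longleftrightarrow> (\<forall>F :: nat \<Rightarrow> 'v.
     (\<forall>k. F k \<in> V) \<and> (\<exists>b. \<forall>k. Re (ip (F k) (F k)) \<le> b) \<longrightarrow>
     (\<exists>r :: nat \<Rightarrow> nat. strict_mono r \<and> (\<forall>e>0. \<exists>N. \<forall>m\<ge>N. \<forall>n\<ge>N.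
        Re (q (F (r m) - F (r n)) (F (r m) - F (r n))) < e)))"

lemma form_compactD:
  fixes F :: "nat \<Rightarrow> 'v::ab_group_add"
  assumes "form_compact V ip q" "\<And>k. F k \<in> V" "\<And>k. Re (ip (F k) (F k)) \<le> b"
  shows "\<exists>r :: nat \<Rightarrow> nat. strict_mono r \<and> (\<forall>e>0. \<exists>N. \<forall>m\<ge>N. \<forall>n\<ge>N.
       Re (q (F (r m) - F (r n)) (F (r m) - F (r n))) < e)"
  using assms(1)[unfolded form_compact_def, rule_format, of F] assms(2,3) by blast

context psd_form
begin

text \<open>A form of rank one depends on f only through the number phi f, so the
  Bolzano-Weierstrass theorem in the complex plane supplies the subsequence. This serves both the
  Riesz theorem and point masses.\<close>

lemma form_compact_functional:
  assumes diff: "\<And>f g. \<lbrakk>f \<in> V; g \<in> V\<rbrakk> \<Longrightarrow> \<phi> (f - g) = \<phi> f - \<phi> g"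
    and bdd: "\<And>f. f \<in> V \<Longrightarrow> (cmod (\<phi> f))\<^sup>2 \<le> C * nq f"
    and q: "\<And>f. f \<in> V \<Longrightarrow> Re (q f f) = (cmod (\<phi> f))\<^sup>2"
  shows "form_compact V B q"
  unfolding form_compact_def
proof (intro allI impI, elim conjE exE)
  fix F :: "nat \<Rightarrow> 'v" and b
  assume F: "\<forall>k. F k \<in> V" and b: "\<forall>k. nq (F k) \<le> b"
  have "cmod (\<phi> (F k)) \<le> sqrt (\<bar>C\<bar> * b)" for k
  proof (rule real_le_rsqrt)
    have "(cmod (\<phi> (F k)))\<^sup>2 \<le> C * nq (F k)" using bdd F by blast
    also have "\<dots> \<le> \<bar>C\<bar> * nq (F k)" using nonneg F by (intro mult_right_mono) auto
    also have "\<dots> \<le> \<bar>C\<bar> * b" using b by (intro mult_left_mono) auto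
    finally show "(cmod (\<phi> (F k)))\<^sup>2 \<le> \<bar>C\<bar> * b" .
  qed
  then have "bounded (range (\<lambda>k. \<phi> (F k)))" by (auto simp: bounded_iff)
  then obtain l and r :: "nat \<Rightarrow> nat" where r: "strict_mono r"
    and l: "((\<lambda>k. \<phi> (F k)) \<circ> r) \<longlonglongrightarrow> l"
    using bounded_imp_convergent_subsequence[of "\<lambda>k. \<phi> (F k)"] by blast
  have cau: "Cauchy (\<lambda>k. \<phi> (F (r k)))"
    using LIMSEQ_imp_Cauchy[OF l] by (simp add: o_def)
  have "\<exists>N. \<forall>m\<ge>N. \<forall>n\<ge>N. Re (q (F (r m) - F (r n)) (F (r m) - F (r n))) < e" if e: "e > 0" for e
  proof -
    obtain N where N: "\<And>m n. \<lbrakk>m \<ge> N; n \<ge> N\<rbrakk> \<Longrightarrow> norm (\<phi> (F (r m)) - \<phi> (F (r n))) < sqrt e"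
      using CauchyD[OF cau, of "sqrt e"] e real_sqrt_gt_0_iff by blast
    have "Re (q (F (r m) - F (r n)) (F (r m) - F (r n))) < e" if "m \<ge> N" "n \<ge> N" for m n
    proof -
      have FV: "F (r m) - F (r n) \<in> V" using F by simp
      have "cmod (\<phi> (F (r m) - F (r n))) < sqrt e" using N[OF that] F by (simp add: diff)
      then show ?thesis
        unfolding q[OF FV] using e power_strict_mono[of "cmod (\<phi> (F (r m) - F (r n)))" "sqrt e" 2]
        by simp
    qed
    then show ?thesis by blast
  qed
  then show "\<exists>r :: nat \<Rightarrow> nat. strict_mono r \<and> (\<forall>e>0. \<exists>N. \<forall>m\<ge>N. \<forall>n\<ge>N.
      Re (q (F (r m) - F (r n)) (F (r m) - F (r n))) < e)"
    using r by blast
qed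

end

text \<open>
  Eigenvectors of the operator representing \<open>q\<close>. Those belonging to the eigenvalue 0 are not
  recorded: they are replaced by the zero vector.
\<close>

definition eigensystem ::
    "'v::ab_group_add set \<Rightarrow> ('v \<Rightarrow> 'v \<Rightarrow> complex) \<Rightarrow> ('v \<Rightarrow> 'v \<Rightarrow> complex)
       \<Rightarrow> (nat \<Rightarrow> 'v) \<Rightarrow> (nat \<Rightarrow> real) \<Rightarrow> bool" where
  "eigensystem V ip q e l \<longleftrightarrow>
     (\<forall>k. e k \<in> V) \<and> decseq l \<and> (\<forall>k. 0 \<le> l k) \<and> l \<longlonglongrightarrow> 0 \<and>
     (\<forall>k. \<forall>f\<in>V. q (e k) f = of_real (l k) * ip (e k) f) \<and>
     (\<forall>j k. j \<noteq> k \<longrightarrow> ip (e j) (e k) = 0) \<and>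
     (\<forall>k. Re (ip (e k) (e k)) = (if l k = 0 then 0 else 1)) \<and>
     (\<forall>k. \<forall>f\<in>V. (\<forall>j<k. ip f (e j) = 0) \<longrightarrow> Re (q f f) \<le> l k * Re (ip f f))"

locale form_pair = ip: hilbert_form scl V ip + q: psd_form scl V q
  for scl :: "complex \<Rightarrow> 'v::ab_group_add \<Rightarrow> 'v" (infixr "\<cdot>" 75) and V ip q +
  assumes bounded: "\<exists>C. \<forall>f\<in>V. Re (q f f) \<le> C * Re (ip f f)"
begin

text \<open>The norm of the compression of the representing operator to the orthogonal complement of
  S, that is, the next eigenvalue in the variational principle. Using the ball instead of the sphere
  keeps the set nonempty when that complement is trivial.\<close>

definition unit_sup :: "'v set \<Rightarrow> real" where
  "unit_sup S = Sup {q.nq f |f. f \<in> V \<and> (\<forall>s\<in>S. ip f s = 0) \<and> ip.nq f \<le> 1}"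

lemma unit_sup_bdd: "bdd_above {q.nq f |f. f \<in> V \<and> (\<forall>s\<in>S. ip f s = 0) \<and> ip.nq f \<le> 1}"
proof -
  obtain C where C: "\<forall>f\<in>V. q.nq f \<le> C * ip.nq f" using bounded by blast
  have "q.nq f \<le> \<bar>C\<bar>" if "f \<in> V" "ip.nq f \<le> 1" for f
  proof -
    have "q.nq f \<le> C * ip.nq f" using C that by blast
    also have "\<dots> \<le> \<bar>C\<bar> * ip.nq f" using ip.nonneg that by (intro mult_right_mono) auto
    also have "\<dots> \<le> \<bar>C\<bar> * 1" using that by (intro mult_left_mono) auto
    finally show ?thesis by simp
  qed
  then show ?thesis by (intro bdd_aboveI[of _ "\<bar>C\<bar>"]) auto
qed

lemma unit_sup_nonempty:
  "S \<subseteq> V \<Longrightarrow> {q.nq f |f. f \<in> V \<and> (\<forall>s\<in>S. ip f s = 0) \<and> ip.nq f \<le> 1} \<noteq> {}"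
  by (auto intro!: exI[of _ 0] simp: subset_iff)

lemma unit_sup_upper:
  "\<lbrakk>f \<in> V; \<forall>s\<in>S. ip f s = 0; ip.nq f \<le> 1\<rbrakk> \<Longrightarrow> q.nq f \<le> unit_sup S"
  unfolding unit_sup_def by (rule cSup_upper[OF _ unit_sup_bdd]) auto

lemma unit_sup_nonneg: "S \<subseteq> V \<Longrightarrow> 0 \<le> unit_sup S"
  using unit_sup_upper[of 0 S] by (auto simp: subset_iff)

lemma unit_sup_antimono: "\<lbrakk>S \<subseteq> S'; S' \<subseteq> V\<rbrakk> \<Longrightarrow> unit_sup S' \<le> unit_sup S"
  unfolding unit_sup_def
  by (rule cSup_subset_mono[OF unit_sup_nonempty unit_sup_bdd]) auto

lemma unit_sup_bound:
  assumes S: "S \<subseteq> V" and f: "f \<in> V" "\<forall>s\<in>S. ip f s = 0"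
  shows "q.nq f \<le> unit_sup S * ip.nq f"
proof (cases "ip.nq f = 0")
  case True
  then have "f = 0" using ip.definite f by simp
  then show ?thesis by simp
next
  case False
  then have p: "0 < ip.nq f" using ip.nonneg[OF f(1)] by simp
  define c where "c = complex_of_real (1 / sqrt (ip.nq f))"
  have c2: "(cmod c)\<^sup>2 = 1 / ip.nq f"
    using p by (simp add: c_def norm_divide power_divide)
  have "q.nq (c \<cdot> f) \<le> unit_sup S"
  proof (rule unit_sup_upper)
    show "ip.nq (c \<cdot> f) \<le> 1" using p unfolding ip.nq_scale[OF f(1)] c2 by simp
  qed (use f S in \<open>auto simp: ip.scale_left subset_iff\<close>)
  then have "q.nq f / ip.nq f \<le> unit_sup S"
    using f c2 by (simp add: q.nq_scale)
  then show ?thesis using p by (simp add: pos_divide_le_eq)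
qed

lemma subspace_orth: "S \<subseteq> V \<Longrightarrow> ip.subspace {f\<in>V. \<forall>s\<in>S. ip f s = 0}"
  unfolding ip.subspace_def by (auto simp: ip.add_left ip.scale_left subset_iff)

text \<open>On the complement W the form D = m ip - q is positive semidefinite, m being the
  supremum. Along a maximizing sequence D tends to 0, and compactness makes a subsequence q-Cauchy;
  together these make it ip-Cauchy. Its limit is a null vector of D, and Cauchy-Schwarz for D turns
  this into the eigenvalue equation on W.\<close>

lemma maximizer:
  assumes comp: "form_compact V ip q" and S: "S \<subseteq> V"
  shows "\<exists>e\<in>V. (\<forall>s\<in>S. ip e s = 0) \<and> ip.nq e = (if unit_sup S = 0 then 0 else 1) \<and>
    (\<forall>g\<in>V. (\<forall>s\<in>S. ip g s = 0) \<longrightarrow> q e g = of_real (unit_sup S) * ip e g)"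
proof (cases "unit_sup S = 0")
  case True
  then show ?thesis using S by (intro bexI[of _ 0]) (auto simp: subset_iff)
next
  case False
  define m where "m = unit_sup S"
  define W where "W = {f\<in>V. \<forall>s\<in>S. ip f s = 0}"
  define D where "D = (\<lambda>f g. of_real m * ip f g - q f g)"
  have m: "0 < m" using False unit_sup_nonneg[OF S] by (simp add: m_def)
  have WV: "W \<subseteq> V" by (auto simp: W_def)
  have W: "ip.subspace W" unfolding W_def by (rule subspace_orth[OF S])
  interpret D: psd_form scl W D
  proof unfold_locales
    show "ip.subspace W" by (rule W)
    show "0 \<le> Re (D x x)" if "x \<in> W" for x
      using unit_sup_bound[OF S, of x] that by (auto simp: D_def W_def m_def)
    show "D y x = cnj (D x y)" if "x \<in> W" "y \<in> W" for x y
      unfolding D_def using that WV by (subst ip.sym[of x y], auto, subst q.sym[of x y], auto)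
  qed (use WV in \<open>auto simp: D_def subset_iff ip.add_left q.add_left ip.scale_left q.scale_left
      algebra_simps\<close>)
  have "\<exists>f. f \<in> W \<and> ip.nq f \<le> 1 \<and> m - 1 / real (Suc k) < q.nq f" for k
  proof -
    have "m - 1 / real (Suc k) < m" by simp
    then obtain y where "y \<in> {q.nq f |f. f \<in> V \<and> (\<forall>s\<in>S. ip f s = 0) \<and> ip.nq f \<le> 1}"
        "m - 1 / real (Suc k) < y"
      unfolding m_def unit_sup_def less_cSup_iff[OF unit_sup_nonempty[OF S] unit_sup_bdd] by blast
    then show ?thesis by (auto simp: W_def)
  qed
  then obtain F where F: "\<And>k. F k \<in> W" "\<And>k. ip.nq (F k) \<le> 1"
    "\<And>k. m - 1 / real (Suc k) < q.nq (F k)"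
    by metis
  have FV: "F k \<in> V" for k using F(1) WV by auto
  obtain r :: "nat \<Rightarrow> nat" where r: "strict_mono r"
    "\<forall>e>0. \<exists>N. \<forall>i\<ge>N. \<forall>j\<ge>N. q.nq (F (r i) - F (r j)) < e"
    using form_compactD[of V ip q F 1, OF comp FV F(2)] by blast
  define G where "G = (\<lambda>k. F (r k))"
  have G: "G k \<in> W" "G k \<in> V" "ip.nq (G k) \<le> 1" "q.nq (G k) \<le> m" for k
  proof -
    show "G k \<in> W" "G k \<in> V" "ip.nq (G k) \<le> 1" using F(1,2) FV by (simp_all add: G_def)
    then show "q.nq (G k) \<le> m" unfolding m_def by (intro unit_sup_upper) (auto simp: W_def)
  qed
  have G_lower: "m - 1 / real (Suc k) \<le> q.nq (G k)" for k
  proof -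
    have "1 / real (Suc (r k)) \<le> 1 / real (Suc k)"
      using seq_suble[OF r(1), of k] by (intro divide_left_mono) auto
    then show ?thesis using F(3)[of "r k"] by (simp add: G_def)
  qed
  have DG: "D.nq (G k) \<le> 1 / real (Suc k)" for k
  proof -
    have "m * ip.nq (G k) \<le> m * 1" using G m by (intro mult_left_mono) auto
    then show ?thesis using G_lower[of k] by (simp add: D_def)
  qed
  have inv_lim: "(\<lambda>k. 1 / real (Suc k)) \<longlonglongrightarrow> 0"
    using LIMSEQ_inverse_real_of_nat by (simp add: inverse_eq_divide)
  have "\<exists>N. \<forall>i\<ge>N. \<forall>j\<ge>N. ip.nq (G i - G j) < e" if e: "e > 0" for e
  proof -
    obtain N1 where N1: "\<And>i j. \<lbrakk>i \<ge> N1; j \<ge> N1\<rbrakk> \<Longrightarrow> q.nq (G i - G j) < m * e / 2"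
      using r(2)[rule_format, of "m * e / 2"] m e unfolding G_def by auto
    \<comment> \<open>Four terms of size at most m e / 8 bound D by m e / 2; the q part contributes
      another m e / 2, and m ip = D + q.\<close>
    obtain N2 where N2: "\<And>i. i \<ge> N2 \<Longrightarrow> 1 / real (Suc i) < m * e / 8"
      using order_tendstoD(2)[OF inv_lim, of "m * e / 8"] m e
      unfolding eventually_sequentially by auto
    have "ip.nq (G i - G j) < e" if "i \<ge> max N1 N2" "j \<ge> max N1 N2" for i j
    proof -
      have "D.nq (G i - G j) \<le> 2 * D.nq (G i) + 2 * D.nq (G j)"
        using G by (intro D.nq_diff_le)
      also have "\<dots> < m * e / 2"
        using DG[of i] DG[of j] N2[of i] N2[of j] that by linarith
      finally have "m * ip.nq (G i - G j) - q.nq (G i - G j) < m * e / 2" by (simp add: D_def)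
      then have "m * ip.nq (G i - G j) < m * e" using N1[of i j] that by simp
      then show ?thesis using m by simp
    qed
    then show ?thesis by blast
  qed
  from ip.complete[OF G(2) this]
  obtain e where e: "e \<in> V" and lim: "(\<lambda>k. ip.nq (G k - e)) \<longlonglongrightarrow> 0" by blast
  obtain C where C: "\<forall>f\<in>V. q.nq f \<le> C * ip.nq f" using bounded by blast
  have limq: "(\<lambda>k. q.nq (G k - e)) \<longlonglongrightarrow> 0"
  proof (rule tendsto_sandwich[OF _ _ tendsto_const])
    show "\<forall>\<^sub>F k in sequentially. 0 \<le> q.nq (G k - e)" using q.nonneg G e by simp
    show "\<forall>\<^sub>F k in sequentially. q.nq (G k - e) \<le> C * ip.nq (G k - e)" using C G e by simp
    show "(\<lambda>k. C * ip.nq (G k - e)) \<longlonglongrightarrow> 0" using tendsto_mult_left[OF lim, of C] by simp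
  qed
  have orth: "ip e s = 0" if s: "s \<in> S" for s
  proof -
    have sV: "s \<in> V" using s S by auto
    have "(cmod (ip e s))\<^sup>2 \<le> ip.nq (G k - e) * ip.nq s" for k
      using ip.cauchy_schwarz[of "G k - e" s] G(1)[of k] s sV e
      by (simp add: ip.diff_left W_def)
    moreover have "(\<lambda>k. ip.nq (G k - e) * ip.nq s) \<longlonglongrightarrow> 0"
      using tendsto_mult_right[OF lim, of "ip.nq s"] by simp
    ultimately have "(cmod (ip e s))\<^sup>2 \<le> 0"
      by (intro LIMSEQ_le_const[of _ 0]) auto
    then show ?thesis by simp
  qed
  then have eW: "e \<in> W" using e by (simp add: W_def)
  have "D.nq e \<le> 2 * m * ip.nq (G k - e) + 2 * (1 / real (Suc k))" for k
  proof -
    have "D.nq e \<le> 2 * D.nq (G k) + 2 * D.nq (G k - e)"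
      using D.nq_diff_le[of "G k" "G k - e"] G eW by simp
    moreover have "D.nq (G k - e) \<le> m * ip.nq (G k - e)"
      using q.nonneg[of "G k - e"] G e by (simp add: D_def)
    ultimately show ?thesis using DG[of k] by simp
  qed
  moreover have "(\<lambda>k. 2 * m * ip.nq (G k - e) + 2 * (1 / real (Suc k))) \<longlonglongrightarrow> 2 * m * 0 + 2 * 0"
    by (intro tendsto_intros lim inv_lim)
  ultimately have "D.nq e \<le> 0"
    by (intro LIMSEQ_le_const[of _ 0]) auto
  then have De: "D.nq e = 0" using D.nonneg[OF eW] by simp
  \<comment> \<open>This is where maximality becomes an equation: a null vector of D pairs to 0 with
    all of W.\<close>
  have eigen: "q e g = of_real m * ip e g" if "g \<in> W" for g
    using D.null_left[OF eW that De] by (simp add: D_def)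
  have "sqrt (ip.nq e) \<le> 1 + sqrt (ip.nq (G k - e))" for k
  proof -
    have "sqrt (ip.nq e) \<le> sqrt (ip.nq (G k)) + sqrt (ip.nq (G k - e))"
      using ip.sqrt_nq_triangle_sub[of e "G k"] G e by (simp add: ip.nq_minus_commute)
    then show ?thesis using G(3)[of k] real_sqrt_le_1_iff[of "ip.nq (G k)"] by linarith
  qed
  moreover have "(\<lambda>k. 1 + sqrt (ip.nq (G k - e))) \<longlonglongrightarrow> 1 + sqrt 0"
    by (intro tendsto_intros lim)
  ultimately have "sqrt (ip.nq e) \<le> 1"
    by (intro LIMSEQ_le_const[of _ 1]) auto
  then have le1: "ip.nq e \<le> 1" by simp
  \<comment> \<open>The radicand may be negative for small k; \<open>sqrt\<close> is odd and
    increasing on all reals, so the estimate still holds. In the limit it gives m \<le> q e e = m ip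
    e e, hence e has norm at least 1.\<close>
  have "sqrt (m - 1 / real (Suc k)) - sqrt (q.nq (G k - e)) \<le> sqrt (q.nq e)" for k
  proof -
    have "sqrt (m - 1 / real (Suc k)) \<le> sqrt (q.nq (G k))" using G_lower[of k] by simp
    also have "\<dots> \<le> sqrt (q.nq e) + sqrt (q.nq (G k - e))"
      using q.sqrt_nq_triangle_sub[of "G k" e] G e by simp
    finally show ?thesis by simp
  qed
  moreover have "(\<lambda>k. sqrt (m - 1 / real (Suc k)) - sqrt (q.nq (G k - e))) \<longlonglongrightarrow> sqrt (m - 0) - sqrt 0"
    by (intro tendsto_intros limq inv_lim)
  ultimately have "sqrt m \<le> sqrt (q.nq e)"
    by (intro LIMSEQ_le_const2[of _ "sqrt m"]) auto
  then have "m \<le> q.nq e" by simp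
  also have "q.nq e = m * ip.nq e" using eigen[OF eW] by simp
  finally have "1 \<le> ip.nq e" using m by simp
  with le1 have "ip.nq e = 1" by simp
  then show ?thesis using False e orth eigen by (intro bexI[of _ e]) (auto simp: m_def W_def)
qed

text \<open>Deflation: each vector maximizes q on the orthogonal complement of its predecessors, so
  the values decrease because the complements shrink. When the supremum reaches 0, all later vectors
  are 0.\<close>

lemma eigensystem_exists:
  assumes comp: "form_compact V ip q"
  shows "\<exists>e l. eigensystem V ip q e l"
proof -
  define P where "P = (\<lambda>(f :: nat \<Rightarrow> 'v) n x. x \<in> V \<and> (\<forall>j<n. ip x (f j) = 0) \<and>
    ip.nq x = (if unit_sup (f ` {..<n}) = 0 then 0 else 1) \<and>
    (\<forall>g\<in>V. q x g = of_real (unit_sup (f ` {..<n})) * ip x g))"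
  have "\<exists>e. \<forall>n. P e n (e n)"
  proof (rule dependent_wellorder_choice[where P = P])
    \<comment> \<open>Well-ordered dependent choice requires that the condition on the n-th vector
      depend only on the earlier ones.\<close>
    fix r and f g :: "nat \<Rightarrow> 'v" and n :: nat
    assume eq: "\<And>y. y < n \<Longrightarrow> f y = g y"
    have im: "f ` {..<n} = g ` {..<n}" by (rule image_cong) (simp_all add: eq)
    have "(\<forall>j<n. ip r (f j) = 0) = (\<forall>j<n. ip r (g j) = 0)" by (simp add: eq)
    then show "P f n r = P g n r" unfolding P_def im by (rule arg_cong)
  next
    fix n and f :: "nat \<Rightarrow> 'v"
    assume IH: "\<And>y. y < n \<Longrightarrow> P f y (f y)"
    define S where "S = f ` {..<n}"
    have fV: "f j \<in> V" if "j < n" for j using IH[OF that] by (simp add: P_def)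
    have orth: "ip (f i) (f j) = 0" if "i < n" "j < n" "i \<noteq> j" for i j
    proof (cases "j < i")
      case True
      then show ?thesis using IH[OF that(1)] by (simp add: P_def)
    next
      case False
      then have "ip (f j) (f i) = 0" using IH[OF that(2)] that by (simp add: P_def)
      then show ?thesis using ip.sym[of "f j" "f i"] fV that by simp
    qed
    have unit: "ip.nq (f j) \<in> {0, 1}" if "j < n" for j using IH[OF that] by (simp add: P_def)
    have S: "S \<subseteq> V" using fV by (auto simp: S_def)
    obtain e where e: "e \<in> V" "\<forall>s\<in>S. ip e s = 0" "ip.nq e = (if unit_sup S = 0 then 0 else 1)"
      "\<And>g. \<lbrakk>g \<in> V; \<forall>s\<in>S. ip g s = 0\<rbrakk> \<Longrightarrow> q e g = of_real (unit_sup S) * ip e g"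
      using maximizer[OF comp S] by blast
    have e0: "ip e (f j) = 0" if "j < n" for j using e(2) that by (simp add: S_def)
    \<comment> \<open>So far the equation is tested only on the complement of S. It extends to V
      because the earlier vectors are eigenvectors orthogonal to e, which makes both sides vanish on
      their span.\<close>
    have "q e g = of_real (unit_sup S) * ip e g" if g: "g \<in> V" for g
    proof -
      define p where "p = (\<Sum>j<n. ip g (f j) \<cdot> f j)"
      have "ip.orthonormal_or_zero {..<n} f"
        using fV orth unit by (simp add: ip.orthonormal_or_zero_def)
      note res = ip.orthonormal_residual[OF finite_lessThan this g, folded p_def]
      have pV: "p \<in> V" using fV by (auto simp: p_def intro!: ip.sum_V)
      have g': "g - p \<in> V" "\<And>j. j < n \<Longrightarrow> ip (g - p) (f j) = 0"
        using res(1,2) by simp_all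
      have "q e (f j) = 0" if j: "j < n" for j
      proof -
        have "q (f j) e = 0"
          using IH[OF j] e(1) e0[OF j] ip.sym[of e "f j"] fV[OF j] by (simp add: P_def)
        then show ?thesis using q.sym[of "f j" e] e fV j by simp
      qed
      then have "q e p = 0"
        unfolding p_def using e fV
        by (subst q.sum_right) (auto simp: q.scale_right intro!: sum.neutral)
      moreover have "ip e p = 0"
        unfolding p_def using e e0 fV
        by (subst ip.sum_right) (auto simp: ip.scale_right intro!: sum.neutral)
      moreover have "q e (g - p) = of_real (unit_sup S) * ip e (g - p)"
        using g' by (intro e(4)) (auto simp: S_def)
      ultimately show ?thesis using e g pV by (simp add: q.diff_right ip.diff_right)
    qed
    then show "\<exists>r. P f n r" using e e0 by (intro exI[of _ e]) (simp add: P_def S_def)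
  qed
  then obtain e where e: "\<And>n. P e n (e n)" by blast
  define l where "l = (\<lambda>n. unit_sup (e ` {..<n}))"
  have eV: "e n \<in> V" and eigen: "\<And>g. g \<in> V \<Longrightarrow> q (e n) g = of_real (l n) * ip (e n) g"
    and unit: "ip.nq (e n) = (if l n = 0 then 0 else 1)" for n
    using e[of n] by (simp_all add: P_def l_def)
  have orth: "ip (e i) (e j) = 0" if "i \<noteq> j" for i j
  proof (cases "j < i")
    case True
    then show ?thesis using e[of i] by (simp add: P_def)
  next
    case False
    then have "ip (e j) (e i) = 0" using e[of j] that by (simp add: P_def)
    then show ?thesis using ip.sym[of "e j" "e i"] eV by simp
  qed
  have sub: "e ` {..<n} \<subseteq> V" for n using eV by auto
  have dec: "decseq l"
    unfolding decseq_def l_def by (intro allI impI unit_sup_antimono image_mono sub) simp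
  have l0: "0 \<le> l n" for n unfolding l_def by (intro unit_sup_nonneg sub)
  have "l \<longlonglongrightarrow> 0"
  proof (rule LIMSEQ_I)
    fix \<epsilon> :: real assume eps: "0 < \<epsilon>"
    have "\<exists>n. l n < \<epsilon>"
    proof (rule ccontr)
      assume "\<nexists>n. l n < \<epsilon>"
      then have big: "\<epsilon> \<le> l n" for n by (simp add: not_less)
      then have unit1: "ip.nq (e n) = 1" for n using unit[of n] big[of n] eps by auto
      then obtain r :: "nat \<Rightarrow> nat" where r: "strict_mono r"
        "\<forall>d>0. \<exists>N. \<forall>i\<ge>N. \<forall>j\<ge>N. q.nq (e (r i) - e (r j)) < d"
        using form_compactD[of V ip q e 1, OF comp eV eq_refl[OF unit1]] by blast
      obtain N where "\<forall>i\<ge>N. \<forall>j\<ge>N. q.nq (e (r i) - e (r j)) < \<epsilon>"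
        using r(2)[rule_format, OF eps] ..
      then have N: "q.nq (e (r N) - e (r (Suc N))) < \<epsilon>" by simp
      have ne: "r N \<noteq> r (Suc N)" using r(1) by (metis lessI less_irrefl strict_monoD)
      \<comment> \<open>Distinct eigenvectors are also q-orthogonal. If all eigenvalues were at
        least \<epsilon>, these squared q-distances would stay above \<epsilon> and no subsequence
        could be q-Cauchy.\<close>
      have "q.nq (e (r N) - e (r (Suc N))) = l (r N) + l (r (Suc N))"
        using eV eigen orth[OF ne] unit1 by (simp add: q.nq_diff)
      then show False using N big[of "r N"] l0[of "r (Suc N)"] by simp
    qed
    then obtain n where "l n < \<epsilon>" by blast
    then show "\<exists>no. \<forall>n\<ge>no. norm (l n - 0) < \<epsilon>"
      using decseqD[OF dec, of n] l0 by (intro exI[of _ n]) (auto intro: le_less_trans)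
  qed
  moreover have "q.nq f \<le> l k * ip.nq f" if "f \<in> V" "\<forall>j<k. ip f (e j) = 0" for k f
    unfolding l_def using that by (intro unit_sup_bound sub) auto
  ultimately have "eigensystem V ip q e l"
    unfolding eigensystem_def using eV dec l0 eigen orth unit by simp
  then show ?thesis by blast
qed

end

context hilbert_form
begin

text \<open>The eigenvector of the rank one form \<open>\<phi>(f) cnj (\<phi>(g))\<close> represents \<open>\<phi>\<close>.\<close>

lemma riesz:
  assumes add: "\<And>f g. \<lbrakk>f \<in> V; g \<in> V\<rbrakk> \<Longrightarrow> \<phi> (f + g) = \<phi> f + \<phi> g"
    and scale: "\<And>c f. f \<in> V \<Longrightarrow> \<phi> (scl c f) = c * \<phi> f"
    and bdd: "\<And>f. f \<in> V \<Longrightarrow> (cmod (\<phi> f))\<^sup>2 \<le> C * nq f"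
  shows "\<exists>h\<in>V. \<forall>f\<in>V. B f h = \<phi> f"
proof -
  define q where "q = (\<lambda>f g. \<phi> f * cnj (\<phi> g))"
  have qq: "Re (q f f) = (cmod (\<phi> f))\<^sup>2" for f
    by (simp only: q_def complex_norm_square[symmetric] Re_complex_of_real)
  interpret q: psd_form scl V q
  proof unfold_locales
    show "0 \<le> Re (q f f)" for f unfolding qq by simp
  qed (simp_all add: subspace_V q_def add scale distrib_right)
  interpret form_pair scl V B q
  proof unfold_locales
    show "\<exists>C. \<forall>f\<in>V. q.nq f \<le> C * nq f" unfolding qq using bdd by blast
  qed
  have \<phi>_diff: "\<phi> (f - g) = \<phi> f - \<phi> g" if "f \<in> V" "g \<in> V" for f g
    using add[of "f - g" g] that by simp
  have "form_compact V B q"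
    by (rule form_compact_functional[where \<phi> = \<phi> and C = C]) (simp_all add: \<phi>_diff bdd qq)
  then obtain e l where el: "eigensystem V B q e l" using eigensystem_exists by blast
  have eV: "e 0 \<in> V" using el by (simp add: eigensystem_def)
  have eig: "\<phi> (e 0) * cnj (\<phi> f) = of_real (l 0) * B (e 0) f" if "f \<in> V" for f
    using el that by (simp add: eigensystem_def q_def)
  show ?thesis
  proof (cases "\<phi> (e 0) = 0")
    case True
    have unit: "nq (e 0) = (if l 0 = 0 then 0 else 1)" using el by (simp add: eigensystem_def)
    have "of_real (l 0) * B (e 0) (e 0) = 0" using eig[OF eV] True by simp
    \<comment> \<open>A nonzero \<open>l 0\<close> would come with a unit vector \<open>e 0\<close>,
      against the preceding identity. Since \<open>l 0\<close> bounds the form on all of V, phi then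
      vanishes and is represented by 0.\<close>
    then have "l 0 = 0" using unit by (auto split: if_splits)
    have "\<phi> f = 0" if f: "f \<in> V" for f
    proof -
      have "\<forall>k. \<forall>f\<in>V. (\<forall>j<k. B f (e j) = 0) \<longrightarrow> q.nq f \<le> l k * nq f"
        using el unfolding eigensystem_def by (elim conjE)
      from this[rule_format, of f 0] have "q.nq f \<le> l 0 * nq f" using f by simp
      then show ?thesis using \<open>l 0 = 0\<close> unfolding qq by simp
    qed
    then show ?thesis by (intro bexI[of _ 0]) auto
  next
    case False
    have rep: "\<phi> f = cnj (of_real (l 0) / \<phi> (e 0)) * B f (e 0)" if f: "f \<in> V" for f
    proof -
      have "B f (e 0) = cnj (B (e 0) f)" by (rule sym[OF eV f])
      moreover have "cnj (\<phi> (e 0)) * \<phi> f = of_real (l 0) * cnj (B (e 0) f)"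
        using arg_cong[OF eig[OF f], of cnj] by simp
      ultimately show ?thesis using False by (simp add: field_simps)
    qed
    show ?thesis
    proof (intro bexI ballI)
      fix f assume f: "f \<in> V"
      show "B f (scl (of_real (l 0) / \<phi> (e 0)) (e 0)) = \<phi> f"
        unfolding scale_right[OF eV f] by (rule rep[OF f, symmetric])
    qed (rule scale_V[OF eV])
  qed
qed

end

section \<open>Ky Fan inequalities and representing operators\<close>

context psd_form
begin

lemma orthonormal_independent:
  assumes A: "finite A" "\<And>i. i \<in> A \<Longrightarrow> w i \<in> V"
    and orth: "\<And>i j. \<lbrakk>i \<in> A; j \<in> A; i \<noteq> j\<rbrakk> \<Longrightarrow> B (w i) (w j) = 0"
    and unit: "\<And>i. i \<in> A \<Longrightarrow> nq (w i) = 1"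
  shows "inj_on w A" "independent (w ` A)"
proof -
  show inj: "inj_on w A"
    using orth unit by (metis inj_onI zero_complex.sel(1) zero_neq_one)
  show "independent (w ` A)"
  proof
    assume "dependent (w ` A)"
    then obtain u i where i: "i \<in> A" "u (w i) \<noteq> 0" and z: "(\<Sum>v\<in>w ` A. u v \<cdot> v) = 0"
      using dependent_finite[of "w ` A"] A(1) by auto
    have "(\<Sum>j\<in>A. u (w j) \<cdot> w j) = 0" using z by (simp add: sum.reindex[OF inj])
    then have "0 = B (\<Sum>j\<in>A. u (w j) \<cdot> w j) (w i)" using A(2)[OF i(1)] by simp
    also have "\<dots> = (\<Sum>j\<in>A. u (w j) * B (w j) (w i))"
      using A i by (simp add: sum_left scale_left)
    also have "\<dots> = (\<Sum>j\<in>A. if j = i then u (w i) * B (w i) (w i) else 0)"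
      using orth i by (intro sum.cong) auto
    also have "\<dots> = u (w i)"
      using A i unit self_real[of "w i"] by simp
    finally show False using i by simp
  qed
qed

end

context hilbert_form
begin

lemma ext_left: "\<lbrakk>x \<in> V; y \<in> V; \<And>f. f \<in> V \<Longrightarrow> B x f = B y f\<rbrakk> \<Longrightarrow> x = y"
  using definite[of "x - y"] by (simp add: diff_left)

lemma ext_right: "\<lbrakk>x \<in> V; y \<in> V; \<And>f. f \<in> V \<Longrightarrow> B f x = B f y\<rbrakk> \<Longrightarrow> x = y"
  using definite[of "x - y"] by (simp add: diff_right)

end

context form_pair
begin

lemma eigensystemD:
  assumes "eigensystem V ip q e l"
  shows "\<And>k. e k \<in> V" "decseq l" "\<And>k. 0 \<le> l k" "l \<longlonglongrightarrow> 0"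
    and "\<And>k f. f \<in> V \<Longrightarrow> q (e k) f = of_real (l k) * ip (e k) f"
    and "\<And>j k. j \<noteq> k \<Longrightarrow> ip (e j) (e k) = 0"
    and "\<And>k. ip.nq (e k) = (if l k = 0 then 0 else 1)"
    and "\<And>k f. \<lbrakk>f \<in> V; \<And>j. j < k \<Longrightarrow> ip f (e j) = 0\<rbrakk> \<Longrightarrow> q.nq f \<le> l k * ip.nq f"
  using assms unfolding eigensystem_def by simp_all

text \<open>
  If \<open>J\<close> is the map from \<open>W\<close> to the space with inner product \<open>q\<close>, then \<open>g = J\<^sup>* v\<close>, and the
  lemma bounds \<open>J J\<^sup>*\<close> in terms of its eigenvectors \<open>e j / \<surd> t j\<close>.
\<close>

lemma adjoint_bound:
  assumes W: "W \<subseteq> V" "ip.subspace W" and e: "eigensystem W ip q e t"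
    and v: "v \<in> V" and g: "g \<in> W" and vg: "\<And>w. w \<in> W \<Longrightarrow> q v w = ip g w"
  defines "w \<equiv> \<lambda>j. of_real (1 / sqrt (t j)) \<cdot> e j"
  shows "ip.nq g \<le> t N * q.nq v + (\<Sum>j<N. (t j - t N) * (cmod (q v (w j)))\<^sup>2)"
    and "\<And>j. w j \<in> W" "\<And>i j. i \<noteq> j \<Longrightarrow> q (w i) (w j) = 0" "\<And>j. q.nq (w j) \<in> {0, 1}"
proof -
  interpret ipW: psd_form scl W ip by (rule ip.psd_form_subspace[OF W])
  interpret qW: psd_form scl W q by (rule q.psd_form_subspace[OF W])
  have eW: "e k \<in> W" and t0: "0 \<le> t k"
    and eig: "\<And>f. f \<in> W \<Longrightarrow> q (e k) f = of_real (t k) * ip (e k) f"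
    and unit: "ip.nq (e k) = (if t k = 0 then 0 else 1)"
    and top: "\<And>f. \<lbrakk>f \<in> W; \<And>j. j < k \<Longrightarrow> ip f (e j) = 0\<rbrakk> \<Longrightarrow> q.nq f \<le> t k * ip.nq f" for k
    using e unfolding eigensystem_def by simp_all
  have orth: "ip (e j) (e k) = 0" if "j \<noteq> k" for j k
    using e that unfolding eigensystem_def by simp
  show wW: "w j \<in> W" for j by (simp add: w_def eW)
  \<comment> \<open>The adjoint of J maps w j to sqrt (t j) times e j. Division by zero gives w j =
    0 when t j = 0, which keeps the formula uniform.\<close>
  have qw: "q (w j) f = of_real (sqrt (t j)) * ip (e j) f" if f: "f \<in> W" for j f
  proof -
    have "t j / sqrt (t j) = sqrt (t j)" by (rule real_div_sqrt[OF t0])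
    then have "of_real (1 / sqrt (t j)) * complex_of_real (t j) = of_real (sqrt (t j))"
      by (simp flip: of_real_mult of_real_divide)
    then show ?thesis
      unfolding w_def qW.scale_left[OF eW f] eig[OF f] mult.assoc[symmetric] by simp
  qed
  show worth: "q (w i) (w j) = 0" if "i \<noteq> j" for i j
    using that by (simp add: qw wW) (simp add: w_def ipW.scale_right eW orth)
  have "q (w j) (w j) = of_real (sqrt (t j)) * (of_real (1 / sqrt (t j)) * ip (e j) (e j))" for j
    by (simp add: qw wW) (simp add: w_def ipW.scale_right eW)
  then show wunit: "q.nq (w j) \<in> {0, 1}" for j
    using t0[of j] ipW.self_real[OF eW[of j]] unit[of j] by (cases "t j = 0") auto
  define g' where "g' = g - (\<Sum>j<N. ip g (e j) \<cdot> e j)"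
  define v' where "v' = v - (\<Sum>j<N. q v (w j) \<cdot> w j)"
  have "ipW.orthonormal_or_zero {..<N} e"
    by (simp add: ipW.orthonormal_or_zero_def eW unit orth)
  note rg = ipW.orthonormal_residual[OF finite_lessThan this g, folded g'_def]
  have g': "g' \<in> W" "\<And>j. j < N \<Longrightarrow> ip g' (e j) = 0"
      "ip.nq g' = ip.nq g - (\<Sum>j<N. (cmod (ip g (e j)))\<^sup>2)"
    using rg by simp_all
  have wV: "w j \<in> V" for j using wW W by auto
  have "q.orthonormal_or_zero {..<N} w"
    using wV worth wunit by (simp add: q.orthonormal_or_zero_def)
  note rv = q.orthonormal_residual[OF finite_lessThan this v, folded v'_def]
  have qvw: "q v (w j) = of_real (1 / sqrt (t j)) * ip g (e j)" for j
    using vg[OF wW] by (simp add: w_def ipW.scale_right g eW)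
  have ge: "(cmod (ip g (e j)))\<^sup>2 = t j * (cmod (q v (w j)))\<^sup>2" for j
  proof (cases "t j = 0")
    case True
    then have "ip g (e j) = 0" using unit[of j] g eW by (intro ipW.null_right) auto
    then show ?thesis using True by simp
  next
    case False
    then show ?thesis using t0[of j] unfolding qvw
      by (simp add: norm_mult norm_divide power_mult_distrib power_divide)
  qed
  \<comment> \<open>Removing the first N components on both sides preserves the adjoint relation, so
    g' is again the image of v' and only the spectrum from t N on is left.\<close>
  have v'g': "q v' f = ip g' f" if f: "f \<in> W" for f
  proof -
    have fV: "f \<in> V" using f W by auto
    have "q v (w j) * q (w j) f = ip g (e j) * ip (e j) f" for j
    proof (cases "t j = 0")
      case True
      then have "ip g (e j) = 0" using unit[of j] g eW by (intro ipW.null_right) auto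
      then show ?thesis unfolding qvw by simp
    next
      case False
      then show ?thesis unfolding qvw qw[OF f] using t0[of j] by simp
    qed
    moreover have "q (\<Sum>j<N. q v (w j) \<cdot> w j) f = (\<Sum>j<N. q v (w j) * q (w j) f)"
      using wV fV by (subst q.sum_left) (auto simp: q.scale_left)
    moreover have "ip (\<Sum>j<N. ip g (e j) \<cdot> e j) f = (\<Sum>j<N. ip g (e j) * ip (e j) f)"
      using eW f by (subst ipW.sum_left) (auto simp: ipW.scale_left)
    moreover have "(\<Sum>j<N. q v (w j) \<cdot> w j) \<in> V" "(\<Sum>j<N. ip g (e j) \<cdot> e j) \<in> W"
      using wV eW by (auto intro!: q.sum_V ipW.sum_V)
    ultimately show ?thesis
      unfolding v'_def g'_def using v fV f g vg by (simp add: q.diff_left ipW.diff_left)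
  qed
  have v'V: "v' \<in> V" by (rule rv(1))
  have nqv': "q.nq v' = q.nq v - (\<Sum>j<N. (cmod (q v (w j)))\<^sup>2)" using rv(3) by simp
  have g'V: "g' \<in> V" using g' W by auto
  \<comment> \<open>Cauchy-Schwarz for q and the bound t N on the remaining space produce a factor
    ip.nq g' on both sides, which is then cancelled.\<close>
  have "(ip.nq g')\<^sup>2 = (cmod (q v' g'))\<^sup>2"
    unfolding v'g'[OF g'(1)] using ipW.self_real[OF g'(1)] by (metis norm_of_real power2_abs)
  also have "\<dots> \<le> q.nq v' * q.nq g'" by (rule q.cauchy_schwarz[OF v'V g'V])
  also have "\<dots> \<le> q.nq v' * (t N * ip.nq g')"
    using top[OF g'(1,2)] q.nonneg[OF v'V] by (intro mult_left_mono) auto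
  finally have "ip.nq g' * ip.nq g' \<le> (t N * q.nq v') * ip.nq g'"
    by (simp add: power2_eq_square mult_ac)
  then have "ip.nq g' \<le> t N * q.nq v'"
    using ipW.nonneg[OF g'(1)] q.nonneg[OF v'V] t0[of N]
    by (cases "ip.nq g' = 0") (auto simp: less_le)
  then have "ip.nq g \<le> t N * q.nq v - t N * (\<Sum>j<N. (cmod (q v (w j)))\<^sup>2)
      + (\<Sum>j<N. t j * (cmod (q v (w j)))\<^sup>2)"
    using g'(3) unfolding nqv' ge by (simp add: right_diff_distrib)
  then show "ip.nq g \<le> t N * q.nq v + (\<Sum>j<N. (t j - t N) * (cmod (q v (w j)))\<^sup>2)"
    by (simp add: left_diff_distrib sum_subtractf sum_distrib_left)
qed

text \<open>In both applications the weights \<open>b\<close> are doubly substochastic by Bessel's inequality.\<close>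

lemma ky_fan_weights:
  assumes dec: "decseq t" and t0: "0 \<le> t N"
    and a: "\<And>k. k < N \<Longrightarrow> a k \<le> t N * c k + (\<Sum>j<N. (t j - t N) * b k j)"
    and c: "\<And>k. k < N \<Longrightarrow> c k \<le> 1" and b: "\<And>j. j < N \<Longrightarrow> (\<Sum>k<N. b k j) \<le> 1"
  shows "(\<Sum>k<N. a k) \<le> (\<Sum>k<N. t k :: real)"
proof -
  have "(\<Sum>k<N. a k) \<le> (\<Sum>k<N. t N * 1 + (\<Sum>j<N. (t j - t N) * b k j))"
  proof (intro sum_mono)
    fix k assume "k \<in> {..<N}"
    then have k: "k < N" by simp
    have "t N * c k \<le> t N * 1" using c[OF k] t0 by (intro mult_left_mono) auto
    then show "a k \<le> t N * 1 + (\<Sum>j<N. (t j - t N) * b k j)" using a[OF k] by linarith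
  qed
  also have "\<dots> = N * t N + (\<Sum>j<N. (t j - t N) * (\<Sum>k<N. b k j))"
    by (simp add: sum.distrib sum_distrib_left) (subst sum.swap, rule refl)
  also have "\<dots> \<le> N * t N + (\<Sum>j<N. (t j - t N) * 1)"
    using b decseqD[OF dec] by (intro add_left_mono sum_mono mult_left_mono) auto
  also have "\<dots> = (\<Sum>k<N. t k)" by (simp add: sum_subtractf)
  finally show ?thesis .
qed

text \<open>Ky Fan's maximum principle: no N orthonormal test vectors give a larger sum than the top
  N eigenvectors. It yields the lower estimate, with Fock eigenvectors tested in the pluriharmonic
  space.\<close>

lemma ky_fan:
  assumes e: "eigensystem V ip q e l"
    and w: "ip.orthonormal_or_zero {..<N} w"
  shows "(\<Sum>k<N. q.nq (w k)) \<le> (\<Sum>k<N. l k)"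
proof -
  note E = eigensystemD[OF e]
  have wV: "w k \<in> V" and wu: "ip.nq (w k) \<in> {0, 1}" if "k < N" for k
    using w that by (simp_all add: ip.orthonormal_or_zero_def)
  have eo: "ip.orthonormal_or_zero {..<N} e"
    by (simp add: ip.orthonormal_or_zero_def E(1,6,7))
  \<comment> \<open>Replace every eigenvalue from index N on by \<open>l N\<close>: the part of f
    orthogonal to the first N eigenvectors contributes at most \<open>l N\<close> times its squared
    norm.\<close>
  have bound: "q.nq f \<le> l N * ip.nq f + (\<Sum>j<N. (l j - l N) * (cmod (ip f (e j)))\<^sup>2)"
    if f: "f \<in> V" for f
  proof -
    define p where "p = (\<Sum>j<N. ip f (e j) \<cdot> e j)"
    note r = ip.orthonormal_residual[OF finite_lessThan eo f, folded p_def]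
    have pV: "p \<in> V" using E(1) by (auto simp: p_def intro!: ip.sum_V)
    have qp: "q p g = (\<Sum>j<N. ip f (e j) * (of_real (l j) * ip (e j) g))" if "g \<in> V" for g
      unfolding p_def using E(1,5) that by (subst q.sum_left) (auto simp: q.scale_left)
    have r2: "ip (f - p) (e j) = 0" if "j < N" for j using r(2)[of j] that by simp
    have "ip (e j) (f - p) = 0" if "j < N" for j
      using ip.sym[OF r(1) E(1)[of j]] r2[OF that] by simp
    then have qpf: "q p (f - p) = 0" by (simp add: qp r(1))
    have pf: "ip (e j) p = ip (e j) f" if "j < N" for j
      using \<open>\<And>j. j < N \<Longrightarrow> ip (e j) (f - p) = 0\<close>[OF that] by (simp add: ip.diff_right E(1) f pV)
    have "q p p = (\<Sum>j<N. of_real (l j * (cmod (ip f (e j)))\<^sup>2))"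
      unfolding qp[OF pV]
    proof (intro sum.cong refl)
      fix j assume "j \<in> {..<N}"
      then have "ip (e j) p = cnj (ip f (e j))" using pf[of j] ip.sym[OF f E(1)[of j]] by simp
      then show "ip f (e j) * (of_real (l j) * ip (e j) p) = of_real (l j * (cmod (ip f (e j)))\<^sup>2)"
        by (simp only: complex_norm_square of_real_mult mult_ac)
    qed
    then have "q.nq p = (\<Sum>j<N. l j * (cmod (ip f (e j)))\<^sup>2)" by simp
    moreover have "q.nq f = q.nq (f - p) + q.nq p"
      using q.nq_add[OF pV r(1)] qpf by simp
    moreover have "q.nq (f - p) \<le> l N * ip.nq (f - p)"
      by (rule E(8)[OF r(1) r2])
    moreover have "l N * ip.nq (f - p)
        = l N * ip.nq f - (\<Sum>j<N. l N * (cmod (ip f (e j)))\<^sup>2)"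
      unfolding r(3) by (simp add: right_diff_distrib sum_distrib_left)
    ultimately show ?thesis by (simp add: left_diff_distrib sum_subtractf)
  qed
  show ?thesis
  proof (rule ky_fan_weights[where t = l and c = "\<lambda>k. ip.nq (w k)"
        and b = "\<lambda>k j. (cmod (ip (w k) (e j)))\<^sup>2"])
    show "decseq l" "0 \<le> l N" by (rule E)+
  next
    fix j assume "j < N"
    \<comment> \<open>The column sums are controlled by expanding e j along the test vectors w k,
      not the other way round.\<close>
    have "(\<Sum>k<N. (cmod (ip (w k) (e j)))\<^sup>2) = (\<Sum>k<N. (cmod (ip (e j) (w k)))\<^sup>2)"
    proof (intro sum.cong refl)
      fix k assume "k \<in> {..<N}"
      then show "(cmod (ip (w k) (e j)))\<^sup>2 = (cmod (ip (e j) (w k)))\<^sup>2"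
        using ip.sym[OF wV E(1), of k j] by simp
    qed
    also have "\<dots> \<le> ip.nq (e j)"
      by (rule ip.bessel[OF finite_lessThan w E(1)])
    also have "\<dots> \<le> 1" using E(7)[of j] by simp
    finally show "(\<Sum>k<N. (cmod (ip (w k) (e j)))\<^sup>2) \<le> 1" .
  next
    fix k assume k: "k < N"
    show "q.nq (w k) \<le> l N * ip.nq (w k) + (\<Sum>j<N. (l j - l N) * (cmod (ip (w k) (e j)))\<^sup>2)"
      by (rule bound[OF wV[OF k]])
    show "ip.nq (w k) \<le> 1" using wu[OF k] by auto
  qed
qed

text \<open>Here p k is the orthogonal projection of u k to W. The vectors v k = J u k / sqrt (l k)
  are q-orthonormal (or null), and l k |p k|^2 is the quadratic form of J_W J_W^* at v k, where J_W
  is J restricted to W. So this is Ky Fan's principle for an operator whose nonzero eigenvalues are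
  those of q on W.\<close>

lemma ky_fan_projection:
  assumes u: "eigensystem V ip q u l" and W: "W \<subseteq> V" "ip.subspace W"
    and e: "eigensystem W ip q e t"
    and p: "\<And>k. k < N \<Longrightarrow> p k \<in> W" "\<And>k w. \<lbrakk>k < N; w \<in> W\<rbrakk> \<Longrightarrow> ip (u k) w = ip (p k) w"
  shows "(\<Sum>k<N. l k * ip.nq (p k)) \<le> (\<Sum>k<N. t k)"
proof -
  note U = eigensystemD[OF u]
  define v where "v = (\<lambda>k. of_real (1 / sqrt (l k)) \<cdot> u k)"
  define g where "g = (\<lambda>k. of_real (sqrt (l k)) \<cdot> p k)"
  define w where "w = (\<lambda>j. of_real (1 / sqrt (t j)) \<cdot> e j)"
  have vV: "v k \<in> V" for k by (simp add: v_def U(1))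
  have gW: "g k \<in> W" if "k < N" for k using p(1)[OF that] W(2) by (simp add: g_def ip.subspace_scale)
  have qv: "q (v k) f = of_real (sqrt (l k)) * ip (u k) f" if f: "f \<in> V" for k f
  proof -
    have "l k / sqrt (l k) = sqrt (l k)" by (rule real_div_sqrt[OF U(3)])
    then have "of_real (1 / sqrt (l k)) * complex_of_real (l k) = of_real (sqrt (l k))"
      by (simp flip: of_real_mult of_real_divide)
    then show ?thesis
      unfolding v_def q.scale_left[OF U(1) f] U(5)[OF f] mult.assoc[symmetric] by simp
  qed
  \<comment> \<open>That is, g k is the image of v k under the adjoint of the restriction of J to
    W.\<close>
  have vg: "q (v k) f = ip (g k) f" if "k < N" "f \<in> W" for k f
  proof -
    have fV: "f \<in> V" and pV: "p k \<in> V" using that W p by auto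
    show ?thesis unfolding qv[OF fV] g_def ip.scale_left[OF pV fV] p(2)[OF that] ..
  qed
  have vorth: "q (v i) (v j) = 0" if "i \<noteq> j" for i j
    using that by (simp add: qv vV) (simp add: v_def ip.scale_right U(1,6))
  have "q (v j) (v j) = of_real (sqrt (l j)) * (of_real (1 / sqrt (l j)) * ip (u j) (u j))" for j
    by (simp add: qv vV) (simp add: v_def ip.scale_right U(1))
  then have vunit: "q.nq (v j) \<in> {0, 1}" for j
    using U(3)[of j] ip.self_real[OF U(1)[of j]] U(7)[of j] by (cases "l j = 0") auto
  have adj1: "ip.nq (g k) \<le> t N * q.nq (v k) + (\<Sum>j<N. (t j - t N) * (cmod (q (v k) (w j)))\<^sup>2)"
    if "k < N" for k
    unfolding w_def by (rule adjoint_bound(1)[OF W e vV gW[OF that] vg[OF that]])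
  have adj2: "w j \<in> W" "q.nq (w j) \<in> {0, 1}" if "k < N" for j k
    unfolding w_def
    by (rule adjoint_bound(2,4)[OF W e vV gW[OF that] vg[OF that]], assumption)+
  show ?thesis
  proof (rule ky_fan_weights[where t = t and c = "\<lambda>k. q.nq (v k)"
        and b = "\<lambda>k j. (cmod (q (v k) (w j)))\<^sup>2"])
    show "decseq t" "0 \<le> t N" using e by (simp_all add: eigensystem_def)
    fix k assume k: "k < N"
    have "ip.nq (g k) = l k * ip.nq (p k)"
    proof -
      have pV: "p k \<in> V" using p(1)[OF k] W(1) by auto
      show ?thesis unfolding g_def ip.nq_scale[OF pV] using U(3)[of k] by simp
    qed
    then show "l k * ip.nq (p k) \<le> t N * q.nq (v k)
        + (\<Sum>j<N. (t j - t N) * (cmod (q (v k) (w j)))\<^sup>2)"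
      using adj1[OF k] by simp
    show "q.nq (v k) \<le> 1" using vunit[of k] by auto
  next
    fix j assume j: "j < N"
    have wV: "w j \<in> V" using adj2(1)[OF j, of j] W by auto
    have "(\<Sum>k<N. (cmod (q (v k) (w j)))\<^sup>2) = (\<Sum>k<N. (cmod (q (w j) (v k)))\<^sup>2)"
    proof (intro sum.cong refl)
      fix k
      show "(cmod (q (v k) (w j)))\<^sup>2 = (cmod (q (w j) (v k)))\<^sup>2"
        using q.sym[OF vV wV, of k] by simp
    qed
    also have "\<dots> \<le> q.nq (w j)"
      using vV vorth vunit wV
      by (intro q.bessel) (simp_all add: q.orthonormal_or_zero_def)
    also have "\<dots> \<le> 1" using adj2(2)[OF j, of j] by auto
    finally show "(\<Sum>k<N. (cmod (q (v k) (w j)))\<^sup>2) \<le> 1" .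
  qed
qed

section \<open>The operator representing a bounded form: compactness and eigenspaces\<close>

lemma represents_exists: "\<exists>T. \<forall>f\<in>V. T f \<in> V \<and> (\<forall>g\<in>V. ip (T f) g = q f g)"
proof -
  obtain C where C: "\<forall>f\<in>V. q.nq f \<le> C * ip.nq f" using bounded by blast
  have "\<exists>h\<in>V. \<forall>g\<in>V. ip h g = q f g" if f: "f \<in> V" for f
  proof -
    have "\<exists>h\<in>V. \<forall>g\<in>V. ip g h = q g f"
    proof (rule ip.riesz)
      fix g assume g: "g \<in> V"
      have "(cmod (q g f))\<^sup>2 \<le> q.nq g * q.nq f" by (rule q.cauchy_schwarz[OF g f])
      also have "\<dots> \<le> C * ip.nq g * q.nq f"
        using C g q.nonneg[OF f] by (intro mult_right_mono) auto
      finally show "(cmod (q g f))\<^sup>2 \<le> (C * q.nq f) * ip.nq g" by (simp add: mult_ac)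
    qed (simp_all add: f q.add_left q.scale_left)
    then obtain h where h: "h \<in> V" "\<And>g. g \<in> V \<Longrightarrow> ip g h = q g f" by blast
    have "ip h g = q f g" if g: "g \<in> V" for g
      using h(2)[OF g] ip.sym[OF g h(1)] q.sym[OF g f] by simp
    then show ?thesis using h(1) by blast
  qed
  then show ?thesis by metis
qed

context
  fixes T :: "'v \<Rightarrow> 'v"
  assumes T: "\<And>f. f \<in> V \<Longrightarrow> T f \<in> V" "\<And>f g. \<lbrakk>f \<in> V; g \<in> V\<rbrakk> \<Longrightarrow> ip (T f) g = q f g"
begin

lemma represents_add: "\<lbrakk>f \<in> V; g \<in> V\<rbrakk> \<Longrightarrow> T (f + g) = T f + T g"
  by (rule ip.ext_left) (simp_all add: T ip.add_left q.add_left)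

lemma represents_scale: "f \<in> V \<Longrightarrow> T (c \<cdot> f) = c \<cdot> T f"
  by (rule ip.ext_left) (simp_all add: T ip.scale_left q.scale_left)

lemma represents_diff: "\<lbrakk>f \<in> V; g \<in> V\<rbrakk> \<Longrightarrow> T (f - g) = T f - T g"
  by (rule ip.ext_left) (simp_all add: T ip.diff_left q.diff_left)

lemma represents_selfadjoint: "\<lbrakk>f \<in> V; g \<in> V\<rbrakk> \<Longrightarrow> ip (T f) g = ip f (T g)"
  using T ip.sym[of "T g" f] q.sym[of g f] by simp

text \<open>The squared norm of T f is q f (T f), and Cauchy-Schwarz is applied in q rather than in
  ip, so that T f is controlled by the q-size of f.\<close>

lemma represents_norm: "f \<in> V \<Longrightarrow> (ip.nq (T f))\<^sup>2 \<le> q.nq f * q.nq (T f)"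
proof -
  assume f: "f \<in> V"
  have "ip.nq (T f) = Re (q f (T f))" using T f by simp
  also have "\<bar>\<dots>\<bar> \<le> cmod (q f (T f))" by (rule abs_Re_le_cmod)
  finally have "\<bar>ip.nq (T f)\<bar> \<le> \<bar>cmod (q f (T f))\<bar>" using ip.nonneg[OF T(1)[OF f]] by simp
  then have "(ip.nq (T f))\<^sup>2 \<le> (cmod (q f (T f)))\<^sup>2" by (simp only: abs_le_square_iff)
  then show ?thesis using q.cauchy_schwarz[OF f T(1)[OF f]] by linarith
qed

lemma represents_le:
  assumes C: "\<And>f. f \<in> V \<Longrightarrow> q.nq f \<le> C * ip.nq f" and f: "f \<in> V"
  shows "ip.nq (T f) \<le> C * q.nq f"
proof (cases "ip.nq (T f) = 0")
  case True
  then show ?thesis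
    using represents_norm[OF f] T f q.null_left C ip.nonneg q.nonneg
    by (smt (verit, best) mult_eq_0_iff mult_nonneg_nonneg mult_nonpos_nonneg)
next
  case False
  then have p: "0 < ip.nq (T f)" using ip.nonneg[OF T(1)[OF f]] by simp
  have "ip.nq (T f) * ip.nq (T f) \<le> q.nq f * (C * ip.nq (T f))"
    using represents_norm[OF f] mult_left_mono[OF C[OF T(1)[OF f]] q.nonneg[OF f]]
    by (simp add: power2_eq_square)
  then show ?thesis using p by (simp add: mult_ac)
qed

text \<open>With T = J^* J this is the equivalence of compactness of T and of J. One direction uses
  q f f = ip (T f) f together with boundedness of the sequence, the other that |T f|^2 is at most C
  q f f.\<close>

lemma represents_compact_iff:
  "(\<forall>F :: nat \<Rightarrow> 'v. (\<forall>k. F k \<in> V) \<and> (\<exists>b. \<forall>k. ip.nq (F k) \<le> b) \<longrightarrow>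
      (\<exists>g\<in>V. \<exists>r :: nat \<Rightarrow> nat. strict_mono r \<and> (\<lambda>k. ip.nq (T (F (r k)) - g)) \<longlonglongrightarrow> 0))
    \<longleftrightarrow> form_compact V ip q" (is "?L \<longleftrightarrow> _")
proof
  assume L: ?L
  show "form_compact V ip q"
    unfolding form_compact_def
  proof (intro allI impI, elim conjE exE)
    fix F :: "nat \<Rightarrow> 'v" and b
    assume F: "\<forall>k. F k \<in> V" and b: "\<forall>k. ip.nq (F k) \<le> b"
    then obtain g and r :: "nat \<Rightarrow> nat" where g: "g \<in> V" and r: "strict_mono r"
      and lim: "(\<lambda>k. ip.nq (T (F (r k)) - g)) \<longlonglongrightarrow> 0"
      using L by blast
    have b0: "0 \<le> b" using b ip.nonneg[of "F 0"] F by (meson order_trans)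
    have "\<exists>N. \<forall>m\<ge>N. \<forall>n\<ge>N. q.nq (F (r m) - F (r n)) < d" if d: "0 < d" for d
    proof -
      \<comment> \<open>Below, T f and f have squared norms at most 4 \<epsilon> and 4 b, so the
        squared q-size is at most 16 \<epsilon> b. Writing b + 1 avoids a zero denominator and makes
        the final inequality strict.\<close>
      define \<epsilon> where "\<epsilon> = d\<^sup>2 / (16 * (b + 1))"
      have eps: "0 < \<epsilon>" using d b0 by (simp add: \<epsilon>_def)
      obtain N where N: "\<And>k. k \<ge> N \<Longrightarrow> ip.nq (T (F (r k)) - g) < \<epsilon>"
        using order_tendstoD(2)[OF lim eps] unfolding eventually_sequentially by blast
      have "q.nq (F (r m) - F (r n)) < d" if mn: "m \<ge> N" "n \<ge> N" for m n
      proof -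
        define f where "f = F (r m) - F (r n)"
        have fV: "f \<in> V" using F by (simp add: f_def)
        have "T f = (T (F (r m)) - g) - (T (F (r n)) - g)"
          using F by (simp add: f_def represents_diff)
        then have "ip.nq (T f) \<le> 2 * ip.nq (T (F (r m)) - g) + 2 * ip.nq (T (F (r n)) - g)"
          using ip.nq_diff_le[of "T (F (r m)) - g" "T (F (r n)) - g"] F g T by simp
        then have Tf: "ip.nq (T f) \<le> 4 * \<epsilon>" using N[OF mn(1)] N[OF mn(2)] by linarith
        have f4: "ip.nq f \<le> 4 * b"
          using ip.nq_diff_le[of "F (r m)" "F (r n)"] F b[rule_format, of "r m"]
            b[rule_format, of "r n"] by (simp add: f_def)
        have "(q.nq f)\<^sup>2 \<le> (cmod (ip (T f) f))\<^sup>2"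
          using T fV abs_Re_le_cmod[of "q f f"] q.nonneg[OF fV] by (simp add: power_mono)
        also have "\<dots> \<le> ip.nq (T f) * ip.nq f" by (rule ip.cauchy_schwarz[OF T(1)[OF fV] fV])
        also have "\<dots> \<le> (4 * \<epsilon>) * (4 * b)"
          using Tf f4 ip.nonneg[OF fV] eps by (intro mult_mono) auto
        also have "\<dots> < (4 * \<epsilon>) * (4 * (b + 1))" using eps by (intro mult_strict_left_mono) auto
        also have "\<dots> = \<epsilon> * (16 * (b + 1))" by (simp add: algebra_simps)
        also have "\<dots> = d\<^sup>2" using b0 by (simp add: \<epsilon>_def)
        finally show ?thesis unfolding f_def using d by (simp add: power2_less_imp_less)
      qed
      then show ?thesis by blast
    qed
    then show "\<exists>r :: nat \<Rightarrow> nat. strict_mono r \<and> (\<forall>d>0. \<exists>N. \<forall>m\<ge>N. \<forall>n\<ge>N.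
        q.nq (F (r m) - F (r n)) < d)"
      using r by blast
  qed
next
  assume comp: "form_compact V ip q"
  obtain C0 where C0: "\<forall>f\<in>V. q.nq f \<le> C0 * ip.nq f" using bounded by blast
  define C where "C = \<bar>C0\<bar> + 1"
  have C: "q.nq f \<le> C * ip.nq f" if "f \<in> V" for f
  proof -
    have "C0 * ip.nq f \<le> C * ip.nq f"
      using ip.nonneg[OF that] by (intro mult_right_mono) (auto simp: C_def)
    then show ?thesis using C0 that by fastforce
  qed
  have C1: "0 < C" by (simp add: C_def)
  show ?L
  proof (intro allI impI, elim conjE exE)
    fix F :: "nat \<Rightarrow> 'v" and b
    assume F: "\<forall>k. F k \<in> V" and b: "\<forall>k. ip.nq (F k) \<le> b"
    obtain r :: "nat \<Rightarrow> nat" where r: "strict_mono r"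
      and cau: "\<forall>e>0. \<exists>N. \<forall>m\<ge>N. \<forall>n\<ge>N. q.nq (F (r m) - F (r n)) < e"
      using form_compactD[of V ip q F b, OF comp] F b by blast
    have "\<exists>N. \<forall>m\<ge>N. \<forall>n\<ge>N. ip.nq (T (F (r m)) - T (F (r n))) < e" if e: "0 < e" for e
    proof -
      obtain N where N: "\<forall>m\<ge>N. \<forall>n\<ge>N. q.nq (F (r m) - F (r n)) < e / C"
        using cau[rule_format, of "e / C"] e C1 by auto
      have "ip.nq (T (F (r m)) - T (F (r n))) < e" if "m \<ge> N" "n \<ge> N" for m n
      proof -
        have "ip.nq (T (F (r m) - F (r n))) \<le> C * q.nq (F (r m) - F (r n))"
          using F by (intro represents_le[OF C]) auto
        also have "\<dots> < C * (e / C)"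
          using N that C1 by (intro mult_strict_left_mono) auto
        finally show ?thesis using F C1 by (simp add: represents_diff)
      qed
      then show ?thesis by blast
    qed
    then have "\<exists>g\<in>V. (\<lambda>k. ip.nq (T (F (r k)) - g)) \<longlonglongrightarrow> 0"
      using F T by (intro ip.complete) auto
    then show "\<exists>g\<in>V. \<exists>r :: nat \<Rightarrow> nat. strict_mono r \<and> (\<lambda>k. ip.nq (T (F (r k)) - g)) \<longlonglongrightarrow> 0"
      using r by blast
  qed
qed

text \<open>T is self-adjoint, so the eigenspace of T T at the square of t is what the definition of
  singular values counts. After subtracting its projection to the e k with l k = t, an eigenvector
  is orthogonal to the whole system, hence lies in the kernel of T, hence is 0.\<close>

lemma represents_eigenspace:
  assumes e: "eigensystem V ip q e l" and t: "0 < t"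
  shows "finite {k. l k = t}"
    and "ip.dim {f\<in>V. T (T f) = of_real (t\<^sup>2) \<cdot> f} = card {k. l k = t}"
proof -
  note E = eigensystemD[OF e]
  define K where "K = {k. l k = t}"
  define S where "S = {f\<in>V. T (T f) = of_real (t\<^sup>2) \<cdot> f}"
  obtain n where "\<And>k. k \<ge> n \<Longrightarrow> l k < t"
    using order_tendstoD(2)[OF E(4) t] unfolding eventually_sequentially by blast
  then have "K \<subseteq> {..<n}" unfolding K_def by (force simp: not_less[symmetric])
  then show fin: "finite {k. l k = t}" unfolding K_def using finite_subset by blast
  have Te: "T (e k) = of_real (l k) \<cdot> e k" for k
    by (rule ip.ext_left) (simp_all add: T E ip.scale_left)
  have eK: "e k \<in> V" "ip.nq (e k) = 1" if "k \<in> K" for k using that t by (auto simp: K_def E)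
  have ind: "inj_on e K" "ip.independent (e ` K)"
    using ip.orthonormal_independent[of K e] fin eK E(6) by (simp_all add: K_def)
  have sub: "ip.span (e ` K) \<subseteq> S"
  proof -
    have "ip.subspace S"
      unfolding ip.subspace_def S_def
      by (auto simp: represents_add represents_scale T ip.scale_right_distrib ip.scale_left_commute
          mult.commute ip.scale_scale)
        (metis represents_scale ip.scale_zero_left ip.zero_V)
    moreover have "e ` K \<subseteq> S"
      unfolding S_def by (auto simp: E(1) Te represents_scale K_def power2_eq_square)
    ultimately show ?thesis by (rule ip.span_minimal[rotated])
  qed
  have "S = ip.span (e ` K)"
  proof (rule antisym[OF _ sub])
    show "S \<subseteq> ip.span (e ` K)"
    proof
      fix f assume "f \<in> S"
      then have f: "f \<in> V" and TTf: "T (T f) = of_real (t\<^sup>2) \<cdot> f" by (auto simp: S_def)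
      define p where "p = (\<Sum>k\<in>K. ip f (e k) \<cdot> e k)"
      define g where "g = f - p"
      have "ip.orthonormal_or_zero K e" by (simp add: ip.orthonormal_or_zero_def E(1,6,7))
      note r = ip.orthonormal_residual[OF fin[folded K_def] this f, folded p_def g_def]
      have sp: "p \<in> ip.span (e ` K)"
        unfolding p_def by (intro ip.span_sum ip.span_scale ip.span_base) auto
      have pS: "p \<in> S"
        using sub sp by blast
      have pV: "p \<in> V" using pS by (simp add: S_def)
      have TTg: "T (T g) = of_real (t\<^sup>2) \<cdot> g"
        using pS TTf f pV by (simp add: g_def S_def represents_diff T ip.scale_right_diff_distrib)
      have g_orth: "ip g (e k) = 0" for k
      proof (cases "k \<in> K")
        case False
        have "of_real (t\<^sup>2) * ip g (e k) = ip (T (T g)) (e k)"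
          unfolding TTg ip.scale_left[OF r(1) E(1)] ..
        also have "\<dots> = ip g (T (T (e k)))"
          by (simp add: represents_selfadjoint T r(1) E(1))
        also have "\<dots> = of_real ((l k)\<^sup>2) * ip g (e k)"
          by (simp add: Te represents_scale E(1) ip.scale_right r(1) power2_eq_square)
        finally have "(of_real (t\<^sup>2) - of_real ((l k)\<^sup>2)) * ip g (e k) = 0"
          by (simp add: left_diff_distrib)
        \<comment> \<open>Positivity of t and nonnegativity of l k let the squares separate distinct
          eigenvalues.\<close>
        moreover have "t\<^sup>2 \<noteq> (l k)\<^sup>2"
          using False t E(3)[of k] by (simp add: K_def power2_eq_iff_nonneg)
        then have "complex_of_real (t\<^sup>2) \<noteq> of_real ((l k)\<^sup>2)" by (simp only: of_real_eq_iff not_False_eq_True)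
        ultimately show ?thesis by (simp del: of_real_power)
      qed (rule r(2))
      \<comment> \<open>A vector orthogonal to every e k is bounded by each eigenvalue in turn, and
        these tend to 0.\<close>
      have "q.nq g \<le> l k * ip.nq g" for k by (rule E(8)[OF r(1) g_orth])
      moreover have "(\<lambda>k. l k * ip.nq g) \<longlonglongrightarrow> 0"
        using tendsto_mult_right[OF E(4), of "ip.nq g"] by simp
      ultimately have "q.nq g \<le> 0" by (intro LIMSEQ_le_const[of _ 0]) auto
      then have "q.nq g = 0" using q.nonneg[OF r(1)] by simp
      then have "T g = 0"
        using represents_norm[OF r(1)] ip.definite[OF T(1)[OF r(1)]] by simp
      then have "of_real (t\<^sup>2) \<cdot> g = 0"
        using TTg represents_scale[OF ip.zero_V, of 0] by simp
      then have "g = 0" using t by simp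
      then show "f \<in> ip.span (e ` K)" using sp by (simp add: g_def)
    qed
  qed
  then have "ip.dim S = card (e ` K)"
    using ip.dim_span_eq_card_independent[OF ind(2)] by simp
  also have "\<dots> = card K" by (rule card_image[OF ind(1)])
  finally show "ip.dim {f\<in>V. T (T f) = of_real (t\<^sup>2) \<cdot> f} = card {k. l k = t}"
    by (simp only: S_def K_def)
qed

end

end

section \<open>Symmetric norming functions and singular values\<close>

text \<open>Below, y is obtained from x by a sign change or a transposition, so both points have
  equal norm and their convex combinations have no larger one.\<close>

lemma symmetric_norming_convex:
  assumes \<Phi>: "symmetric_norming \<Phi>" and x: "x \<in> fin_supp" and y: "y \<in> fin_supp"
    and t: "0 \<le> t" "t \<le> 1" and le: "\<Phi> x \<le> c" "\<Phi> y \<le> c"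
  shows "\<Phi> (\<lambda>k. (1 - t) * x k + t * y k) \<le> c"
proof -
  have s: "(\<lambda>k. s * z k) \<in> fin_supp" if "z \<in> fin_supp" for s z
    using that by (auto simp: fin_supp_def elim: rev_finite_subset)
  have "\<Phi> (\<lambda>k. (1 - t) * x k + t * y k) \<le> \<Phi> (\<lambda>k. (1 - t) * x k) + \<Phi> (\<lambda>k. t * y k)"
    using \<Phi> s[OF x] s[OF y] by (simp add: symmetric_norming_def)
  also have "\<dots> = (1 - t) * \<Phi> x + t * \<Phi> y"
    using \<Phi> x y t by (simp add: symmetric_norming_def)
  also have "\<dots> \<le> (1 - t) * c + t * c"
    using le t by (intro add_mono mult_left_mono) auto
  finally show ?thesis by (simp add: algebra_simps)
qed

text \<open>The vector with the smaller entry lies on the segment between y and the vector with y i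
  negated, which has the same norm as y.\<close>

lemma symmetric_norming_shrink:
  assumes \<Phi>: "symmetric_norming \<Phi>" and y: "y \<in> fin_supp" and a: "0 \<le> a" "a \<le> y i"
  shows "\<Phi> (y(i := a)) \<le> \<Phi> y"
proof (cases "y i = 0")
  case True
  then have "y(i := a) = y" using a by auto
  then show ?thesis by simp
next
  case False
  then have p: "0 < y i" using a by simp
  define y' where "y' = y(i := - y i)"
  \<comment> \<open>The solution of (1 - t) y i - t y i = a.\<close>
  define t where "t = (1 - a / y i) / 2"
  have y': "y' \<in> fin_supp"
    using y False by (auto simp: fin_supp_def y'_def elim: rev_finite_subset)
  have "(\<lambda>k. \<bar>y' k\<bar>) = (\<lambda>k. \<bar>y k\<bar>)" by (auto simp: y'_def)
  then have eq: "\<Phi> y' = \<Phi> y" using \<Phi> y y' unfolding symmetric_norming_def by metis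
  have t: "0 \<le> t" "t \<le> 1" using a p by (auto simp: t_def field_simps)
  have "y(i := a) = (\<lambda>k. (1 - t) * y k + t * y' k)"
    using p by (auto simp: fun_eq_iff y'_def t_def field_simps)
  then show ?thesis
    using symmetric_norming_convex[OF \<Phi> y y' t, of "\<Phi> y"] eq by simp
qed

lemma symmetric_norming_mono:
  assumes \<Phi>: "symmetric_norming \<Phi>" and y: "y \<in> fin_supp" and xy: "\<And>k. 0 \<le> x k" "\<And>k. x k \<le> y k"
  shows "\<Phi> x \<le> \<Phi> y"
proof -
  have "finite A \<Longrightarrow> \<Phi> (\<lambda>k. if k \<in> A then x k else y k) \<le> \<Phi> y" for A
  proof (induction A rule: finite_induct)
    case (insert i A)
    define z where "z = (\<lambda>k. if k \<in> A then x k else y k)"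
    have "z \<in> fin_supp"
    proof -
      have "{k. z k \<noteq> 0} \<subseteq> {k. y k \<noteq> 0}" using xy by (auto simp: z_def) (metis order_antisym)
      then show ?thesis using y by (auto simp: fin_supp_def elim: rev_finite_subset)
    qed
    moreover have "(\<lambda>k. if k \<in> insert i A then x k else y k) = z(i := x i)"
      by (auto simp: z_def)
    ultimately show ?case
      using symmetric_norming_shrink[OF \<Phi>, of z "x i" i] insert xy[of i] by (simp add: z_def)
  qed simp
  moreover have "finite {k. y k \<noteq> 0}" using y by (simp add: fin_supp_def)
  moreover have "(\<lambda>k. if k \<in> {k. y k \<noteq> 0} then x k else y k) = x"
    using xy by (auto simp: fun_eq_iff) (metis order_antisym)
  ultimately show ?thesis by metis
qed

text \<open>A Robin Hood step: moving d from a larger entry to a smaller one, by at most their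
  difference, gives a convex combination of y and its transposition.\<close>

lemma symmetric_norming_transfer:
  assumes \<Phi>: "symmetric_norming \<Phi>" and y: "y \<in> fin_supp"
    and ik: "i \<noteq> k" and d: "0 \<le> d" "d \<le> y i - y k"
  shows "y(i := y i - d, k := y k + d) \<in> fin_supp \<and> \<Phi> (y(i := y i - d, k := y k + d)) \<le> \<Phi> y"
proof
  have "{j. (y(i := y i - d, k := y k + d)) j \<noteq> 0} \<subseteq> {j. y j \<noteq> 0} \<union> {i, k}" by auto
  then show "y(i := y i - d, k := y k + d) \<in> fin_supp"
    unfolding fin_supp_def mem_Collect_eq
    by (rule finite_subset) (use y in \<open>simp add: fin_supp_def\<close>)
  show "\<Phi> (y(i := y i - d, k := y k + d)) \<le> \<Phi> y"
  proof (cases "y i = y k")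
    case True
    then have "y(i := y i - d, k := y k + d) = y" using d by auto
    then show ?thesis by simp
  next
    case False
    then have p: "0 < y i - y k" using d by simp
    define p where "p = Transposition.transpose i k"
    define t where "t = d / (y i - y k)"
    have "bij p" by (simp add: p_def)
    then have yp: "(\<lambda>j. y (p j)) \<in> fin_supp"
      using y finite_vimageI[of "{j. y j \<noteq> 0}" p] by (simp add: fin_supp_def vimage_def bij_is_inj)
    have eq: "\<Phi> (\<lambda>j. y (p j)) = \<Phi> y" using \<Phi> y \<open>bij p\<close> by (simp add: symmetric_norming_def)
    have t: "0 \<le> t" "t \<le> 1" using d p by (auto simp: t_def)
    have td: "t * (y i - y k) = d" using p by (simp add: t_def)
    have "y(i := y i - d, k := y k + d) = (\<lambda>j. (1 - t) * y j + t * y (p j))"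
      using ik td[symmetric] by (auto simp: fun_eq_iff p_def transpose_def algebra_simps)
    then show ?thesis
      using symmetric_norming_convex[OF \<Phi> y yp t, of "\<Phi> y"] eq by simp
  qed
qed

text \<open>
  Ky Fan's dominance principle. At the first index \<open>k\<close> with \<open>y k < x k\<close> there is an earlier \<open>i\<close>
  with \<open>x i < y i\<close>; moving mass from \<open>i\<close> to \<open>k\<close> makes \<open>y\<close> agree with \<open>x\<close> at one more index.
\<close>

lemma symmetric_norming_dominance:
  assumes \<Phi>: "symmetric_norming \<Phi>" and x: "x \<in> fin_supp" "decseq x" "\<And>k. 0 \<le> x k"
    and "y \<in> fin_supp" "\<And>k. 0 \<le> y k" "\<And>m. (\<Sum>k<m. x k) \<le> (\<Sum>k<m. y k)"
  shows "\<Phi> x \<le> \<Phi> y"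
  using assms(5-)
proof (induction "card {k. x k \<noteq> y k}" arbitrary: y rule: less_induct)
  case less
  show ?case
  proof (cases "\<forall>k. x k \<le> y k")
    case True
    then have "x k \<le> y k" for k by simp
    then show ?thesis using symmetric_norming_mono[of \<Phi> y x] \<Phi> less.prems(1) x(3) by simp
  next
    case False
    define k where "k = (LEAST k. y k < x k)"
    have k: "y k < x k" using LeastI_ex[of "\<lambda>k. y k < x k"] False by (auto simp: k_def not_le)
    have before: "x j \<le> y j" if "j < k" for j
      using not_less_Least[of j "\<lambda>k. y k < x k"] that by (simp add: k_def)
    have "\<exists>i<k. x i < y i"
    proof (rule ccontr)
      assume "\<not> ?thesis"
      then have "(\<Sum>j<k. y j) \<le> (\<Sum>j<k. x j)" by (intro sum_mono) (meson lessThan_iff not_less)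
      then show False using less.prems(3)[of "Suc k"] k by simp
    qed
    then obtain i where i: "i < k" "x i < y i" by blast
    \<comment> \<open>The minimum makes z agree with x at i or at k, which is what lets the
      induction terminate.\<close>
    define d where "d = min (y i - x i) (x k - y k)"
    define z where "z = y(i := y i - d, k := y k + d)"
    \<comment> \<open>With this, d \<le> x k - y k \<le> x i - y k < y i - y k, so the transfer is
      admissible.\<close>
    have xik: "x k \<le> x i" using decseqD[OF x(2), of i k] i by simp
    have d: "0 < d" "d \<le> y i - x i" "d \<le> x k - y k" using i k by (auto simp: d_def)
    have z: "z \<in> fin_supp" "\<Phi> z \<le> \<Phi> y"
      unfolding z_def using symmetric_norming_transfer[OF \<Phi> less.prems(1), of i k d] i d xik by auto
    have z0: "0 \<le> z j" for j using less.prems(2) d x(3)[of i] i by (auto simp: z_def)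
    have zi: "z i = y i - d" "z k = y k + d" using i by (auto simp: z_def)
    have "{j. x j \<noteq> z j} \<subseteq> {j. x j \<noteq> y j}" using i k by (auto simp: z_def split: if_splits)
    moreover have "x i = z i \<or> x k = z k" unfolding zi by (auto simp: d_def min_def)
    then have "{j. x j \<noteq> z j} \<noteq> {j. x j \<noteq> y j}" using i(2) k by force
    moreover have "finite {j. x j \<noteq> y j}"
    proof (rule finite_subset)
      show "{j. x j \<noteq> y j} \<subseteq> {j. x j \<noteq> 0} \<union> {j. y j \<noteq> 0}" by auto
      show "finite ({j. x j \<noteq> 0} \<union> {j. y j \<noteq> 0})"
        using x(1) less.prems(1) by (simp add: fin_supp_def)
    qed
    ultimately have card: "card {j. x j \<noteq> z j} < card {j. x j \<noteq> y j}"
      by (intro psubset_card_mono) auto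
    have "(\<Sum>j<m. x j) \<le> (\<Sum>j<m. z j)" for m
    proof -
      have zj: "z j = y j + (if j = k then d else 0) - (if j = i then d else 0)" for j
        using i by (auto simp: z_def)
      have sz: "(\<Sum>j<m. z j) = (\<Sum>j<m. y j) + (if k < m then d else 0) - (if i < m then d else 0)"
        unfolding zj sum_subtractf sum.distrib by (simp add: sum.delta)
      show ?thesis
      proof (cases "i < m \<and> m \<le> k")
        case True
        \<comment> \<open>Only partial sums that contain i but not k lose d. On such initial
          segments y dominates x entry by entry, so the slack is at least y i - x i.\<close>
        have "y i - x i \<le> (\<Sum>j<m. y j - x j)"
          using True before by (intro member_le_sum) auto
        then show ?thesis using True d sz by (simp add: sum_subtractf)
      next
        case False
        then show ?thesis using less.prems(3)[of m] d(1) i(1) sz by (auto split: if_splits)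
      qed
    qed
    then show ?thesis using less.hyps[OF card z(1) z0] z(2) by simp
  qed
qed

text \<open>At the first disagreement the larger value t is positive. All indices where the smaller
  sequence equals t lie strictly before that place, where the two agree, so t has strictly smaller
  multiplicity there. This justifies the definite description in
  \<open>singular_values\<close>.\<close>

lemma decseq_multiplicity_unique:
  fixes s s' :: "nat \<Rightarrow> real"
  assumes s: "decseq s" "s \<longlonglongrightarrow> 0" and s': "decseq s'" "s' \<longlonglongrightarrow> 0"
    and card: "\<And>t. t > 0 \<Longrightarrow> card {k. s k = t} = card {k. s' k = t}"
  shows "s = s'"
proof -
  have aux: False
    if a: "decseq a" "a \<longlonglongrightarrow> 0" "decseq b" "b \<longlonglongrightarrow> 0" "\<And>j. j < k \<Longrightarrow> a j = b j" "b k < a k"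
      and card: "\<And>t. t > 0 \<Longrightarrow> card {k. a k = t} = card {k. b k = t}"
    for a b :: "nat \<Rightarrow> real" and k
  proof -
    define t where "t = a k"
    have "0 \<le> b k" using decseq_ge[OF a(3,4)] .
    then have t: "0 < t" using a(6) by (simp add: t_def)
    obtain n where n: "\<And>j. j \<ge> n \<Longrightarrow> a j < t"
      using order_tendstoD(2)[OF a(2) t] unfolding eventually_sequentially by blast
    have "{j. a j = t} \<subseteq> {..<n}" using n by (force simp: not_less[symmetric])
    then have fin: "finite {j. a j = t}" using finite_subset by blast
    have lt: "j < k" if "b j = t" for j
    proof (rule ccontr)
      assume "\<not> j < k"
      then have "b j \<le> b k" using decseqD[OF a(3), of k j] by simp
      then show False using that a(6) by (simp add: t_def)
    qed
    have "{j. b j = t} \<subset> {j. a j = t}"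
      using lt a(5,6) by (auto simp: t_def)
    then have "card {j. b j = t} < card {j. a j = t}" by (rule psubset_card_mono[OF fin])
    then show False using card[OF t] by simp
  qed
  show ?thesis
  proof (rule ccontr)
    assume "s \<noteq> s'"
    define k where "k = (LEAST k. s k \<noteq> s' k)"
    have k: "s k \<noteq> s' k" using LeastI_ex[of "\<lambda>k. s k \<noteq> s' k"] \<open>s \<noteq> s'\<close> by (auto simp: k_def)
    have eq: "s j = s' j" if "j < k" for j
      using not_less_Least[of j "\<lambda>k. s k \<noteq> s' k"] that by (simp add: k_def)
    then show False
      using k aux[OF s s', of k] aux[OF s' s, of k] card by (metis neq_iff)
  qed
qed

section \<open>From forms to operators on function spaces\<close>

lemma l2_inner_self: "l2_inner M f f = complex_of_real (\<integral>z. (cmod (f z))\<^sup>2 \<partial>M)"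
  unfolding l2_inner_def complex_norm_square[symmetric] by (rule integral_complex_of_real)

lemma l2_norm_eq: "l2_norm M f = sqrt (Re (l2_inner M f f))"
  by (simp add: l2_norm_def l2_inner_self)

lemma adjoint_operator_eq:
  assumes "form_pair fun_scale H (l2_inner M) q"
    and T: "\<And>f. f \<in> H \<Longrightarrow> T f \<in> H" "\<And>f g. \<lbrakk>f \<in> H; g \<in> H\<rbrakk> \<Longrightarrow> l2_inner M (T f) g = q f g"
    and g: "g \<in> H"
  shows "adjoint_operator M H T g = T g"
proof -
  interpret form_pair fun_scale H "l2_inner M" q by fact
  show ?thesis
    unfolding adjoint_operator_def
  proof (rule the_equality)
    show "T g \<in> H \<and> (\<forall>f\<in>H. l2_inner M (T f) g = l2_inner M f (T g))"
      using T(1)[OF g] represents_selfadjoint[of T, OF T _ g] by blast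
    fix h assume h: "h \<in> H \<and> (\<forall>f\<in>H. l2_inner M (T f) g = l2_inner M f h)"
    show "h = T g"
      by (rule ip.ext_right) (use h T g represents_selfadjoint[of T, OF T _ g] in auto)
  qed
qed

text \<open>A representing operator of a positive form is its own adjoint and its own modulus, so
  its singular values are the eigenvalues of the form.\<close>

lemma singular_values_eq:
  assumes fp: "form_pair fun_scale H (l2_inner M) q"
    and T: "\<And>f. f \<in> H \<Longrightarrow> T f \<in> H" "\<And>f g. \<lbrakk>f \<in> H; g \<in> H\<rbrakk> \<Longrightarrow> l2_inner M (T f) g = q f g"
    and e: "eigensystem H (l2_inner M) q e l"
  shows "singular_values M H T = l"
proof -
  interpret form_pair fun_scale H "l2_inner M" q by fact
  have "singular_space M H T t = {f\<in>H. T (T f) = fun_scale (complex_of_real (t\<^sup>2)) f}" for t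
    unfolding singular_space_def using adjoint_operator_eq[OF fp T] T(1) by auto
  then have dim: "card {k. l k = t} = ip.dim (singular_space M H T t)" if "t > 0" for t
    using represents_eigenspace(2)[of T, OF T e that] by simp
  have l: "decseq l" "l \<longlonglongrightarrow> 0" using e by (simp_all add: eigensystem_def)
  show ?thesis
    unfolding singular_values_def
  proof (rule the_equality)
    show "decseq l \<and> l \<longlonglongrightarrow> 0 \<and> (\<forall>t>0. card {k. l k = t} = ip.dim (singular_space M H T t))"
      using l dim by blast
    fix s assume "decseq s \<and> s \<longlonglongrightarrow> 0 \<and>
      (\<forall>t>0. card {k. s k = t} = ip.dim (singular_space M H T t))"
    then show "s = l" using l dim by (intro decseq_multiplicity_unique) auto
  qed
qed

lemma compact_operator_iff:
  assumes fp: "form_pair fun_scale H (l2_inner M) q"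
    and T: "\<And>f. f \<in> H \<Longrightarrow> T f \<in> H" "\<And>f g. \<lbrakk>f \<in> H; g \<in> H\<rbrakk> \<Longrightarrow> l2_inner M (T f) g = q f g"
  shows "compact_operator M H T \<longleftrightarrow> form_compact H (l2_inner M) q"
proof -
  interpret form_pair fun_scale H "l2_inner M" q by fact
  have "bounded_operator M H T"
    unfolding bounded_operator_def
  proof (intro conjI ballI allI)
    show "T f \<in> H" if "f \<in> H" for f by (rule T(1)[OF that])
    show "T (\<lambda>z. f z + g z) = (\<lambda>z. T f z + T g z)" if "f \<in> H" "g \<in> H" for f g
      using represents_add[of T, OF T that] by (simp add: plus_fun_def)
    show "T (fun_scale c f) = fun_scale c (T f)" if "f \<in> H" for c f
      by (rule represents_scale[of T, OF T that])
    obtain C0 where C0: "\<forall>f\<in>H. q.nq f \<le> C0 * ip.nq f" using bounded by blast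
    define C where "C = \<bar>C0\<bar>"
    have C: "q.nq f \<le> C * ip.nq f" if "f \<in> H" for f
    proof -
      have "C0 * ip.nq f \<le> C * ip.nq f"
        using ip.nonneg[OF that] by (intro mult_right_mono) (auto simp: C_def)
      then show ?thesis using C0 that by fastforce
    qed
    have "l2_norm M (T f) \<le> C * l2_norm M f" if f: "f \<in> H" for f
    proof -
      have "ip.nq (T f) \<le> C * q.nq f" by (rule represents_le[of T, OF T C f])
      also have "\<dots> \<le> C * (C * ip.nq f)"
        using C[OF f] by (intro mult_left_mono) (auto simp: C_def)
      finally have "sqrt (ip.nq (T f)) \<le> sqrt (C\<^sup>2 * ip.nq f)"
        by (simp add: power2_eq_square mult.assoc)
      then show ?thesis by (simp add: l2_norm_eq real_sqrt_mult C_def)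
    qed
    then show "\<exists>C. \<forall>f\<in>H. l2_norm M (T f) \<le> C * l2_norm M f" by blast
  qed
  moreover have "(\<exists>B. \<forall>k. l2_norm M (F k) \<le> B) \<longleftrightarrow> (\<exists>b. \<forall>k. ip.nq (F k) \<le> b)"
    if "\<forall>k. F k \<in> H" for F :: "nat \<Rightarrow> 'a \<Rightarrow> complex"
  proof
    assume "\<exists>B. \<forall>k. l2_norm M (F k) \<le> B"
    then obtain B where "\<And>k. sqrt (ip.nq (F k)) \<le> B" by (auto simp: l2_norm_eq)
    then show "\<exists>b. \<forall>k. ip.nq (F k) \<le> b"
      by (intro exI[of _ "B\<^sup>2"] allI) (rule sqrt_le_D)
  next
    assume "\<exists>b. \<forall>k. ip.nq (F k) \<le> b"
    then obtain b where "\<forall>k. ip.nq (F k) \<le> b" by blast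
    then show "\<exists>B. \<forall>k. l2_norm M (F k) \<le> B"
      by (intro exI[of _ "sqrt b"]) (simp add: l2_norm_eq)
  qed
  moreover have "(\<lambda>k. l2_norm M (\<lambda>z. T (F (r k)) z - g z)) \<longlonglongrightarrow> 0 \<longleftrightarrow>
      (\<lambda>k. ip.nq (T (F (r k)) - g)) \<longlonglongrightarrow> 0"
    for F :: "nat \<Rightarrow> 'a \<Rightarrow> complex" and r :: "nat \<Rightarrow> nat" and g
  proof -
    have "(\<lambda>k. sqrt (ip.nq (T (F (r k)) - g))) \<longlonglongrightarrow> 0 \<longleftrightarrow>
      (\<lambda>k. ip.nq (T (F (r k)) - g)) \<longlonglongrightarrow> 0" (is "?L \<longleftrightarrow> ?R")
    proof
      assume ?L
      from tendsto_power[OF this, of 2] show ?R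
        by (simp add: l2_inner_self)
    next
      assume ?R
      from tendsto_real_sqrt[OF this] show ?L by simp
    qed
    then show ?thesis by (simp add: l2_norm_eq fun_diff_def)
  qed
  ultimately have "compact_operator M H T \<longleftrightarrow>
    (\<forall>F :: nat \<Rightarrow> 'a \<Rightarrow> complex. (\<forall>k. F k \<in> H) \<and> (\<exists>b. \<forall>k. ip.nq (F k) \<le> b) \<longrightarrow>
      (\<exists>g\<in>H. \<exists>r :: nat \<Rightarrow> nat. strict_mono r \<and> (\<lambda>k. ip.nq (T (F (r k)) - g)) \<longlonglongrightarrow> 0))"
    unfolding compact_operator_def by (simp cong: conj_cong)
  then show ?thesis using represents_compact_iff[of T] T by simp
qed

section \<open>Entire functions and circularly symmetric measures\<close>

lemma emeasure_distr_ball: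
  fixes U :: "'a::euclidean_space \<Rightarrow> 'a"
  assumes U: "linear U" "\<And>x. norm (U x) = norm x"
  shows "emeasure (distr lborel borel U) (ball 0 r) = emeasure lborel (ball 0 r :: 'a set)"
proof -
  have [measurable]: "U \<in> borel_measurable borel"
    using U(1) by (intro borel_measurable_continuous_onI linear_continuous_on)
      (simp add: linear_conv_bounded_linear)
  have "U -` ball 0 r = ball 0 r" using U(2) by auto
  then show ?thesis by (simp add: emeasure_distr)
qed

text \<open>
  Uniqueness of Haar measure: with \<open>M = distr lborel borel U\<close> and \<open>B\<close> the unit ball, evaluate
  \<open>\<integral>\<integral> f (x + y) 1\<^bsub>B\<^esub>(y) dM(x) dy\<close> in both orders.
\<close>

lemma lborel_distr_isometry:
  fixes U :: "'a::euclidean_space \<Rightarrow> 'a"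
  assumes U: "linear U" "\<And>x. norm (U x) = norm x"
  shows "distr lborel borel U = lborel"
proof -
  define M where "M = distr lborel borel U"
  define B where "B = ball (0::'a) 1"
  have [measurable]: "U \<in> borel_measurable borel"
    using U(1) by (intro borel_measurable_continuous_onI linear_continuous_on)
      (simp add: linear_conv_bounded_linear)
  have [simp, measurable_cong]: "sets M = sets borel" and [simp]: "space M = UNIV"
    by (simp_all add: M_def)
  have [measurable]: "B \<in> sets borel" by (simp add: B_def)
  have "inj U"
  proof (rule injI)
    fix x y assume "U x = U y"
    then have "U (x - y) = 0" using U(1) by (simp add: linear_diff)
    then have "norm (x - y) = 0" using U(2)[of "x - y"] by simp
    then show "x = y" by simp
  qed
  then have "surj U" using U(1) by (simp add: linear_injective_imp_surjective)
  have ball: "emeasure M (ball 0 r) = emeasure lborel (ball 0 r :: 'a set)" for r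
    unfolding M_def by (rule emeasure_distr_ball[OF U])
  interpret M: sigma_finite_measure M
  proof
    show "\<exists>A. countable A \<and> A \<subseteq> sets M \<and> \<Union>A = space M \<and> (\<forall>a\<in>A. emeasure M a \<noteq> \<infinity>)"
    proof (intro exI[of _ "range (\<lambda>n::nat. ball 0 (real n))"] conjI)
      show "\<Union> (range (\<lambda>n::nat. ball 0 (real n))) = space M"
        by (auto simp: reals_Archimedean2)
      show "\<forall>a\<in>range (\<lambda>n. ball 0 (real n)). emeasure M a \<noteq> \<infinity>"
        using emeasure_lborel_ball_finite[of "0::'a"] by (auto simp: ball top.not_eq_extremum)
    qed auto
  qed
  interpret P: pair_sigma_finite M "lborel :: 'a measure" ..
  have transl: "(\<integral>\<^sup>+x. f (x + b) \<partial>M) = (\<integral>\<^sup>+x. f x \<partial>M)"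
    if [measurable]: "f \<in> borel_measurable borel" for f :: "'a \<Rightarrow> ennreal" and b
  proof -
    \<comment> \<open>Surjectivity of U lets every translation be pulled back to a translation of
      Lebesgue measure.\<close>
    obtain a where a: "b = U a" using \<open>surj U\<close> by auto
    have "(\<integral>\<^sup>+x. f (x + b) \<partial>M) = (\<integral>\<^sup>+x. f (U (a + x)) \<partial>lborel)"
      by (simp add: M_def nn_integral_distr a linear_add[OF U(1)] add.commute)
    also have "\<dots> = (\<integral>\<^sup>+x. f (U x) \<partial>distr lborel borel ((+) a))"
      by (subst nn_integral_distr) auto
    also have "\<dots> = (\<integral>\<^sup>+x. f x \<partial>M)"
      by (simp add: lborel_distr_plus M_def nn_integral_distr)
    finally show ?thesis .
  qed
  have transl_lborel: "(\<integral>\<^sup>+x. f x \<partial>lborel) = (\<integral>\<^sup>+x. f (a + x) \<partial>lborel)"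
    if [measurable]: "f \<in> borel_measurable borel" for f :: "'a \<Rightarrow> ennreal" and a
    by (subst lborel_distr_plus[symmetric, of a]) (simp add: nn_integral_distr)
  have eq: "emeasure M A = emeasure lborel A" if [measurable]: "A \<in> sets borel" for A
  proof -
    define f g :: "'a \<Rightarrow> ennreal" where "f = indicator A" and "g = indicator B"
    have [measurable]: "f \<in> borel_measurable borel" "g \<in> borel_measurable borel"
      by (simp_all add: f_def g_def)
    have "(\<integral>\<^sup>+x. f x \<partial>M) * (\<integral>\<^sup>+y. g y \<partial>lborel) = (\<integral>\<^sup>+y. (\<integral>\<^sup>+x. f (x + y) * g y \<partial>M) \<partial>lborel)"
      by (simp add: nn_integral_multc nn_integral_cmult transl mult.commute)
    also have "\<dots> = (\<integral>\<^sup>+x. (\<integral>\<^sup>+y. f (x + y) * g y \<partial>lborel) \<partial>M)"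
      by (rule P.Fubini') simp
    also have "\<dots> = (\<integral>\<^sup>+x. (\<integral>\<^sup>+y. f y * g (y - x) \<partial>lborel) \<partial>M)"
    proof (rule nn_integral_cong)
      fix x
      show "(\<integral>\<^sup>+y. f (x + y) * g y \<partial>lborel) = (\<integral>\<^sup>+y. f y * g (y - x) \<partial>lborel)"
        by (subst (2) transl_lborel[of _ x]) auto
    qed
    also have "\<dots> = (\<integral>\<^sup>+y. (\<integral>\<^sup>+x. f y * g (y - x) \<partial>M) \<partial>lborel)"
      by (rule P.Fubini'[symmetric]) simp
    also have "\<dots> = (\<integral>\<^sup>+y. f y * (\<integral>\<^sup>+x. g x \<partial>M) \<partial>lborel)"
    proof (rule nn_integral_cong)
      fix y
      \<comment> \<open>The ball is symmetric about 0, which turns the reflected translate into a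
        plain one.\<close>
      have "g (y - x) = g (x + - y)" for x
        by (simp add: g_def B_def indicator_def norm_minus_commute)
      then have "(\<integral>\<^sup>+x. g (y - x) \<partial>M) = (\<integral>\<^sup>+x. g x \<partial>M)"
        using transl[of g "- y"] by simp
      then show "(\<integral>\<^sup>+x. f y * g (y - x) \<partial>M) = f y * (\<integral>\<^sup>+x. g x \<partial>M)"
        by (simp add: nn_integral_cmult)
    qed
    also have "\<dots> = (\<integral>\<^sup>+y. f y \<partial>lborel) * (\<integral>\<^sup>+x. g x \<partial>M)"
      by (simp add: nn_integral_multc)
    finally have "emeasure M A * emeasure lborel B = emeasure lborel A * emeasure M B"
      by (simp add: f_def g_def)
    \<comment> \<open>The two invariant measures are now proportional; an isometry preserves the
      unit ball, so the factor is 1.\<close>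
    moreover have "emeasure M B = emeasure lborel B" by (simp add: B_def ball)
    moreover have "emeasure lborel B \<noteq> 0" "emeasure lborel B \<noteq> \<top>"
      using emeasure_lborel_ball_finite[of "0::'a" 1] content_ball_pos[of 1 "0::'a"]
      by (auto simp: B_def top.not_eq_extremum measure_def)
    ultimately show ?thesis by (simp add: mult.commute[of _ "emeasure lborel B"] ennreal_mult_cancel_left)
  qed
  show ?thesis
    by (rule measure_eqI) (use eq in \<open>auto simp: M_def\<close>)
qed

lemma norm_vector_smult: "norm (c *s (z :: complex ^ 'n)) = cmod c * norm z"
  by (simp add: norm_vec_def norm_mult L2_set_right_distrib)

lemma linear_vector_smult: "linear (\<lambda>z :: complex ^ 'n. c *s z)"
  by (intro linearI) (simp_all add: vector_add_ldistrib vec_eq_iff)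

lemma bounded_linear_smult_vector: "bounded_linear (\<lambda>c. c *s (z :: complex ^ 'n))"
  by (rule linear_conv_bounded_linear[THEN iffD1], intro linearI)
    (simp_all add: vec_eq_iff distrib_right)

lemma continuous_on_vector_smult [continuous_intros]:
  fixes g :: "'a::topological_space \<Rightarrow> complex ^ 'n"
  assumes "continuous_on S f" "continuous_on S g"
  shows "continuous_on S (\<lambda>x. f x *s g x)"
  unfolding vector_scalar_mult_def using assms by (intro continuous_intros)

text \<open>The Gaussian measure and its truncations to balls are both of this kind, so one mean
  value property serves the Fock space and the splitting argument.\<close>

definition circular :: "(complex ^ 'n) measure \<Rightarrow> bool" where
  "circular M \<longleftrightarrow> finite_measure M \<and> sets M = sets borel \<and>
     (\<forall>c. cmod c = 1 \<longrightarrow> distr M borel (\<lambda>z. c *s z) = M)"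

lemma circular_density:
  fixes \<rho> :: "real \<Rightarrow> ennreal"
  assumes [measurable]: "\<rho> \<in> borel_measurable borel"
    and fin: "(\<integral>\<^sup>+z. \<rho> (norm (z :: complex ^ 'n)) \<partial>lborel) < \<infinity>"
  shows "circular (density lborel (\<lambda>z :: complex ^ 'n. \<rho> (norm z)))"
  unfolding circular_def
proof (intro conjI allI impI)
  show "finite_measure (density lborel (\<lambda>z :: complex ^ 'n. \<rho> (norm z)))"
    by (rule finite_measureI) (use fin in \<open>simp add: emeasure_density\<close>)
  fix c :: complex assume c: "cmod c = 1"
  have [measurable]: "(\<lambda>z :: complex ^ 'n. c *s z) \<in> borel_measurable borel"
    by (intro borel_measurable_continuous_onI continuous_intros)
  have inv: "distr lborel borel (\<lambda>z :: complex ^ 'n. c *s z) = lborel"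
    by (rule lborel_distr_isometry) (simp_all add: linear_vector_smult norm_vector_smult c)
  show "distr (density lborel (\<lambda>z. \<rho> (norm z))) borel (\<lambda>z :: complex ^ 'n. c *s z)
      = density lborel (\<lambda>z. \<rho> (norm z))"
  proof (rule measure_eqI)
    fix A :: "(complex ^ 'n) set"
    assume "A \<in> sets (distr (density lborel (\<lambda>z. \<rho> (norm z))) borel (\<lambda>z. c *s z))"
    then have [measurable]: "A \<in> sets borel" by simp
    have [measurable]: "(*s) c -` A \<in> sets borel"
      using measurable_sets_borel[of "(*s) c" borel A] by simp
    have "emeasure (distr (density lborel (\<lambda>z. \<rho> (norm z))) borel (\<lambda>z. c *s z)) A
        = (\<integral>\<^sup>+z. \<rho> (norm (c *s z)) * indicator A (c *s z) \<partial>lborel)"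
      by (subst emeasure_distr, simp, simp, subst emeasure_density)
        (auto simp: norm_vector_smult c intro!: nn_integral_cong split: split_indicator)
    also have "\<dots> = (\<integral>\<^sup>+z. \<rho> (norm z) * indicator A z \<partial>distr lborel borel (\<lambda>z. c *s z))"
      by (subst nn_integral_distr) auto
    also have "\<dots> = emeasure (density lborel (\<lambda>z. \<rho> (norm z))) A"
      by (simp add: inv emeasure_density)
    finally show "emeasure (distr (density lborel (\<lambda>z. \<rho> (norm z))) borel (\<lambda>z. c *s z)) A
        = emeasure (density lborel (\<lambda>z. \<rho> (norm z))) A" .
  qed simp
qed simp

section \<open>Entire functions of several variables\<close>

lemma entireD:
  assumes "entire f"
  shows "(f has_derivative frechet_derivative f (at z)) (at z)"
    and "frechet_derivative f (at z) (c *s v) = c * frechet_derivative f (at z) v"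
proof -
  obtain D where D: "(f has_derivative D) (at z)" "\<And>c v. D (c *s v) = c * D v"
    using assms unfolding entire_def by blast
  then have "frechet_derivative f (at z) = D" using frechet_derivative_at by metis
  with D show "(f has_derivative frechet_derivative f (at z)) (at z)"
    "frechet_derivative f (at z) (c *s v) = c * frechet_derivative f (at z) v" by auto
qed

lemma entireI:
  assumes "\<And>z. (f has_derivative D z) (at z)" "\<And>z c v. D z (c *s v) = c * D z v"
  shows "entire f"
  unfolding entire_def using assms by blast

lemma entire_continuous: "entire f \<Longrightarrow> continuous_on S f"
  by (meson continuous_at_imp_continuous_on entireD(1) has_derivative_continuous)

lemma entire_measurable: "entire f \<Longrightarrow> f \<in> borel_measurable borel"
  by (intro borel_measurable_continuous_onI entire_continuous)

lemma entire_const: "entire (\<lambda>z. a)"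
  by (rule entireI[where D = "\<lambda>z v. 0"]) auto

lemma entire_add: "\<lbrakk>entire f; entire g\<rbrakk> \<Longrightarrow> entire (\<lambda>z. f z + g z)"
  by (rule entireI[where D = "\<lambda>z v. frechet_derivative f (at z) v + frechet_derivative g (at z) v"])
    (auto simp: entireD distrib_left intro!: derivative_intros)

lemma entire_mult: "\<lbrakk>entire f; entire g\<rbrakk> \<Longrightarrow> entire (\<lambda>z. f z * g z)"
  by (rule entireI[where D = "\<lambda>z v. f z * frechet_derivative g (at z) v
        + frechet_derivative f (at z) v * g z"])
    (auto simp: entireD algebra_simps intro!: derivative_eq_intros)

lemma entire_cmult: "entire f \<Longrightarrow> entire (\<lambda>z. c * f z)"
  by (intro entire_mult entire_const)

lemma entire_diff: "\<lbrakk>entire f; entire g\<rbrakk> \<Longrightarrow> entire (\<lambda>z. f z - g z)"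
  using entire_add[of f "\<lambda>z. (-1) * g z"] entire_cmult[of g "-1"] by simp

lemma entire_linear: "\<lbrakk>bounded_linear L; \<And>c v. L (c *s v) = c * L v\<rbrakk> \<Longrightarrow> entire L"
  by (rule entireI[where D = "\<lambda>z. L"]) (auto intro: bounded_linear_imp_has_derivative)

lemma entire_translate: "entire f \<Longrightarrow> entire (\<lambda>z. f (z + a))"
  by (rule entireI[where D = "\<lambda>z. frechet_derivative f (at (z + a))"])
    (auto simp: entireD intro!: has_derivative_compose[of "\<lambda>z. z + a" "\<lambda>v. v", where g = f]
      derivative_eq_intros)

lemma entire_exp: "entire f \<Longrightarrow> entire (\<lambda>z. exp (f z))"
  by (rule entireI[where D = "\<lambda>z v. exp (f z) * frechet_derivative f (at z) v"])
    (auto simp: entireD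
      intro: has_derivative_compose[OF _ DERIV_exp[unfolded has_field_derivative_def]])

text \<open>Restriction to complex lines is the route by which one-variable complex analysis
  enters.\<close>

lemma entire_slice:
  assumes "entire f"
  shows "((\<lambda>\<zeta>. f (a + \<zeta> *s v)) has_field_derivative frechet_derivative f (at (a + \<zeta> *s v)) v) (at \<zeta>)"
proof -
  have "((\<lambda>\<zeta>. a + \<zeta> *s v) has_derivative (\<lambda>\<zeta>. \<zeta> *s v)) (at \<zeta>)"
    using bounded_linear_imp_has_derivative[OF bounded_linear_smult_vector[of v]]
    by (auto intro!: derivative_eq_intros)
  from has_derivative_compose[OF this entireD(1)[OF assms]]
  show ?thesis
    by (simp add: has_field_derivative_def entireD(2)[OF assms] mult.commute[of _ "frechet_derivative _ _ _"])
qed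

lemma entire_slice_holomorphic: "entire f \<Longrightarrow> (\<lambda>\<zeta>. f (a + \<zeta> *s v)) holomorphic_on S"
  using entire_slice[of f a v]
  by (auto simp: holomorphic_on_def field_differentiable_def intro: has_field_derivative_at_within)

lemma entire_slice_deriv:
  "entire f \<Longrightarrow> deriv (\<lambda>\<zeta>. f (a + \<zeta> *s v)) \<zeta> = frechet_derivative f (at (a + \<zeta> *s v)) v"
  by (rule DERIV_imp_deriv[OF entire_slice])

text \<open>Cauchy's formula at the centre of the unit circle, on the line through z: the factor 1/u
  of the integrand cancels against the derivative of the parametrization.\<close>

lemma entire_circle_mean:
  assumes f: "entire f"
  shows "((\<lambda>t. f (exp (2 * of_real pi * \<i> * of_real t) *s z)) has_integral f 0) {0..1}"
proof -
  define \<phi> where "\<phi> = (\<lambda>\<zeta>. f (\<zeta> *s z))"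
  have "\<phi> holomorphic_on S" for S
    using entire_slice_holomorphic[OF f, of 0 z] by (simp add: \<phi>_def)
  then have "((\<lambda>u. \<phi> u / (u - 0)) has_contour_integral 2 * of_real pi * \<i> * \<phi> 0) (circlepath 0 1)"
    by (intro Cauchy_integral_circlepath_simple) auto
  then have "((\<lambda>t. \<phi> (circlepath 0 1 t) / circlepath 0 1 t *
      vector_derivative (circlepath 0 1) (at t within {0..1})) has_integral
      2 * of_real pi * \<i> * \<phi> 0) {0..1}"
    by (simp add: has_contour_integral_def)
  then have "((\<lambda>t. (2 * of_real pi * \<i>) * \<phi> (exp (2 * of_real pi * \<i> * of_real t))) has_integral
      (2 * of_real pi * \<i>) * \<phi> 0) {0..1}"
  proof (rule has_integral_eq[rotated])
    fix t :: real assume t: "t \<in> {0..1}"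
    show "\<phi> (circlepath 0 1 t) / circlepath 0 1 t *
        vector_derivative (circlepath 0 1) (at t within {0..1})
      = (2 * of_real pi * \<i>) * \<phi> (exp (2 * of_real pi * \<i> * of_real t))"
      using t by (subst vector_derivative_circlepath01) (simp_all add: circlepath)
  qed
  from has_integral_mult_right[OF this, of "1 / (2 * of_real pi * \<i>)"]
  show ?thesis by (simp add: \<phi>_def)
qed

text \<open>Integrate f (c t z) over both t and z. Integrating first over z removes the rotation by
  invariance; integrating first over t leaves f 0 by the circle mean.\<close>

lemma circular_mean_value:
  fixes f :: "complex ^ 'n \<Rightarrow> complex"
  assumes f: "entire f" and M: "circular M" and int: "integrable M f"
  shows "(\<integral>z. f z \<partial>M) = f 0 * of_real (measure M UNIV)"
proof -
  define c :: "real \<Rightarrow> complex" where "c = (\<lambda>t. exp (2 * of_real pi * \<i> * of_real t))"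
  define L where "L = restrict_space lborel {0..1::real}"
  have [simp, measurable_cong]: "sets M = sets borel" and fin: "finite_measure M"
    using M by (auto simp: circular_def)
  then have spM [simp]: "space M = UNIV" using sets_eq_imp_space_eq by fastforce
  interpret M: finite_measure M by (rule fin)
  interpret L: finite_measure L
    by (rule finite_measureI) (simp add: L_def emeasure_restrict_space space_restrict_space)
  interpret P: pair_sigma_finite L M ..
  have c1: "cmod (c t) = 1" for t by (simp add: c_def)
  have rot: "distr M borel (\<lambda>z. c t *s z) = M" for t
    using M c1 by (simp add: circular_def)
  have [measurable]: "f \<in> borel_measurable borel" using f by (rule entire_measurable)
  have [measurable]: "(\<lambda>z :: complex ^ 'n. c t *s z) \<in> borel_measurable borel" for t
    by (intro borel_measurable_continuous_onI continuous_intros)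
  have shift: "(\<integral>z. g (c t *s z) \<partial>M) = (\<integral>z. g z \<partial>M)"
    if [measurable]: "g \<in> borel_measurable borel"
    for t and g :: "complex ^ 'n \<Rightarrow> 'x::{banach, second_countable_topology}"
  proof -
    have "(\<integral>z. g z \<partial>M) = (\<integral>z. g z \<partial>distr M borel (\<lambda>z. c t *s z))" by (simp add: rot)
    also have "\<dots> = (\<integral>z. g (c t *s z) \<partial>M)" by (rule integral_distr) auto
    finally show ?thesis ..
  qed
  have shift_int: "integrable M (\<lambda>z. f (c t *s z))" for t
  proof -
    have "integrable (distr M borel (\<lambda>z. c t *s z)) f" using int by (simp add: rot)
    then show ?thesis by (subst (asm) integrable_distr_eq) auto
  qed
  have "(\<lambda>p :: real \<times> (complex ^ 'n). f (c (fst p) *s snd p)) \<in> borel_measurable borel"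
    unfolding c_def
    by (intro borel_measurable_continuous_onI continuous_on_compose2[OF entire_continuous[OF f, of UNIV]]
        continuous_intros) auto
  then have "(\<lambda>p :: real \<times> (complex ^ 'n). f (c (fst p) *s snd p)) \<in> borel_measurable (borel \<Otimes>\<^sub>M borel)"
    by (simp add: borel_prod)
  moreover have "(\<lambda>p. p) \<in> L \<Otimes>\<^sub>M M \<rightarrow>\<^sub>M (borel :: real measure) \<Otimes>\<^sub>M (borel :: (complex ^ 'n) measure)"
  proof (rule measurable_pair)
    have "fst \<in> L \<Otimes>\<^sub>M M \<rightarrow>\<^sub>M borel"
      by (rule measurable_compose[OF measurable_fst])
        (simp add: L_def measurable_restrict_space1)
    then show "fst \<circ> (\<lambda>p. p) \<in> L \<Otimes>\<^sub>M M \<rightarrow>\<^sub>M borel" by (simp add: o_def)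
    have "snd \<in> L \<Otimes>\<^sub>M M \<rightarrow>\<^sub>M borel"
      by (rule measurable_compose[OF measurable_snd]) simp
    then show "snd \<circ> (\<lambda>p. p) \<in> L \<Otimes>\<^sub>M M \<rightarrow>\<^sub>M borel" by (simp add: o_def)
  qed
  ultimately have meas: "(\<lambda>p. f (c (fst p) *s snd p)) \<in> borel_measurable (L \<Otimes>\<^sub>M M)"
    by (rule measurable_compose[rotated])
  have "integrable (L \<Otimes>\<^sub>M M) (\<lambda>p. f (c (fst p) *s snd p))"
  proof (rule P.Fubini_integrable[OF meas])
    have "(\<integral>z. norm (f (c t *s z)) \<partial>M) = (\<integral>z. norm (f z) \<partial>M)" for t
      using shift[of "\<lambda>z. norm (f z)" t] by simp
    then show "integrable L (\<lambda>t. \<integral>z. norm (f (c (fst (t, z)) *s snd (t, z))) \<partial>M)" by simp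
    show "AE t in L. integrable M (\<lambda>z. f (c (fst (t, z)) *s snd (t, z)))"
      using shift_int by simp
  qed
  then have "integrable (L \<Otimes>\<^sub>M M) (\<lambda>(t, z). f (c t *s z))" by (simp add: case_prod_unfold)
  from P.Fubini_integral[OF this]
  have "(\<integral>z. (\<integral>t. f (c t *s z) \<partial>L) \<partial>M) = (\<integral>t. (\<integral>z. f (c t *s z) \<partial>M) \<partial>L)" .
  also have "\<dots> = (\<integral>z. f z \<partial>M)"
    by (simp add: shift) (simp add: L_def measure_restrict_space space_restrict_space)
  also have "(\<integral>z. (\<integral>t. f (c t *s z) \<partial>L) \<partial>M) = (\<integral>z. f 0 \<partial>M)"
  proof (rule Bochner_Integration.integral_cong[OF refl])
    fix z
    have cont: "continuous_on {0..1} (\<lambda>t. f (c t *s z))"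
      unfolding c_def
      by (intro continuous_on_compose2[OF entire_continuous[OF f, of UNIV]] continuous_intros) auto
    have "(\<integral>t. f (c t *s z) \<partial>L) = (LINT t:{0..1}|lborel. f (c t *s z))"
      by (simp add: L_def integral_restrict_space set_lebesgue_integral_def)
    also have "\<dots> = integral {0..1} (\<lambda>t. f (c t *s z))"
      by (intro set_borel_integral_eq_integral borel_integrable_atLeastAtMost' cont)
    also have "\<dots> = f 0"
      using entire_circle_mean[OF f, of z] by (simp add: c_def integral_unique)
    finally show "(\<integral>t. f (c t *s z) \<partial>L) = f 0" .
  qed
  finally show ?thesis by (simp add: mult.commute scaleR_conv_of_real)
qed

lemma entire_cauchy_estimate:
  assumes f: "entire f" and r: "0 < r" and B: "\<And>w. norm (w - z) \<le> r \<Longrightarrow> cmod (f w) \<le> B"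
  shows "cmod (frechet_derivative f (at z) v) \<le> B / r * norm v"
proof (cases "v = 0")
  case True
  have "frechet_derivative f (at z) 0 = 0" using entireD(2)[OF f, of z 0 0] by simp
  then show ?thesis using True by simp
next
  case False
  \<comment> \<open>The disc of radius s on the line through z in direction v lies in the ball of
    radius r around z.\<close>
  define s where "s = r / norm v"
  have s: "0 < s" using r False by (simp add: s_def)
  have "norm ((deriv ^^ 1) (\<lambda>\<zeta>. f (z + \<zeta> *s v)) 0) \<le> fact 1 * B / s ^ 1"
  proof (rule Cauchy_inequality)
    show "(\<lambda>\<zeta>. f (z + \<zeta> *s v)) holomorphic_on ball 0 s" by (rule entire_slice_holomorphic[OF f])
    show "continuous_on (cball 0 s) (\<lambda>\<zeta>. f (z + \<zeta> *s v))"
      by (rule holomorphic_on_imp_continuous_on[OF entire_slice_holomorphic[OF f]])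
    fix x :: complex assume "norm (0 - x) = s"
    then have "norm ((z + x *s v) - z) \<le> r" using False by (simp add: norm_vector_smult s_def)
    then show "norm (f (z + x *s v)) \<le> B" by (rule B)
  qed (rule s)
  then show ?thesis by (simp add: entire_slice_deriv[OF f] s_def)
qed

lemma frechet_derivative_entire_diff:
  fixes f g :: "complex ^ 'n \<Rightarrow> complex"
  assumes "entire f" "entire g"
  shows "frechet_derivative (\<lambda>z. f z - g z) (at z) v
    = frechet_derivative f (at z) v - frechet_derivative g (at z) v"
proof -
  have "((\<lambda>z. f z - g z) has_derivative (\<lambda>v. frechet_derivative f (at z) v - frechet_derivative g (at z) v)) (at z)"
    by (intro derivative_intros entireD assms)
  from frechet_derivative_at[OF this] show ?thesis by metis
qed

text \<open>The Cauchy estimate turns uniform convergence on a ball into uniform convergence of the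
  derivatives on a smaller ball, so the limit may be differentiated termwise; complex linearity
  passes to the limit.\<close>

lemma entire_uniform_limit:
  fixes F :: "nat \<Rightarrow> complex ^ 'n \<Rightarrow> complex"
  assumes F: "\<And>n. entire (F n)"
    and lim: "\<And>R. uniform_limit (cball 0 R) F f sequentially"
  shows "entire f"
  unfolding entire_def
proof
  fix z0 :: "complex ^ 'n"
  define R where "R = norm z0 + 1"
  define S where "S = ball (0 :: complex ^ 'n) R"
  have z0: "z0 \<in> S" by (simp add: S_def R_def)
  define F' where "F' = (\<lambda>n z. frechet_derivative (F n) (at z))"
  have cau: "\<exists>N. \<forall>m\<ge>N. \<forall>n\<ge>N. \<forall>x\<in>S. \<forall>h. norm (F' m x h - F' n x h) \<le> e * norm h"
    if e: "0 < e" for e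
  proof -
    \<comment> \<open>The extra radius 1 leaves room for a Cauchy estimate around every point of
      S.\<close>
    have "uniformly_Cauchy_on (cball 0 (R + 1)) F"
      using lim[of "R + 1"] by (auto simp: uniformly_convergent_Cauchy uniformly_convergentI)
    then obtain N where N: "\<And>m n x. \<lbrakk>m \<ge> N; n \<ge> N; x \<in> cball 0 (R + 1)\<rbrakk> \<Longrightarrow> dist (F m x) (F n x) < e"
      using e unfolding uniformly_Cauchy_on_def by meson
    have "norm (F' m x h - F' n x h) \<le> e * norm h" if "m \<ge> N" "n \<ge> N" "x \<in> S" for m n x h
    proof -
      have "cmod (frechet_derivative (\<lambda>z. F m z - F n z) (at x) h) \<le> e / 1 * norm h"
      proof (rule entire_cauchy_estimate)
        show "entire (\<lambda>z. F m z - F n z)" by (intro entire_diff F)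
        fix w assume "norm (w - x) \<le> 1"
        then have "norm w \<le> R + 1"
          using that(3) norm_triangle_sub[of w x] by (simp add: S_def)
        then show "cmod (F m w - F n w) \<le> e"
          using N[OF that(1,2), of w] by (simp add: dist_norm)
      qed simp
      then show ?thesis by (simp add: F'_def frechet_derivative_entire_diff F)
    qed
    then show ?thesis by blast
  qed
  have "convergent (\<lambda>n. F' n x h)" if x: "x \<in> S" for x h
  proof (rule Cauchy_convergent, rule CauchyI)
    fix e :: real assume e: "0 < e"
    have "0 < e / (norm h + 1)" using e by (simp add: add_nonneg_pos)
    from cau[OF this] obtain N where N: "\<And>m n. \<lbrakk>m \<ge> N; n \<ge> N\<rbrakk> \<Longrightarrow>
        norm (F' m x h - F' n x h) \<le> e / (norm h + 1) * norm h" using x by blast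
    have "e / (norm h + 1) * norm h < e"
      using e by (simp add: pos_divide_less_eq add_nonneg_pos)
    then show "\<exists>M. \<forall>m\<ge>M. \<forall>n\<ge>M. norm (F' m x h - F' n x h) < e"
      using N by (meson le_less_trans)
  qed
  then have F'lim: "(\<lambda>n. F' n x h) \<longlonglongrightarrow> lim (\<lambda>n. F' n x h)" if "x \<in> S" for x h
    using that convergent_LIMSEQ_iff by blast
  define g' where "g' = (\<lambda>x h. lim (\<lambda>n. F' n x h))"
  have "\<exists>g. \<forall>x\<in>S. (\<lambda>n. F n x) \<longlonglongrightarrow> g x \<and> (g has_derivative g' x) (at x within S)"
  proof (rule has_derivative_sequence[where ?x0.0 = z0])
    show "convex S" by (simp add: S_def)
    show "(F n has_derivative F' n x) (at x within S)" for n x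
      unfolding F'_def by (rule has_derivative_at_withinI[OF entireD(1)[OF F]])
    show "\<forall>\<^sub>F n in sequentially. \<forall>x\<in>S. \<forall>h. norm (F' n x h - g' x h) \<le> e * norm h"
      if e: "0 < e" for e
    proof -
      obtain N where N: "\<And>m n x h. \<lbrakk>m \<ge> N; n \<ge> N; x \<in> S\<rbrakk> \<Longrightarrow> norm (F' m x h - F' n x h) \<le> e * norm h"
        using cau[OF e] by blast
      have "norm (F' n x h - g' x h) \<le> e * norm h" if "n \<ge> N" "x \<in> S" for n x h
      proof (rule LIMSEQ_le_const2)
        show "(\<lambda>m. norm (F' n x h - F' m x h)) \<longlonglongrightarrow> norm (F' n x h - g' x h)"
          unfolding g'_def by (intro tendsto_intros F'lim that)
        show "\<exists>M. \<forall>m\<ge>M. norm (F' n x h - F' m x h) \<le> e * norm h"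
          using N[OF that(1) _ that(2)] by blast
      qed
      then show ?thesis unfolding eventually_sequentially by blast
    qed
    show "z0 \<in> S" by (rule z0)
    show "(\<lambda>n. F n z0) \<longlonglongrightarrow> f z0"
      using tendsto_uniform_limitI[OF lim[of R]] z0 by (simp add: S_def)
  qed
  then obtain g where g: "\<And>x. x \<in> S \<Longrightarrow> (\<lambda>n. F n x) \<longlonglongrightarrow> g x"
    "\<And>x. x \<in> S \<Longrightarrow> (g has_derivative g' x) (at x within S)" by blast
  have gf: "g x = f x" if "x \<in> S" for x
    using LIMSEQ_unique[OF g(1)[OF that]] tendsto_uniform_limitI[OF lim[of R], of x] that
    by (simp add: S_def)
  have "open S" by (simp add: S_def)
  have "(g has_derivative g' z0) (at z0)"
    using g(2)[OF z0] unfolding at_within_open[OF z0 \<open>open S\<close>] .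
  then have "(f has_derivative g' z0) (at z0)"
    by (rule has_derivative_transform_within_open[OF _ \<open>open S\<close> z0 gf])
  moreover have "g' z0 (c *s v) = c * g' z0 v" for c v
  proof (rule LIMSEQ_unique)
    show "(\<lambda>n. F' n z0 (c *s v)) \<longlonglongrightarrow> g' z0 (c *s v)" unfolding g'_def by (rule F'lim[OF z0])
    have "(\<lambda>n. c * F' n z0 v) \<longlonglongrightarrow> c * g' z0 v"
      unfolding g'_def by (intro tendsto_intros F'lim z0)
    then show "(\<lambda>n. F' n z0 (c *s v)) \<longlonglongrightarrow> c * g' z0 v" by (simp add: F'_def entireD(2)[OF F])
  qed
  ultimately show "\<exists>D. (f has_derivative D) (at z0) \<and> (\<forall>c v. D (c *s v) = c * D v)" by blast
qed

text \<open>The difference quotients with step 1/(n+1) are entire, and Taylor's formula on slices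
  shows that they converge locally uniformly. Second-order smoothness of entire functions rests on
  this.\<close>

lemma entire_derivative:
  fixes f :: "complex ^ 'n \<Rightarrow> complex"
  assumes f: "entire f"
  shows "entire (\<lambda>z. frechet_derivative f (at z) v)"
proof (rule entire_uniform_limit)
  define F where "F = (\<lambda>n z. of_nat (Suc n) * (f (z + (1 / of_nat (Suc n)) *s v) - f z))"
  show "entire (F n)" for n
    unfolding F_def by (intro entire_cmult entire_diff entire_translate f)
  show "uniform_limit (cball 0 R) F (\<lambda>z. frechet_derivative f (at z) v) sequentially" for R
  proof -
    \<comment> \<open>Taylor's formula is used on the unit disc of each slice, and bounding the
      second derivative there needs one more unit of radius, hence 2 norm v. The Cauchy bound 2 B
      gives the Taylor remainder 2 B |t|^2.\<close>
    define K where "K = cball (0 :: complex ^ 'n) (R + 2 * norm v)"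
    have "bounded (f ` K)"
      by (intro compact_imp_bounded compact_continuous_image entire_continuous f) (simp add: K_def)
    then obtain B where B: "\<And>w. w \<in> K \<Longrightarrow> cmod (f w) \<le> B"
      unfolding bounded_iff by blast
    have bound: "cmod (F n z - frechet_derivative f (at z) v) \<le> 2 * B / of_nat (Suc n)"
      if z: "z \<in> cball 0 R" for n z
    proof -
      define \<phi> where "\<phi> = (\<lambda>\<zeta>. f (z + \<zeta> *s v))"
      have hol: "\<phi> holomorphic_on S" for S
        unfolding \<phi>_def by (rule entire_slice_holomorphic[OF f])
      have \<phi>B: "cmod (\<phi> \<zeta>) \<le> B" if "cmod \<zeta> \<le> 2" for \<zeta>
      proof -
        have "norm (z + \<zeta> *s v) \<le> norm z + cmod \<zeta> * norm v"
          using norm_triangle_ineq[of z "\<zeta> *s v"] by (simp add: norm_vector_smult)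
        also have "\<dots> \<le> R + 2 * norm v" using z that by (intro add_mono mult_right_mono) auto
        finally show ?thesis unfolding \<phi>_def by (intro B) (simp add: K_def)
      qed
      define t :: complex where "t = 1 / of_nat (Suc n)"
      have t: "cmod t = 1 / of_nat (Suc n)" by (simp only: t_def norm_divide norm_of_nat norm_one)
      have "cmod ((deriv ^^ 0) \<phi> t - (\<Sum>i\<le>1. (deriv ^^ i) \<phi> 0 * (t - 0) ^ i / fact i))
          \<le> (2 * B) * cmod (t - 0) ^ Suc 1 / fact 1"
      proof (rule complex_Taylor[of "cball 0 1"])
        show "((deriv ^^ i) \<phi> has_field_derivative (deriv ^^ Suc i) \<phi> x) (at x within cball 0 1)" for i x
          using holomorphic_derivI[OF holomorphic_higher_deriv[OF hol[of UNIV] open_UNIV], of x i]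
          by (auto intro: has_field_derivative_at_within)
        show "cmod ((deriv ^^ Suc 1) \<phi> x) \<le> 2 * B" if x: "x \<in> cball 0 1" for x
        proof -
          have "norm ((deriv ^^ 2) \<phi> x) \<le> fact 2 * B / 1 ^ 2"
          proof (rule Cauchy_inequality[OF hol holomorphic_on_imp_continuous_on[OF hol]])
            fix y assume "norm (x - y) = 1"
            then show "norm (\<phi> y) \<le> B"
              using x norm_triangle_sub[of y x] by (intro \<phi>B) (simp add: norm_minus_commute)
          qed simp
          then show ?thesis by (simp add: numeral_2_eq_2)
        qed
        show "t \<in> cball 0 1" using t by simp
      qed auto
      then have T: "cmod (\<phi> t - (\<phi> 0 + deriv \<phi> 0 * t)) \<le> 2 * B * (cmod t)\<^sup>2"
        by (simp add: numeral_2_eq_2)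
      have "F n z - frechet_derivative f (at z) v = of_nat (Suc n) * (\<phi> t - (\<phi> 0 + deriv \<phi> 0 * t))"
        using entire_slice_deriv[OF f, of z v 0]
        by (simp add: F_def \<phi>_def t_def field_simps del: of_nat_Suc)
      then have "cmod (F n z - frechet_derivative f (at z) v)
          = of_nat (Suc n) * cmod (\<phi> t - (\<phi> 0 + deriv \<phi> 0 * t))"
        by (simp only: norm_mult norm_of_nat)
      also have "\<dots> \<le> of_nat (Suc n) * (2 * B * (cmod t)\<^sup>2)" by (intro mult_left_mono T) simp
      also have "\<dots> = 2 * B / of_nat (Suc n)" unfolding t by (simp add: power2_eq_square)
      finally show ?thesis .
    qed
    show ?thesis
    proof (rule uniform_limitI)
      fix e :: real assume e: "0 < e"
      have "(\<lambda>n. 2 * B / of_nat (Suc n)) \<longlonglongrightarrow> 0"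
        using tendsto_mult_right_zero[OF LIMSEQ_inverse_real_of_nat, of "2 * B"]
        by (simp add: divide_inverse)
      from order_tendstoD(2)[OF this e]
      show "\<forall>\<^sub>F n in sequentially. \<forall>z\<in>cball 0 R. dist (F n z) (frechet_derivative f (at z) v) < e"
      proof eventually_elim
        case (elim n)
        show ?case unfolding dist_norm using le_less_trans[OF bound elim] by blast
      qed
    qed
  qed
qed

section \<open>The Fock space\<close>

definition gauss_weight :: "real \<Rightarrow> complex ^ 'n \<Rightarrow> real" where
  "gauss_weight \<alpha> z = exp (- (norm z)\<^sup>2 / \<alpha>) / (pi * \<alpha>) ^ CARD('n)"

lemma gauss_weight_measurable [measurable]: "gauss_weight \<alpha> \<in> borel_measurable borel"
  unfolding gauss_weight_def by measurable

lemma gauss_weight_nonneg: "\<alpha> > 0 \<Longrightarrow> 0 \<le> gauss_weight \<alpha> z"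
  by (simp add: gauss_weight_def)

lemma gauss_measure_eq: "gauss_measure \<alpha> = density lborel (\<lambda>z. ennreal (gauss_weight \<alpha> z))"
  by (simp add: gauss_measure_def gauss_weight_def)

lemma sets_gauss_measure [simp, measurable_cong]: "sets (gauss_measure \<alpha>) = sets borel"
  and space_gauss_measure [simp]: "space (gauss_measure \<alpha>) = UNIV"
  by (simp_all add: gauss_measure_def)

lemma nn_integral_gauss_weight:
  assumes \<alpha>: "\<alpha> > 0"
  shows "(\<integral>\<^sup>+z. ennreal (gauss_weight \<alpha> (z :: complex ^ 'n)) \<partial>lborel) = 1"
proof -
  \<comment> \<open>The Gaussian is the product of 2n real normal densities, each of variance
    \<alpha>/2.\<close>
  define \<sigma> where "\<sigma> = sqrt (\<alpha> / 2)"
  have \<sigma>: "0 < \<sigma>" "2 * \<sigma>\<^sup>2 = \<alpha>" using \<alpha> by (auto simp: \<sigma>_def)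
  have dim: "DIM(complex ^ 'n) = 2 * CARD('n)" by (simp add: mult.commute)
  have prod: "gauss_weight \<alpha> z = (\<Prod>b\<in>Basis. normal_density 0 \<sigma> (z \<bullet> b))" for z :: "complex ^ 'n"
  proof -
    have "(\<Prod>b\<in>Basis. normal_density 0 \<sigma> (z \<bullet> b))
        = (\<Prod>b\<in>(Basis :: (complex ^ 'n) set). 1 / sqrt (pi * \<alpha>)) * (\<Prod>b\<in>Basis. exp (- (z \<bullet> b)\<^sup>2 / \<alpha>))"
    proof -
      have "2 * pi * \<sigma>\<^sup>2 = pi * \<alpha>" unfolding \<sigma>(2)[symmetric] by simp
      then have "normal_density 0 \<sigma> x = 1 / sqrt (pi * \<alpha>) * exp (- x\<^sup>2 / \<alpha>)" for x
        using \<sigma>(2) by (simp add: normal_density_def)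
      then show ?thesis by (simp only: prod.distrib)
    qed
    also have "(\<Prod>b\<in>Basis. exp (- (z \<bullet> b)\<^sup>2 / \<alpha>)) = exp (- (norm z)\<^sup>2 / \<alpha>)"
      by (simp add: exp_sum[symmetric] sum_negf sum_divide_distrib[symmetric] norm_eq_sqrt_inner[of z]
          euclidean_inner[of z z] sum_nonneg power2_eq_square)
    also have "(\<Prod>b\<in>(Basis :: (complex ^ 'n) set). 1 / sqrt (pi * \<alpha>)) = 1 / (pi * \<alpha>) ^ CARD('n)"
      unfolding prod_constant dim power_mult using \<alpha> by (simp add: power_divide)
    finally show ?thesis by (simp add: gauss_weight_def)
  qed
  have "(\<integral>\<^sup>+z. ennreal (gauss_weight \<alpha> (z :: complex ^ 'n)) \<partial>lborel)
      = (\<integral>\<^sup>+z. (\<Prod>b\<in>Basis. ennreal (normal_density 0 \<sigma> ((z :: complex ^ 'n) \<bullet> b))) \<partial>lborel)"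
    by (simp add: prod prod_ennreal)
  also have "\<dots> = (\<Prod>b\<in>(Basis :: (complex ^ 'n) set). \<integral>\<^sup>+x. ennreal (normal_density 0 \<sigma> x) \<partial>lborel)"
    by (rule nn_integral_lborel_prod) auto
  also have "(\<integral>\<^sup>+x. ennreal (normal_density 0 \<sigma> x) \<partial>lborel) = 1"
    using \<sigma>(1) by (subst nn_integral_eq_integral) auto
  finally show ?thesis by simp
qed

lemma circular_gauss_measure:
  assumes \<alpha>: "\<alpha> > 0"
  shows "circular (gauss_measure \<alpha> :: (complex ^ 'n) measure)"
proof -
  have "circular (density lborel (\<lambda>z :: complex ^ 'n.
      ennreal (exp (- (norm z)\<^sup>2 / \<alpha>) / (pi * \<alpha>) ^ CARD('n))))"
    using nn_integral_gauss_weight[OF \<alpha>, where 'n = 'n]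
    by (intro circular_density[where \<rho> = "\<lambda>r. ennreal (exp (- r\<^sup>2 / \<alpha>) / (pi * \<alpha>) ^ CARD('n))"])
      (simp_all add: gauss_weight_def)
  then show ?thesis by (simp add: gauss_measure_def)
qed

lemma emeasure_gauss_measure:
  assumes \<alpha>: "\<alpha> > 0"
  shows "emeasure (gauss_measure \<alpha> :: (complex ^ 'n) measure) UNIV = 1"
  using nn_integral_gauss_weight[OF \<alpha>, where 'n = 'n] by (simp add: gauss_measure_eq emeasure_density)

lemma measure_gauss_measure:
  "\<alpha> > 0 \<Longrightarrow> measure (gauss_measure \<alpha> :: (complex ^ 'n) measure) UNIV = 1"
  using emeasure_gauss_measure[of \<alpha>, where 'n = 'n] by (simp add: measure_def)

lemma finite_gauss_measure: "\<alpha> > 0 \<Longrightarrow> finite_measure (gauss_measure \<alpha> :: (complex ^ 'n) measure)"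
  using circular_gauss_measure[of \<alpha>, where 'n = 'n] by (simp add: circular_def)

section \<open>Square integrable functions and the Gaussian inner product\<close>

lemma borel_measurable_cnj' [measurable (raw)]:
  "f \<in> borel_measurable M \<Longrightarrow> (\<lambda>x. cnj (f x)) \<in> borel_measurable M"
  by (rule measurable_compose[OF _
        borel_measurable_continuous_onI[OF continuous_on_cnj[OF continuous_on_id]]])

lemma square_integrable_cnj: "square_integrable M f \<Longrightarrow> square_integrable M (\<lambda>z. cnj (f z))"
  by (auto simp: square_integrable_def)

lemma square_integrable_mult:
  assumes "square_integrable M f" "square_integrable M g"
  shows "integrable M (\<lambda>z. f z * g z)"
proof (rule Bochner_Integration.integrable_bound)
  show "integrable M (\<lambda>z. (cmod (f z))\<^sup>2 + (cmod (g z))\<^sup>2)"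
    using assms by (auto simp: square_integrable_def)
  show "(\<lambda>z. f z * g z) \<in> borel_measurable M" using assms by (auto simp: square_integrable_def)
  have "cmod a * cmod b \<le> (cmod a)\<^sup>2 + (cmod b)\<^sup>2" for a b
  proof -
    have "0 \<le> cmod a * cmod b" by simp
    then show ?thesis using sum_squares_bound[of "cmod a" "cmod b"] unfolding mult.assoc by linarith
  qed
  then show "AE z in M. norm (f z * g z) \<le> norm ((cmod (f z))\<^sup>2 + (cmod (g z))\<^sup>2)"
    by (simp add: norm_mult)
qed

lemma square_integrable_mult_cnj:
  "\<lbrakk>square_integrable M f; square_integrable M g\<rbrakk> \<Longrightarrow> integrable M (\<lambda>z. f z * cnj (g z))"
  by (intro square_integrable_mult square_integrable_cnj)

lemma square_integrable_add:
  assumes "square_integrable M f" "square_integrable M g"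
  shows "square_integrable M (\<lambda>z. f z + g z)"
  unfolding square_integrable_def
proof
  show m: "(\<lambda>z. f z + g z) \<in> borel_measurable M" using assms by (auto simp: square_integrable_def)
  show "integrable M (\<lambda>z. (cmod (f z + g z))\<^sup>2)"
  proof (rule Bochner_Integration.integrable_bound)
    show "integrable M (\<lambda>z. 2 * (cmod (f z))\<^sup>2 + 2 * (cmod (g z))\<^sup>2)"
      using assms by (auto simp: square_integrable_def)
    show "(\<lambda>z. (cmod (f z + g z))\<^sup>2) \<in> borel_measurable M" using m by measurable
    have "(cmod (a + b))\<^sup>2 \<le> 2 * (cmod a)\<^sup>2 + 2 * (cmod b)\<^sup>2" for a b
    proof -
      have "(cmod (a + b))\<^sup>2 \<le> (cmod a + cmod b)\<^sup>2" by (intro power_mono norm_triangle_ineq) simp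
      then show ?thesis using sum_squares_bound[of "cmod a" "cmod b"] by (simp add: power2_sum)
    qed
    then show "AE z in M. norm ((cmod (f z + g z))\<^sup>2) \<le> norm (2 * (cmod (f z))\<^sup>2 + 2 * (cmod (g z))\<^sup>2)"
      by simp
  qed
qed

lemma square_integrable_cmult:
  "square_integrable M f \<Longrightarrow> square_integrable M (\<lambda>z. c * f z)"
  by (auto simp: square_integrable_def norm_mult power_mult_distrib)

lemma square_integrable_diff:
  assumes "square_integrable M f" "square_integrable M g"
  shows "square_integrable M (\<lambda>z. f z - g z)"
  using square_integrable_add[OF assms(1) square_integrable_cmult[OF assms(2), of "-1"]] by simp

lemma psd_form_l2:
  assumes sub: "module.subspace fun_scale H" and sq: "\<And>f. f \<in> H \<Longrightarrow> square_integrable M f"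
  shows "psd_form fun_scale H (l2_inner M)"
proof (intro psd_form.intro vector_space_fun_scale psd_form_axioms.intro sub)
  fix f g h assume "f \<in> H" "g \<in> H" "h \<in> H"
  then have "integrable M (\<lambda>z. f z * cnj (h z))" "integrable M (\<lambda>z. g z * cnj (h z))"
    using square_integrable_mult_cnj sq by blast+
  then show "l2_inner M (f + g) h = l2_inner M f h + l2_inner M g h"
    by (simp add: l2_inner_def distrib_right)
next
  fix c f g assume "f \<in> H" "g \<in> H"
  then show "l2_inner M (fun_scale c f) g = c * l2_inner M f g"
    by (simp add: l2_inner_def mult.assoc)
next
  fix f g
  have "cnj (l2_inner M f g) = (\<integral>z. cnj (f z * cnj (g z)) \<partial>M)"
    unfolding l2_inner_def by (rule Bochner_Integration.integral_cnj[symmetric])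
  then show "l2_inner M g f = cnj (l2_inner M f g)" by (simp add: l2_inner_def mult.commute)
next
  fix f show "0 \<le> Re (l2_inner M f f)"
    unfolding l2_inner_def complex_norm_square[symmetric] integral_complex_of_real by simp
qed

lemma subspace_fock_space: "\<alpha> > 0 \<Longrightarrow> module.subspace fun_scale (fock_space \<alpha>)"
proof -
  interpret vector_space "fun_scale :: complex \<Rightarrow> (complex ^ 'n \<Rightarrow> complex) \<Rightarrow> _"
    by (rule vector_space_fun_scale)
  assume "\<alpha> > 0"
  then interpret finite_measure "gauss_measure \<alpha> :: (complex ^ 'n) measure" by (rule finite_gauss_measure)
  show ?thesis
    unfolding subspace_def fock_space_def
    by (auto simp: entire_add entire_cmult square_integrable_add square_integrable_cmult plus_fun_def
        zero_fun_def entire_const) (simp add: square_integrable_def)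
qed

lemma fock_space_const: "\<alpha> > 0 \<Longrightarrow> (\<lambda>z. a) \<in> fock_space \<alpha>"
proof -
  assume "\<alpha> > 0"
  then interpret finite_measure "gauss_measure \<alpha> :: (complex ^ 'n) measure" by (rule finite_gauss_measure)
  show ?thesis by (simp add: fock_space_def entire_const square_integrable_def)
qed

lemma fock_space_add: "\<lbrakk>f \<in> fock_space \<alpha>; g \<in> fock_space \<alpha>\<rbrakk> \<Longrightarrow> (\<lambda>z. f z + g z) \<in> fock_space \<alpha>"
  by (simp add: fock_space_def entire_add square_integrable_add)

lemma fock_space_cmult: "f \<in> fock_space \<alpha> \<Longrightarrow> (\<lambda>z. c * f z) \<in> fock_space \<alpha>"
  by (simp add: fock_space_def entire_cmult square_integrable_cmult)

lemma fock_space_diff: "\<lbrakk>f \<in> fock_space \<alpha>; g \<in> fock_space \<alpha>\<rbrakk> \<Longrightarrow> (\<lambda>z. f z - g z) \<in> fock_space \<alpha>"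
  by (simp add: fock_space_def entire_diff square_integrable_diff)

text \<open>Read as the inner product of f with the function cnj g, this makes Fock space orthogonal
  to the conjugates of its functions that vanish at 0.\<close>

lemma fock_space_mean:
  fixes f g :: "complex ^ 'n \<Rightarrow> complex"
  assumes \<alpha>: "\<alpha> > 0" and f: "f \<in> fock_space \<alpha>" and g: "g \<in> fock_space \<alpha>"
  shows "(\<integral>z. f z * g z \<partial>gauss_measure \<alpha>) = f 0 * g 0"
  using circular_mean_value[OF entire_mult circular_gauss_measure[OF \<alpha>] square_integrable_mult, of f g]
    f g measure_gauss_measure[OF \<alpha>, where 'n = 'n] by (simp add: fock_space_def)

section \<open>Translations, the reproducing kernel and completeness\<close>

lemma gauss_weight_translate:
  "gauss_weight \<alpha> (w + a) = gauss_weight \<alpha> w * exp (- (2 * (w \<bullet> a) + (norm a)\<^sup>2) / \<alpha>)"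
proof -
  have "- (norm (w + a))\<^sup>2 / \<alpha> = - (norm w)\<^sup>2 / \<alpha> + - (2 * (w \<bullet> a) + (norm a)\<^sup>2) / \<alpha>"
    unfolding power2_norm_eq_inner
    by (simp add: inner_add inner_commute add_divide_distrib diff_divide_distrib algebra_simps)
  then show ?thesis by (simp only: gauss_weight_def exp_add) simp
qed

text \<open>The exponential factor is the ratio of the Gaussian densities at w + a and w. The change
  of variable moves evaluation at a to evaluation at 0, where the mean value property
  applies.\<close>

lemma gauss_measure_translate:
  fixes f :: "complex ^ 'n \<Rightarrow> 'b::{banach, second_countable_topology}"
  assumes \<alpha>: "\<alpha> > 0" and [measurable]: "f \<in> borel_measurable borel"
  shows "integrable (gauss_measure \<alpha>) (\<lambda>w. exp (- (2 * (w \<bullet> a) + (norm a)\<^sup>2) / \<alpha>) *\<^sub>R f (w + a))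
      \<longleftrightarrow> integrable (gauss_measure \<alpha>) f"
    and "(\<integral>w. exp (- (2 * (w \<bullet> a) + (norm a)\<^sup>2) / \<alpha>) *\<^sub>R f (w + a) \<partial>gauss_measure \<alpha>)
      = (\<integral>z. f z \<partial>gauss_measure \<alpha>)"
proof -
  have [measurable]: "(\<lambda>w :: complex ^ 'n. exp (- (2 * (w \<bullet> a) + (norm a)\<^sup>2) / \<alpha>)) \<in> borel_measurable borel"
    using \<alpha> by (intro borel_measurable_continuous_onI continuous_intros) auto
  have w: "gauss_weight \<alpha> (a + w) *\<^sub>R f (a + w)
      = gauss_weight \<alpha> w *\<^sub>R (exp (- (2 * (w \<bullet> a) + (norm a)\<^sup>2) / \<alpha>) *\<^sub>R f (w + a))" for w
    by (simp add: gauss_weight_translate add.commute[of a])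
  have "integrable (gauss_measure \<alpha>) f \<longleftrightarrow> integrable lborel (\<lambda>z. gauss_weight \<alpha> z *\<^sub>R f z)"
    unfolding gauss_measure_eq by (rule integrable_density) (auto simp: gauss_weight_nonneg[OF \<alpha>])
  also have "\<dots> \<longleftrightarrow> integrable (distr lborel borel ((+) a)) (\<lambda>z. gauss_weight \<alpha> z *\<^sub>R f z)"
    by (simp add: lborel_distr_plus)
  also have "\<dots> \<longleftrightarrow> integrable lborel (\<lambda>w. gauss_weight \<alpha> (a + w) *\<^sub>R f (a + w))"
    by (rule integrable_distr_eq) auto
  also have "\<dots> \<longleftrightarrow> integrable (gauss_measure \<alpha>) (\<lambda>w. exp (- (2 * (w \<bullet> a) + (norm a)\<^sup>2) / \<alpha>) *\<^sub>R f (w + a))"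
    unfolding gauss_measure_eq w by (rule integrable_density[symmetric]) (auto simp: gauss_weight_nonneg[OF \<alpha>])
  finally show "integrable (gauss_measure \<alpha>) (\<lambda>w. exp (- (2 * (w \<bullet> a) + (norm a)\<^sup>2) / \<alpha>) *\<^sub>R f (w + a))
      \<longleftrightarrow> integrable (gauss_measure \<alpha>) f" ..
  have "(\<integral>z. f z \<partial>gauss_measure \<alpha>) = (\<integral>z. gauss_weight \<alpha> z *\<^sub>R f z \<partial>lborel)"
    unfolding gauss_measure_eq by (rule integral_density) (auto simp: gauss_weight_nonneg[OF \<alpha>])
  also have "\<dots> = (\<integral>z. gauss_weight \<alpha> z *\<^sub>R f z \<partial>distr lborel borel ((+) a))"
    by (simp add: lborel_distr_plus)
  also have "\<dots> = (\<integral>w. gauss_weight \<alpha> (a + w) *\<^sub>R f (a + w) \<partial>lborel)"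
    by (rule integral_distr) auto
  also have "\<dots> = (\<integral>w. exp (- (2 * (w \<bullet> a) + (norm a)\<^sup>2) / \<alpha>) *\<^sub>R f (w + a) \<partial>gauss_measure \<alpha>)"
    unfolding gauss_measure_eq w by (rule integral_density[symmetric]) (auto simp: gauss_weight_nonneg[OF \<alpha>])
  finally show "(\<integral>w. exp (- (2 * (w \<bullet> a) + (norm a)\<^sup>2) / \<alpha>) *\<^sub>R f (w + a) \<partial>gauss_measure \<alpha>)
      = (\<integral>z. f z \<partial>gauss_measure \<alpha>)" ..
qed

text \<open>The inner product of the library on complex vectors is only the real part of this sum;
  holomorphy of the kernel needs the complex one.\<close>

definition herm :: "complex ^ 'n \<Rightarrow> complex ^ 'n \<Rightarrow> complex" where
  "herm z a = (\<Sum>i\<in>UNIV. z $ i * cnj (a $ i))"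

lemma herm_add: "herm (z + w) a = herm z a + herm w a"
  by (simp add: herm_def distrib_right sum.distrib)

lemma herm_self: "herm a a = of_real ((norm a)\<^sup>2)"
proof -
  have "(norm a)\<^sup>2 = (\<Sum>i\<in>UNIV. (cmod (a $ i))\<^sup>2)"
    by (simp add: norm_vec_def L2_set_def sum_nonneg)
  show ?thesis unfolding herm_def \<open>(norm a)\<^sup>2 = _\<close> of_real_sum complex_norm_square ..
qed

lemma Re_herm: "Re (herm z a) = z \<bullet> a"
  by (simp add: herm_def inner_vec_def inner_complex_def)

definition fock_kernel :: "real \<Rightarrow> complex ^ 'n \<Rightarrow> complex ^ 'n \<Rightarrow> complex" where
  "fock_kernel \<alpha> a z = exp (herm z a / of_real \<alpha>)"

lemma entire_herm: "entire (\<lambda>z. herm z a * c)"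
proof (rule entire_linear)
  show lin: "herm (b *s v) a * c = b * (herm v a * c)" for b v
    by (simp add: herm_def sum_distrib_left sum_distrib_right mult_ac)
  show "bounded_linear (\<lambda>z. herm z a * c)"
    unfolding herm_def
    by (rule bounded_linear_compose[OF bounded_linear_mult_left], rule bounded_linear_sum,
        rule bounded_linear_compose[OF bounded_linear_mult_left bounded_linear_vec_nth])
qed

lemma entire_fock_kernel: "entire (fock_kernel \<alpha> a)"
  using entire_exp[OF entire_herm[of a "1 / of_real \<alpha>"]] by (simp add: fock_kernel_def[abs_def])

lemma cmod_fock_kernel: "(cmod (fock_kernel \<alpha> a z))\<^sup>2 = exp (2 * (z \<bullet> a) / \<alpha>)"
proof -
  have "Re (herm z a / of_real \<alpha>) = (z \<bullet> a) / \<alpha>" by (simp add: Re_herm Re_divide_of_real)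
  then show ?thesis by (simp add: fock_kernel_def flip: exp_double)
qed

text \<open>Translating by a cancels the exponential growth: the weighted squared modulus becomes
  the constant exp (|a|^2 / \<alpha>), integrable against a finite measure.\<close>

lemma fock_kernel_in_fock_space:
  assumes \<alpha>: "\<alpha> > 0"
  shows "fock_kernel \<alpha> a \<in> fock_space \<alpha>"
proof -
  interpret finite_measure "gauss_measure \<alpha> :: (complex ^ 'n) measure" by (rule finite_gauss_measure[OF \<alpha>])
  note ent = entire_fock_kernel[of \<alpha> a]
  have [measurable]: "fock_kernel \<alpha> a \<in> borel_measurable borel" by (rule entire_measurable[OF ent])
  have e: "exp (- (2 * (w \<bullet> a) + (norm a)\<^sup>2) / \<alpha>) *\<^sub>R (cmod (fock_kernel \<alpha> a (w + a)))\<^sup>2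
      = exp ((norm a)\<^sup>2 / \<alpha>)" for w
    unfolding cmod_fock_kernel
    by (simp add: inner_add_left power2_norm_eq_inner add_divide_distrib diff_divide_distrib
        flip: exp_add)
  have "integrable (gauss_measure \<alpha>) (\<lambda>w. exp (- (2 * (w \<bullet> a) + (norm a)\<^sup>2) / \<alpha>) *\<^sub>R
      (cmod (fock_kernel \<alpha> a (w + a)))\<^sup>2)"
    unfolding e by simp
  then have "integrable (gauss_measure \<alpha>) (\<lambda>z. (cmod (fock_kernel \<alpha> a z))\<^sup>2)"
    by (subst (asm) gauss_measure_translate(1)[OF \<alpha>]) measurable
  then show ?thesis using ent by (simp add: fock_space_def square_integrable_def)
qed

text \<open>After translation by a, the conjugated kernel times the density ratio is exp (- herm w a
  / \<alpha>), which is holomorphic in w and equals 1 at w = 0. So the integrand F is entire and its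
  mean is F 0 = f a.\<close>

lemma fock_kernel_reproducing:
  fixes f :: "complex ^ 'n \<Rightarrow> complex"
  assumes \<alpha>: "\<alpha> > 0" and f: "f \<in> fock_space \<alpha>"
  shows "l2_inner (gauss_measure \<alpha>) f (fock_kernel \<alpha> a) = f a"
proof -
  have ent: "entire f" and sq: "square_integrable (gauss_measure \<alpha>) f"
    using f by (auto simp: fock_space_def)
  have sqK: "square_integrable (gauss_measure \<alpha>) (fock_kernel \<alpha> a)"
    using fock_kernel_in_fock_space[OF \<alpha>, of a] by (simp add: fock_space_def)
  have [measurable]: "f \<in> borel_measurable borel" "fock_kernel \<alpha> a \<in> borel_measurable borel"
    by (rule entire_measurable, rule ent entire_fock_kernel)+
  define g where "g = (\<lambda>z. f z * cnj (fock_kernel \<alpha> a z))"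
  define F where "F = (\<lambda>w. f (w + a) * exp (herm w a * (- 1 / of_real \<alpha>)))"
  have [measurable]: "g \<in> borel_measurable borel" unfolding g_def by measurable
  have F: "exp (- (2 * (w \<bullet> a) + (norm a)\<^sup>2) / \<alpha>) *\<^sub>R g (w + a) = F w" for w
  proof -
    have "complex_of_real (- (2 * (w \<bullet> a) + (norm a)\<^sup>2) / \<alpha>) + cnj (herm (w + a) a / of_real \<alpha>)
      = herm w a * (- 1 / of_real \<alpha>)"
      using \<alpha> by (simp add: herm_add herm_self complex_eq_iff Re_herm[symmetric] field_simps)
    then have "complex_of_real (exp (- (2 * (w \<bullet> a) + (norm a)\<^sup>2) / \<alpha>)) * cnj (fock_kernel \<alpha> a (w + a))
      = exp (herm w a * (- 1 / of_real \<alpha>))"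
      by (simp only: fock_kernel_def exp_cnj exp_of_real[symmetric] exp_add[symmetric])
    then show ?thesis by (simp add: F_def g_def scaleR_conv_of_real mult_ac)
  qed
  have "integrable (gauss_measure \<alpha>) g"
    unfolding g_def by (rule square_integrable_mult_cnj[OF sq sqK])
  then have "integrable (gauss_measure \<alpha>)
      (\<lambda>w. exp (- (2 * (w \<bullet> a) + (norm a)\<^sup>2) / \<alpha>) *\<^sub>R g (w + a))"
    by (subst gauss_measure_translate(1)[OF \<alpha>]) measurable
  then have int: "integrable (gauss_measure \<alpha>) F" unfolding F .
  have "l2_inner (gauss_measure \<alpha>) f (fock_kernel \<alpha> a) = (\<integral>z. g z \<partial>gauss_measure \<alpha>)"
    by (simp add: l2_inner_def g_def)
  also have "\<dots> = (\<integral>w. exp (- (2 * (w \<bullet> a) + (norm a)\<^sup>2) / \<alpha>) *\<^sub>R g (w + a) \<partial>gauss_measure \<alpha>)"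
    by (rule gauss_measure_translate(2)[OF \<alpha>, symmetric]) measurable
  also have "\<dots> = (\<integral>w. F w \<partial>gauss_measure \<alpha>)" unfolding F ..
  also have "\<dots> = F 0"
  proof -
    have "entire F"
      unfolding F_def by (rule entire_mult[OF entire_translate[OF ent] entire_exp[OF entire_herm]])
    from circular_mean_value[OF this circular_gauss_measure[OF \<alpha>] int]
    show ?thesis using measure_gauss_measure[OF \<alpha>, where 'n = 'n] by simp
  qed
  also have "\<dots> = f a" by (simp add: F_def herm_def)
  finally show ?thesis .
qed

lemma fock_kernel_diag: "fock_kernel \<alpha> a a = of_real (exp ((norm a)\<^sup>2 / \<alpha>))"
  by (simp add: fock_kernel_def herm_self exp_of_real[symmetric])

text \<open>Fatou's lemma, for passing norm bounds to a limit function and for exhausting space by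
  balls.\<close>

lemma nn_integral_limit_le:
  fixes u :: "nat \<Rightarrow> 'a \<Rightarrow> ennreal"
  assumes "\<And>n. u n \<in> borel_measurable M" "\<And>x. (\<lambda>n. u n x) \<longlonglongrightarrow> v x"
    and "\<forall>\<^sub>F n in sequentially. (\<integral>\<^sup>+x. u n x \<partial>M) \<le> C"
  shows "(\<integral>\<^sup>+x. v x \<partial>M) \<le> C"
proof -
  have "(\<integral>\<^sup>+x. v x \<partial>M) = (\<integral>\<^sup>+x. liminf (\<lambda>n. u n x) \<partial>M)"
    by (intro nn_integral_cong lim_imp_Liminf[symmetric] assms(2)) simp
  also have "\<dots> \<le> liminf (\<lambda>n. \<integral>\<^sup>+x. u n x \<partial>M)" by (rule nn_integral_liminf[OF assms(1)])
  also have "\<dots> \<le> limsup (\<lambda>n. \<integral>\<^sup>+x. u n x \<partial>M)" by (rule Liminf_le_Limsup) simp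
  also have "\<dots> \<le> C" by (rule Limsup_bounded[OF assms(3)])
  finally show ?thesis .
qed

lemma square_integrable_nn_integral:
  assumes [measurable]: "f \<in> borel_measurable M" and "(\<integral>\<^sup>+z. ennreal ((cmod (f z))\<^sup>2) \<partial>M) \<le> ennreal C" "0 \<le> C"
  shows "square_integrable M f" "(\<integral>z. (cmod (f z))\<^sup>2 \<partial>M) \<le> C"
proof -
  have "integrable M (\<lambda>z. (cmod (f z))\<^sup>2)"
    by (rule integrableI_nonneg) (use assms in \<open>auto intro: le_less_trans\<close>)
  then show "square_integrable M f" by (simp add: square_integrable_def)
  show "(\<integral>z. (cmod (f z))\<^sup>2 \<partial>M) \<le> C"
    using assms(2,3) by (intro integral_real_bounded) auto
qed

text \<open>The kernel bounds point evaluations, locally uniformly in the point. A norm-Cauchy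
  sequence therefore converges locally uniformly, its limit is entire, and Fatou's lemma upgrades
  this to norm convergence.\<close>

lemma hilbert_form_fock_space:
  assumes \<alpha>: "\<alpha> > 0"
  shows "hilbert_form fun_scale (fock_space \<alpha>) (l2_inner (gauss_measure \<alpha> :: (complex ^ 'n) measure))"
proof -
  define \<gamma> where "\<gamma> = (gauss_measure \<alpha> :: (complex ^ 'n) measure)"
  interpret psd_form fun_scale "fock_space \<alpha>" "l2_inner \<gamma>"
    unfolding \<gamma>_def by (rule psd_form_l2[OF subspace_fock_space[OF \<alpha>]]) (simp add: fock_space_def)
  have nq: "nq f = (\<integral>z. (cmod (f z))\<^sup>2 \<partial>\<gamma>)" for f
    unfolding l2_inner_def complex_norm_square[symmetric] integral_complex_of_real by simp
  have point: "(cmod (f a))\<^sup>2 \<le> nq f * exp ((norm a)\<^sup>2 / \<alpha>)" if f: "f \<in> fock_space \<alpha>" for f a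
  proof -
    have "nq (fock_kernel \<alpha> a) = exp ((norm a)\<^sup>2 / \<alpha>)"
      using fock_kernel_reproducing[OF \<alpha> fock_kernel_in_fock_space[OF \<alpha>], of a a]
      by (simp add: \<gamma>_def fock_kernel_diag)
    then show ?thesis
      using cauchy_schwarz[OF f fock_kernel_in_fock_space[OF \<alpha>], of a] fock_kernel_reproducing[OF \<alpha> f]
      by (simp add: \<gamma>_def)
  qed
  show ?thesis
    unfolding \<gamma>_def[symmetric]
  proof
    fix f assume f: "f \<in> fock_space \<alpha>" "nq f = 0"
    show "f = 0" using point[OF f(1)] f(2) by (auto simp: fun_eq_iff)
  next
    fix F :: "nat \<Rightarrow> complex ^ 'n \<Rightarrow> complex"
    assume F: "\<And>k. F k \<in> fock_space \<alpha>"
      and cau: "\<And>e. e > 0 \<Longrightarrow> \<exists>N. \<forall>m\<ge>N. \<forall>n\<ge>N. nq (F m - F n) < e"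
    have ent: "entire (F n)" and sqF: "square_integrable \<gamma> (F n)" for n
      using F by (auto simp: fock_space_def \<gamma>_def)
    define f where "f = (\<lambda>z. lim (\<lambda>n. F n z))"
    have unif: "uniform_limit (cball 0 R) F f sequentially" for R
    proof -
      have "uniformly_Cauchy_on (cball 0 R) F"
        unfolding uniformly_Cauchy_on_def
      proof (intro allI impI)
        fix e :: real assume e: "0 < e"
        \<comment> \<open>Chosen so that the evaluation bound on the ball of radius R becomes the
          square of e.\<close>
        define d where "d = e\<^sup>2 / exp (R\<^sup>2 / \<alpha>)"
        have "0 < d" using e by (simp add: d_def)
        then obtain N where N: "\<And>m n. \<lbrakk>m \<ge> N; n \<ge> N\<rbrakk> \<Longrightarrow> nq (F m - F n) < d" using cau by blast
        have "dist (F m z) (F n z) < e" if "m \<ge> N" "n \<ge> N" "z \<in> cball 0 R" for m n z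
        proof -
          have "(cmod ((F m - F n) z))\<^sup>2 \<le> nq (F m - F n) * exp ((norm z)\<^sup>2 / \<alpha>)"
            using F by (intro point diff_V)
          also have "\<dots> \<le> nq (F m - F n) * exp (R\<^sup>2 / \<alpha>)"
            using that(3) \<alpha> F by (intro mult_left_mono nonneg diff_V) (auto intro!: divide_right_mono power_mono)
          also have "\<dots> < d * exp (R\<^sup>2 / \<alpha>)"
            using N[OF that(1,2)] by (intro mult_strict_right_mono) auto
          also have "\<dots> = e\<^sup>2" by (simp add: d_def)
          finally show ?thesis using e by (simp add: dist_norm power2_less_imp_less)
        qed
        then show "\<exists>M. \<forall>x\<in>cball 0 R. \<forall>m\<ge>M. \<forall>n\<ge>M. dist (F m x) (F n x) < e" by blast
      qed
      then show ?thesis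
        unfolding f_def
        by (simp add: Cauchy_uniformly_convergent flip: uniformly_convergent_uniform_limit_iff)
    qed
    have entf: "entire f" by (rule entire_uniform_limit[OF ent unif])
    have lim: "(\<lambda>n. F n z) \<longlonglongrightarrow> f z" for z
      by (rule tendsto_uniform_limitI[OF unif[of "norm z"]]) simp
    have [measurable]: "F n \<in> borel_measurable borel" "f \<in> borel_measurable borel" for n
      by (rule entire_measurable, rule ent entf)+
    have [simp, measurable_cong]: "sets \<gamma> = sets borel" by (simp add: \<gamma>_def)
    have main: "\<exists>N. \<forall>k\<ge>N. square_integrable \<gamma> (\<lambda>z. F k z - f z) \<and>
        (\<integral>z. (cmod (F k z - f z))\<^sup>2 \<partial>\<gamma>) \<le> e" if e: "0 < e" for e
    proof -
      obtain N where N: "\<And>m n. \<lbrakk>m \<ge> N; n \<ge> N\<rbrakk> \<Longrightarrow> nq (F m - F n) < e" using cau[OF e] by blast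
      have "(\<integral>\<^sup>+z. ennreal ((cmod (F k z - f z))\<^sup>2) \<partial>\<gamma>) \<le> ennreal e" if k: "k \<ge> N" for k
      proof (rule nn_integral_limit_le)
        show "(\<lambda>z. ennreal ((cmod (F k z - F n z))\<^sup>2)) \<in> borel_measurable \<gamma>" for n by measurable
        show "(\<lambda>n. ennreal ((cmod (F k z - F n z))\<^sup>2)) \<longlonglongrightarrow> ennreal ((cmod (F k z - f z))\<^sup>2)" for z
          by (intro tendsto_intros lim)
        have "(\<integral>\<^sup>+z. ennreal ((cmod (F k z - F n z))\<^sup>2) \<partial>\<gamma>) \<le> ennreal e" if n: "n \<ge> N" for n
        proof -
          have "integrable \<gamma> (\<lambda>z. (cmod (F k z - F n z))\<^sup>2)"
            using square_integrable_diff[OF sqF sqF] by (simp add: square_integrable_def)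
          then have "(\<integral>\<^sup>+z. ennreal ((cmod (F k z - F n z))\<^sup>2) \<partial>\<gamma>) = ennreal (nq (F k - F n))"
            unfolding nq by (subst nn_integral_eq_integral) auto
          then show ?thesis using N[OF k n] by (simp add: ennreal_leI)
        qed
        then show "\<forall>\<^sub>F n in sequentially. (\<integral>\<^sup>+z. ennreal ((cmod (F k z - F n z))\<^sup>2) \<partial>\<gamma>) \<le> ennreal e"
          unfolding eventually_sequentially by blast
      qed
      then show ?thesis
        using square_integrable_nn_integral[of "\<lambda>z. F _ z - f z" \<gamma> e] e by (intro exI[of _ N]) auto
    qed
    obtain k where "square_integrable \<gamma> (\<lambda>z. F k z - f z)" using main[of 1] by auto
    from square_integrable_diff[OF sqF[of k] this] have "square_integrable \<gamma> f" by simp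
    then have fF: "f \<in> fock_space \<alpha>" using entf by (simp add: fock_space_def \<gamma>_def)
    have "(\<lambda>k. nq (F k - f)) \<longlonglongrightarrow> 0"
    proof (rule LIMSEQ_I)
      fix e :: real assume e: "0 < e"
      obtain N where N: "\<And>k. k \<ge> N \<Longrightarrow> (\<integral>z. (cmod (F k z - f z))\<^sup>2 \<partial>\<gamma>) \<le> e / 2"
        using main[of "e / 2"] e by auto
      have "norm (nq (F k - f) - 0) < e" if "k \<ge> N" for k
        using N[OF that] e unfolding nq by simp
      then show "\<exists>N. \<forall>k\<ge>N. norm (nq (F k - f) - 0) < e" by blast
    qed
    then show "\<exists>g\<in>fock_space \<alpha>. (\<lambda>k. nq (F k - g)) \<longlonglongrightarrow> 0" using fF by blast
  qed
qed

text \<open>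
  On a ball \<open>g\<close> and \<open>cnj h\<close> are orthogonal by the mean value property, so
  \<open>\<parallel>g\<parallel>\<^sup>2 + \<parallel>h\<parallel>\<^sup>2\<close> is bounded by \<open>\<parallel>f\<parallel>\<^sup>2\<close> uniformly in the radius.
\<close>

lemma square_integrable_split:
  fixes g h :: "complex ^ 'n \<Rightarrow> complex"
  assumes \<alpha>: "\<alpha> > 0" and g: "entire g" and h: "entire h" "h 0 = 0"
    and f: "square_integrable (gauss_measure \<alpha>) (\<lambda>z. g z + cnj (h z))"
  shows "square_integrable (gauss_measure \<alpha>) g \<and> square_integrable (gauss_measure \<alpha>) h"
proof -
  define C where "C = (\<integral>z. (cmod (g z + cnj (h z)))\<^sup>2 \<partial>gauss_measure \<alpha>)"
  have C: "0 \<le> C" by (simp add: C_def)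
  define \<rho> :: "nat \<Rightarrow> real \<Rightarrow> real" where
    "\<rho> = (\<lambda>n r. exp (- r\<^sup>2 / \<alpha>) / (pi * \<alpha>) ^ CARD('n) * indicator {..real n} r)"
  define M where "M = (\<lambda>n. density lborel (\<lambda>z :: complex ^ 'n. ennreal (\<rho> n (norm z))))"
  have [measurable]: "g \<in> borel_measurable borel" "h \<in> borel_measurable borel"
    by (rule entire_measurable, rule g h)+
  have [measurable]: "(\<lambda>z. cnj (h z)) \<in> borel_measurable borel"
    by (intro borel_measurable_continuous_onI continuous_on_cnj entire_continuous h)
  have [measurable]: "\<rho> n \<in> borel_measurable borel" for n unfolding \<rho>_def by measurable
  have \<rho>w: "\<rho> n (norm z) = gauss_weight \<alpha> z * indicator {..real n} (norm z)" for n and z :: "complex ^ 'n"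
    by (simp add: \<rho>_def gauss_weight_def)
  have \<rho>0: "0 \<le> \<rho> n r" for n r using \<alpha> by (simp add: \<rho>_def)
  have circ: "circular (M n)" for n
    unfolding M_def
  proof (rule circular_density[where \<rho> = "\<lambda>r. ennreal (\<rho> n r)"])
    have "(\<integral>\<^sup>+z. ennreal (\<rho> n (norm (z :: complex ^ 'n))) \<partial>lborel)
        \<le> (\<integral>\<^sup>+z. ennreal (gauss_weight \<alpha> (z :: complex ^ 'n)) \<partial>lborel)"
      unfolding \<rho>w using gauss_weight_nonneg[OF \<alpha>]
      by (intro nn_integral_mono ennreal_leI) (auto simp: indicator_def)
    then show "(\<integral>\<^sup>+z. ennreal (\<rho> n (norm (z :: complex ^ 'n))) \<partial>lborel) < \<infinity>"
      unfolding nn_integral_gauss_weight[OF \<alpha>] by (rule le_less_trans) simp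
  qed measurable
  have [simp, measurable_cong]: "sets (M n) = sets borel" for n by (simp add: M_def)
  have int: "integrable (M n) \<phi>" if \<phi>: "continuous_on UNIV \<phi>"
    for n and \<phi> :: "complex ^ 'n \<Rightarrow> 'b::{banach, second_countable_topology}"
  proof -
    interpret finite_measure "M n" using circ by (simp add: circular_def)
    have [measurable]: "\<phi> \<in> borel_measurable borel" by (rule borel_measurable_continuous_onI[OF \<phi>])
    have "bounded (\<phi> ` cball 0 (real n))"
      by (intro compact_imp_bounded compact_continuous_image continuous_on_subset[OF \<phi>]) auto
    then obtain B where "\<And>z. z \<in> cball 0 (real n) \<Longrightarrow> norm (\<phi> z) \<le> B"
      unfolding bounded_iff by blast
    then have "AE z in M n. norm (\<phi> z) \<le> B"
      unfolding M_def by (subst AE_density) (auto simp: \<rho>w indicator_def)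
    then show ?thesis
      by (rule integrable_const_bound) measurable
  qed
  note cont = entire_continuous[OF g] entire_continuous[OF h(1)]
  have intg: "integrable (M n) (\<lambda>z. (cmod (g z))\<^sup>2)" and inth: "integrable (M n) (\<lambda>z. (cmod (h z))\<^sup>2)"
    and intgh: "integrable (M n) (\<lambda>z. g z * h z)"
    and intf: "integrable (M n) (\<lambda>z. (cmod (g z + cnj (h z)))\<^sup>2)" for n
    by (intro int continuous_intros cont)+
  have split: "(\<integral>z. (cmod (g z))\<^sup>2 \<partial>M n) + (\<integral>z. (cmod (h z))\<^sup>2 \<partial>M n) \<le> C" for n
  proof -
    define r where "r = (\<lambda>z. Re (g z * h z))"
    have intr: "integrable (M n) r" unfolding r_def by (rule integrable_Re[OF intgh])
    have "(cmod (g z + cnj (h z)))\<^sup>2 = (cmod (g z))\<^sup>2 + (cmod (h z))\<^sup>2 + 2 * r z" for z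
      unfolding r_def cmod_power2 by (simp add: power2_eq_square algebra_simps)
    then have "(\<integral>z. (cmod (g z + cnj (h z)))\<^sup>2 \<partial>M n)
        = (\<integral>z. (cmod (g z))\<^sup>2 \<partial>M n) + (\<integral>z. (cmod (h z))\<^sup>2 \<partial>M n) + 2 * (\<integral>z. r z \<partial>M n)"
      using intg inth intr by simp
    also have "(\<integral>z. r z \<partial>M n) = Re (\<integral>z. g z * h z \<partial>M n)"
      unfolding r_def by (rule integral_Re[OF intgh])
    \<comment> \<open>The cross term of the squared modulus is twice the real part of g h, an entire
      function vanishing at 0; restricting to balls ensures that it is integrable before g and h are
      known to be square integrable.\<close>
    also have "(\<integral>z. g z * h z \<partial>M n) = 0"
      using circular_mean_value[OF entire_mult[OF g h(1)] circ intgh] h(2) by simp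
    finally have "(\<integral>z. (cmod (g z))\<^sup>2 \<partial>M n) + (\<integral>z. (cmod (h z))\<^sup>2 \<partial>M n)
        = (\<integral>z. (cmod (g z + cnj (h z)))\<^sup>2 \<partial>M n)" by simp
    also have "\<dots> \<le> C"
    proof -
      have "ennreal (\<integral>z. (cmod (g z + cnj (h z)))\<^sup>2 \<partial>M n) = (\<integral>\<^sup>+z. ennreal ((cmod (g z + cnj (h z)))\<^sup>2) \<partial>M n)"
        using intf by (intro nn_integral_eq_integral[symmetric]) auto
      also have "\<dots> = (\<integral>\<^sup>+z. ennreal (\<rho> n (norm z)) * ennreal ((cmod (g z + cnj (h z)))\<^sup>2) \<partial>lborel)"
        unfolding M_def by (rule nn_integral_density) measurable
      also have "\<dots> \<le> (\<integral>\<^sup>+z. ennreal (gauss_weight \<alpha> z) * ennreal ((cmod (g z + cnj (h z)))\<^sup>2) \<partial>lborel)"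
        unfolding \<rho>w using gauss_weight_nonneg[OF \<alpha>]
        by (intro nn_integral_mono mult_right_mono ennreal_leI) (auto simp: indicator_def)
      also have "\<dots> = (\<integral>\<^sup>+z. ennreal ((cmod (g z + cnj (h z)))\<^sup>2) \<partial>gauss_measure \<alpha>)"
        unfolding gauss_measure_eq by (rule nn_integral_density[symmetric]) measurable
      also have "\<dots> = ennreal C"
        unfolding C_def using f by (intro nn_integral_eq_integral) (auto simp: square_integrable_def)
      finally show ?thesis using C by simp
    qed
    finally show ?thesis .
  qed
  have "square_integrable (gauss_measure \<alpha>) u"
    if [measurable]: "u \<in> borel_measurable borel"
      and intu: "\<And>n. integrable (M n) (\<lambda>z. (cmod (u z))\<^sup>2)"
      and le: "\<And>n. (\<integral>z. (cmod (u z))\<^sup>2 \<partial>M n) \<le> C" for u :: "complex ^ 'n \<Rightarrow> complex"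
  proof (rule square_integrable_nn_integral(1)[OF _ _ C])
    have "(\<integral>\<^sup>+z. ennreal ((cmod (u z))\<^sup>2) \<partial>gauss_measure \<alpha>)
        = (\<integral>\<^sup>+z. ennreal (gauss_weight \<alpha> z) * ennreal ((cmod (u z))\<^sup>2) \<partial>lborel)"
      unfolding gauss_measure_eq by (rule nn_integral_density) measurable
    also have "\<dots> \<le> ennreal C"
    proof (rule nn_integral_limit_le)
      show "(\<lambda>z :: complex ^ 'n. ennreal (\<rho> n (norm z)) * ennreal ((cmod (u z))\<^sup>2)) \<in> borel_measurable lborel" for n
        by measurable
      show "(\<lambda>n. ennreal (\<rho> n (norm z)) * ennreal ((cmod (u z))\<^sup>2))
          \<longlonglongrightarrow> ennreal (gauss_weight \<alpha> z) * ennreal ((cmod (u z))\<^sup>2)" for z :: "complex ^ 'n"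
      proof (rule tendsto_eventually)
        obtain N :: nat where "norm z \<le> real N" using real_arch_simple by blast
        then show "\<forall>\<^sub>F n in sequentially. ennreal (\<rho> n (norm z)) * ennreal ((cmod (u z))\<^sup>2)
            = ennreal (gauss_weight \<alpha> z) * ennreal ((cmod (u z))\<^sup>2)"
          unfolding eventually_sequentially \<rho>w by (intro exI[of _ N]) (auto simp: indicator_def)
      qed
      show "\<forall>\<^sub>F n in sequentially. (\<integral>\<^sup>+z. ennreal (\<rho> n (norm (z :: complex ^ 'n))) * ennreal ((cmod (u z))\<^sup>2) \<partial>lborel)
          \<le> ennreal C"
      proof (intro always_eventually allI)
        fix n
        have "(\<integral>\<^sup>+z. ennreal (\<rho> n (norm (z :: complex ^ 'n))) * ennreal ((cmod (u z))\<^sup>2) \<partial>lborel)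
            = (\<integral>\<^sup>+z. ennreal ((cmod (u z))\<^sup>2) \<partial>M n)"
          unfolding M_def by (rule nn_integral_density[symmetric]) measurable
        also have "\<dots> = ennreal (\<integral>z. (cmod (u z))\<^sup>2 \<partial>M n)"
          using intu by (intro nn_integral_eq_integral) auto
        also have "\<dots> \<le> ennreal C" using le by (rule ennreal_leI)
        finally show "(\<integral>\<^sup>+z. ennreal (\<rho> n (norm (z :: complex ^ 'n))) * ennreal ((cmod (u z))\<^sup>2) \<partial>lborel)
            \<le> ennreal C" .
      qed
    qed
    finally show "(\<integral>\<^sup>+z. ennreal ((cmod (u z))\<^sup>2) \<partial>gauss_measure \<alpha>) \<le> ennreal C" .
  qed simp
  moreover have "(\<integral>z. (cmod (g z))\<^sup>2 \<partial>M n) \<le> C" "(\<integral>z. (cmod (h z))\<^sup>2 \<partial>M n) \<le> C" for n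
  proof -
    have "0 \<le> (\<integral>z. (cmod (g z))\<^sup>2 \<partial>M n)" "0 \<le> (\<integral>z. (cmod (h z))\<^sup>2 \<partial>M n)" by simp_all
    then show "(\<integral>z. (cmod (g z))\<^sup>2 \<partial>M n) \<le> C" "(\<integral>z. (cmod (h z))\<^sup>2 \<partial>M n) \<le> C"
      using split[of n] by linarith+
  qed
  ultimately show ?thesis using intg inth by simp
qed

section \<open>Pluriharmonic functions\<close>

lemma frechet_derivative_eq: "(f has_derivative D) (at z) \<Longrightarrow> frechet_derivative f (at z) = D"
  by (metis frechet_derivative_at)

lemma C1_has_derivative: "C1 f \<Longrightarrow> (f has_derivative frechet_derivative f (at z)) (at z)"
  by (simp add: C1_def frechet_derivative_works)

lemma frechet_derivative_add:
  "\<lbrakk>C1 f; C1 g\<rbrakk> \<Longrightarrow> frechet_derivative (\<lambda>z. f z + g z) (at z) v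
    = frechet_derivative f (at z) v + frechet_derivative g (at z) v"
  by (subst frechet_derivative_eq[OF has_derivative_add[OF C1_has_derivative C1_has_derivative]]) auto

lemma frechet_derivative_cmult:
  "C1 f \<Longrightarrow> frechet_derivative (\<lambda>z. c * f z) (at z) v = c * frechet_derivative f (at z) v"
  by (subst frechet_derivative_eq[OF has_derivative_mult_right[OF C1_has_derivative]]) auto

lemma has_derivative_cnj':
  "(f has_derivative D) (at z) \<Longrightarrow> ((\<lambda>z. cnj (f z)) has_derivative (\<lambda>v. cnj (D v))) (at z)"
  by (rule bounded_linear.has_derivative[OF bounded_linear_cnj])

lemma frechet_derivative_cnj:
  "C1 f \<Longrightarrow> frechet_derivative (\<lambda>z. cnj (f z)) (at z) v = cnj (frechet_derivative f (at z) v)"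
  by (subst frechet_derivative_eq[OF has_derivative_cnj'[OF C1_has_derivative]]) auto

lemma C1_add: "\<lbrakk>C1 f; C1 g\<rbrakk> \<Longrightarrow> C1 (\<lambda>z. f z + g z)"
  unfolding C1_def[of "\<lambda>z. f z + g z"]
  by (auto simp: frechet_derivative_add) (auto simp: C1_def intro!: continuous_intros)

lemma C1_cmult: "C1 f \<Longrightarrow> C1 (\<lambda>z. c * f z)"
  unfolding C1_def[of "\<lambda>z. c * f z"]
  by (auto simp: frechet_derivative_cmult)
    (auto simp: C1_def intro!: continuous_intros differentiable_mult)

lemma C1_cnj: "C1 f \<Longrightarrow> C1 (\<lambda>z. cnj (f z))"
proof -
  assume f: "C1 f"
  have "(\<lambda>z. cnj (f z)) differentiable (at z)" for z
    using has_derivative_cnj'[OF C1_has_derivative[OF f]] by (auto simp: differentiable_def)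
  then show ?thesis
    unfolding C1_def[of "\<lambda>z. cnj (f z)"] using f
    by (auto simp: frechet_derivative_cnj C1_def intro!: continuous_intros)
qed

lemma C2_add: "\<lbrakk>C2 f; C2 g\<rbrakk> \<Longrightarrow> C2 (\<lambda>z. f z + g z)"
  by (simp add: C2_def frechet_derivative_add C1_add)

lemma C2_cnj: "C2 f \<Longrightarrow> C2 (\<lambda>z. cnj (f z))"
  by (simp add: C2_def frechet_derivative_cnj C1_cnj)

lemma entire_C1: "entire f \<Longrightarrow> C1 f"
  unfolding C1_def by (auto intro: entire_continuous entire_derivative simp: differentiable_def entireD(1))
    (meson entireD(1))

lemma entire_C2: "entire f \<Longrightarrow> C2 f"
  by (simp add: C2_def entire_C1 entire_derivative)

lemma axis_imaginary: "axis j \<i> = \<i> *s (axis j 1 :: complex ^ 'n)"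
  by (simp add: vec_eq_iff axis_def)

lemma d_zbar_entire: "entire f \<Longrightarrow> d_zbar j f z = 0"
  by (simp add: d_zbar_def axis_imaginary entireD(2))

lemma d_z_entire: "entire f \<Longrightarrow> d_z j f z = frechet_derivative f (at z) (axis j 1)"
  by (simp add: d_z_def axis_imaginary entireD(2))

lemma d_zbar_add: "\<lbrakk>C1 f; C1 g\<rbrakk> \<Longrightarrow> d_zbar j (\<lambda>z. f z + g z) z = d_zbar j f z + d_zbar j g z"
  by (simp add: d_zbar_def frechet_derivative_add field_simps)

lemma d_zbar_cmult: "C1 f \<Longrightarrow> d_zbar j (\<lambda>z. c * f z) z = c * d_zbar j f z"
  by (simp add: d_zbar_def frechet_derivative_cmult field_simps)

lemma d_zbar_cnj: "C1 f \<Longrightarrow> d_zbar j (\<lambda>z. cnj (f z)) z = cnj (d_z j f z)"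
  by (simp add: d_zbar_def d_z_def frechet_derivative_cnj)

lemma d_z_cnj: "C1 f \<Longrightarrow> d_z j (\<lambda>z. cnj (f z)) z = cnj (d_zbar j f z)"
  by (simp add: d_zbar_def d_z_def frechet_derivative_cnj)

lemma vec_axis_expansion:
  "(v :: complex ^ 'n) = (\<Sum>j\<in>UNIV. Re (v $ j) *\<^sub>R axis j 1 + Im (v $ j) *\<^sub>R axis j \<i>)"
  by (simp add: vec_eq_iff axis_def if_distrib complex_eq_iff cong: if_cong)

text \<open>The Cauchy-Riemann equations say that the real derivative commutes with multiplication
  by i on each coordinate axis; expanding vectors along the axes makes it complex linear.\<close>

lemma entire_if_d_zbar_zero:
  fixes f :: "complex ^ 'n \<Rightarrow> complex"
  assumes f: "C1 f" and zero: "\<And>j z. d_zbar j f z = 0"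
  shows "entire f"
proof (rule entireI[OF C1_has_derivative[OF f]])
  fix z c and v :: "complex ^ 'n"
  define D where "D = frechet_derivative f (at z)"
  interpret D: bounded_linear D
    unfolding D_def by (rule has_derivative_bounded_linear[OF C1_has_derivative[OF f]])
  have im: "D (axis j \<i>) = \<i> * D (axis j 1)" for j
  proof -
    have "D (axis j 1) + \<i> * D (axis j \<i>) = 0" using zero[of j z] by (simp add: d_zbar_def D_def)
    then have "\<i> * (D (axis j 1) + \<i> * D (axis j \<i>)) = 0" by simp
    then show ?thesis by (simp add: distrib_left)
  qed
  have exp: "D w = (\<Sum>j\<in>UNIV. w $ j * D (axis j 1))" for w
  proof -
    have "D w = (\<Sum>j\<in>UNIV. Re (w $ j) *\<^sub>R D (axis j 1) + Im (w $ j) *\<^sub>R D (axis j \<i>))"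
      by (subst vec_axis_expansion[of w]) (simp add: D.sum D.add D.scaleR)
    also have "\<dots> = (\<Sum>j\<in>UNIV. w $ j * D (axis j 1))"
    proof (intro sum.cong refl)
      fix j
      have "Re a *\<^sub>R x + Im a *\<^sub>R (\<i> * x) = a * x" for a x by (simp add: complex_eq_iff)
      then show "Re (w $ j) *\<^sub>R D (axis j 1) + Im (w $ j) *\<^sub>R D (axis j \<i>) = w $ j * D (axis j 1)"
        unfolding im .
    qed
    finally show ?thesis .
  qed
  show "frechet_derivative f (at z) (c *s v) = c * frechet_derivative f (at z) v"
    unfolding D_def[symmetric] exp[of "c *s v"] exp[of v] by (simp add: sum_distrib_left mult.assoc)
qed

lemma entire_derivative_expansion:
  fixes f :: "complex ^ 'n \<Rightarrow> complex"
  assumes f: "entire f"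
  shows "frechet_derivative f (at z) v = (\<Sum>j\<in>UNIV. v $ j * frechet_derivative f (at z) (axis j 1))"
proof -
  interpret D: bounded_linear "frechet_derivative f (at z)"
    by (rule has_derivative_bounded_linear[OF entireD(1)[OF f]])
  have "v = (\<Sum>j\<in>UNIV. (v $ j) *s axis j 1)"
    by (simp add: vec_eq_iff axis_def if_distrib cong: if_cong)
  then have "frechet_derivative f (at z) v = frechet_derivative f (at z) (\<Sum>j\<in>UNIV. (v $ j) *s axis j 1)"
    by simp
  also have "\<dots> = (\<Sum>j\<in>UNIV. v $ j * frechet_derivative f (at z) (axis j 1))"
    by (simp add: D.sum entireD(2)[OF f])
  finally show ?thesis .
qed

lemma pluriharmonic_entire_add_cnj:
  assumes g: "entire g" and h: "entire h"
  shows "pluriharmonic (\<lambda>z. g z + cnj (h z))"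
proof -
  have "d_zbar k (\<lambda>z. g z + cnj (h z)) = (\<lambda>z. cnj (frechet_derivative h (at z) (axis k 1)))" for k
    using g h by (auto simp: d_zbar_add d_zbar_cnj C1_cnj entire_C1 d_zbar_entire d_z_entire)
  then show ?thesis
    using g h
    by (simp add: pluriharmonic_def C2_add C2_cnj entire_C2 d_z_cnj entire_C1 entire_derivative
        d_zbar_entire)
qed

section \<open>Second derivatives, primitives and the splitting of pluriharmonic functions\<close>

lemma has_vector_derivative_line:
  fixes f :: "'a::real_normed_vector \<Rightarrow> 'b::real_normed_vector"
  assumes "(f has_derivative D) (at (a + s *\<^sub>R u))"
  shows "((\<lambda>s. f (a + s *\<^sub>R u)) has_vector_derivative D u) (at s within S)"
proof -
  have "((\<lambda>s. a + s *\<^sub>R u) has_derivative (\<lambda>s. s *\<^sub>R u)) (at s)"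
    by (auto intro!: derivative_eq_intros)
  from has_derivative_compose[OF this assms]
  have "((\<lambda>s. f (a + s *\<^sub>R u)) has_derivative (\<lambda>t. D (t *\<^sub>R u))) (at s)" .
  moreover have "D (t *\<^sub>R u) = t *\<^sub>R D u" for t
    using has_derivative_bounded_linear[OF assms] by (rule linear_cmul[OF bounded_linear.linear])
  ultimately show ?thesis
    by (auto simp: has_vector_derivative_def intro: has_derivative_at_withinI)
qed

text \<open>
  Differentiate \<open>f (z + s u + t v) - f (z + s u) = \<integral> \<partial>\<^bsub>v\<^esub> f (z + s u + r v) dr\<close> (over \<open>0 \<le> r \<le> t\<close>) first
  with respect to \<open>s\<close> and then with respect to \<open>t\<close>.
\<close>

lemma C2_second_derivative_symmetric:
  fixes f :: "complex ^ 'n \<Rightarrow> complex"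
  assumes f: "C2 f"
  shows "frechet_derivative (\<lambda>z. frechet_derivative f (at z) u) (at z) v
    = frechet_derivative (\<lambda>z. frechet_derivative f (at z) v) (at z) u"
proof -
  define Df where "Df = (\<lambda>w z. frechet_derivative f (at z) w)"
  define S where "S = (\<lambda>w w' z. frechet_derivative (Df w) (at z) w')"
  have C1f: "C1 f" and C1D: "C1 (Df w)" for w using f by (auto simp: C2_def Df_def)
  have contD: "continuous_on UNIV (Df w)" and contS: "continuous_on UNIV (S w w')" for w w'
  proof -
    show "continuous_on UNIV (Df w)" using C1f by (simp add: C1_def Df_def)
    show "continuous_on UNIV (S w w')" using C1D[of w] by (simp add: C1_def S_def)
  qed
  note contD' = continuous_on_compose2[OF contD] and contS' = continuous_on_compose2[OF contS]
  have df: "((\<lambda>s. f (a + s *\<^sub>R w)) has_vector_derivative Df w (a + s *\<^sub>R w)) (at s within X)" for a w s X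
    unfolding Df_def by (rule has_vector_derivative_line[OF C1_has_derivative[OF C1f]])
  have dD: "((\<lambda>s. Df w' (a + s *\<^sub>R w)) has_vector_derivative S w' w (a + s *\<^sub>R w)) (at s within X)" for a w w' s X
    unfolding S_def by (rule has_vector_derivative_line[OF C1_has_derivative[OF C1D]])
  have step: "integral {0..\<tau>} (\<lambda>t. S v u (z + t *\<^sub>R v)) = Df u (z + \<tau> *\<^sub>R v) - Df u z"
    if \<tau>: "0 \<le> \<tau>" for \<tau>
  proof -
    have ftc: "integral {0..\<tau>} (\<lambda>t. Df v (z + s *\<^sub>R u + t *\<^sub>R v)) = f (z + s *\<^sub>R u + \<tau> *\<^sub>R v) - f (z + s *\<^sub>R u)" for s
      using fundamental_theorem_of_calculus[OF \<tau> df[of "z + s *\<^sub>R u" v]] by (simp add: integral_unique)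
    have "((\<lambda>s. integral (cbox 0 \<tau>) (\<lambda>t. Df v (z + s *\<^sub>R u + t *\<^sub>R v))) has_vector_derivative
        integral (cbox 0 \<tau>) (\<lambda>t. S v u (z + 0 *\<^sub>R u + t *\<^sub>R v))) (at 0 within UNIV)"
    proof (rule leibniz_rule_vector_derivative)
      show "((\<lambda>s. Df v (z + s *\<^sub>R u + t *\<^sub>R v)) has_vector_derivative S v u (z + s *\<^sub>R u + t *\<^sub>R v)) (at s within UNIV)" for s t
        using dD[of v "z + t *\<^sub>R v" u s UNIV] by (simp add: add_ac)
      show "(\<lambda>t. Df v (z + s *\<^sub>R u + t *\<^sub>R v)) integrable_on cbox 0 \<tau>" for s
        by (intro integrable_continuous contD' continuous_intros) auto
      show "continuous_on (UNIV \<times> cbox 0 \<tau>) (\<lambda>(s, t). S v u (z + s *\<^sub>R u + t *\<^sub>R v))"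
        unfolding case_prod_unfold by (intro contS' continuous_intros) auto
    qed auto
    then have "((\<lambda>s. f (z + s *\<^sub>R u + \<tau> *\<^sub>R v) - f (z + s *\<^sub>R u)) has_vector_derivative
        integral {0..\<tau>} (\<lambda>t. S v u (z + t *\<^sub>R v))) (at 0)"
      by (simp add: ftc)
    moreover have "((\<lambda>s. f (z + s *\<^sub>R u + \<tau> *\<^sub>R v) - f (z + s *\<^sub>R u)) has_vector_derivative
        Df u (z + \<tau> *\<^sub>R v) - Df u z) (at 0)"
      using has_vector_derivative_diff[OF df[of "z + \<tau> *\<^sub>R v" u 0 UNIV] df[of z u 0 UNIV]]
      by (simp add: add_ac)
    ultimately show ?thesis by (rule vector_derivative_unique_at)
  qed
  \<comment> \<open>The identity \<open>step\<close> is available for nonnegative \<tau> only, so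
    the derivative at 0 is taken one-sidedly on both sides.\<close>
  have "((\<lambda>\<tau>. integral {0..\<tau>} (\<lambda>t. S v u (z + t *\<^sub>R v))) has_vector_derivative S v u (z + 0 *\<^sub>R v)) (at 0 within {0..1})"
    by (rule integral_has_vector_derivative) (auto intro!: contS' continuous_intros)
  then have "((\<lambda>\<tau>. integral {0..\<tau>} (\<lambda>t. S v u (z + t *\<^sub>R v))) has_vector_derivative S v u z) (at 0 within {0..1})"
    by simp
  then have "((\<lambda>\<tau>. Df u (z + \<tau> *\<^sub>R v) - Df u z) has_vector_derivative S v u z) (at 0 within {0..1})"
    by (rule has_vector_derivative_transform[rotated 2]) (simp_all add: step)
  moreover have "((\<lambda>\<tau>. Df u (z + \<tau> *\<^sub>R v) - Df u z) has_vector_derivative S u v z) (at 0 within {0..1})"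
    using has_vector_derivative_diff[OF dD[of u z v 0 "{0..1}"] has_vector_derivative_const[of "Df u z" "at 0 within {0..1}"]]
    by simp
  ultimately have "S v u z = S u v z"
    by (rule vector_derivative_unique_within[rotated]) (simp add: trivial_limit_within islimpt_Icc)
  then show ?thesis by (simp add: S_def Df_def)
qed

text \<open>The Poincare lemma for the holomorphic 1-form \<open>\<Sum> b\<^sub>k dz\<^sub>k\<close>.\<close>

lemma holomorphic_primitive:
  fixes b :: "'n::finite \<Rightarrow> complex ^ 'n \<Rightarrow> complex"
  assumes b: "\<And>k. entire (b k)"
    and closed: "\<And>j k z. frechet_derivative (b k) (at z) (axis j 1) = frechet_derivative (b j) (at z) (axis k 1)"
  obtains H where "entire H" "H 0 = 0" "\<And>k z. frechet_derivative H (at z) (axis k 1) = b k z"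
proof -
  define c where "c = (\<lambda>j i z. frechet_derivative (b j) (at z) (axis i 1))"
  have c_sym: "c k j z = c j k z" for j k z using closed by (simp add: c_def)
  have contb: "continuous_on UNIV (b k)" for k by (rule entire_continuous[OF b])
  have contc: "continuous_on UNIV (c j i)" for j i
    unfolding c_def by (intro entire_continuous entire_derivative b)
  note cont' = continuous_on_compose2[OF contb] continuous_on_compose2[OF contc]
  have Db: "frechet_derivative (b k) (at z) v = (\<Sum>i\<in>UNIV. v $ i * c k i z)" for k z v
    unfolding c_def by (rule entire_derivative_expansion[OF b])
  define \<omega> where "\<omega> = (\<lambda>x (t::real). \<Sum>k\<in>UNIV. b k (t *\<^sub>R x) * x $ k)"
  \<comment> \<open>This is the derivative in t of t b_j (t x). Closedness identifies it with the
    j-th partial derivative in x of the integrand \<omega>, so integrating over [0, 1] leaves b_j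
    x.\<close>
  define e where "e = (\<lambda>j x (t::real). b j (t *\<^sub>R x) + of_real t * (\<Sum>i\<in>UNIV. x $ i * c j i (t *\<^sub>R x)))"
  \<comment> \<open>The Leibniz rule for integrals wants the derivative as a continuous family of
    bounded linear maps.\<close>
  define L where "L = (\<lambda>x t. Blinfun (\<lambda>v. \<Sum>j\<in>UNIV. v $ j * e j x t))"
  have bl: "bounded_linear (\<lambda>v :: complex ^ 'n. \<Sum>j\<in>UNIV. v $ j * a j)" for a
    by (rule bounded_linear_sum, rule bounded_linear_compose[OF bounded_linear_mult_left bounded_linear_vec_nth])
  have L: "blinfun_apply (L x t) v = (\<Sum>j\<in>UNIV. v $ j * e j x t)" for x t v
    unfolding L_def by (simp add: bounded_linear_Blinfun_apply[OF bl])
  have conte: "continuous_on (UNIV \<times> cbox 0 1) (\<lambda>p. e j (fst p) (snd p))" for j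
    unfolding e_def by (intro continuous_intros cont') auto
  define H where "H = (\<lambda>x. integral (cbox 0 1) (\<omega> x))"
  have der_\<omega>: "((\<lambda>x. \<omega> x t) has_derivative blinfun_apply (L x t)) (at x within UNIV)" for x t
  proof -
    have "((\<lambda>x. t *\<^sub>R x) has_derivative (\<lambda>v. t *\<^sub>R v)) (at x)"
      by (auto intro!: derivative_eq_intros)
    from has_derivative_compose[OF this entireD(1)[OF b]]
    have "((\<lambda>x. b k (t *\<^sub>R x)) has_derivative (\<lambda>v. frechet_derivative (b k) (at (t *\<^sub>R x)) (t *\<^sub>R v))) (at x)" for k .
    moreover have "((\<lambda>x. x $ k) has_derivative (\<lambda>v. v $ k)) (at x)" for k
      by (rule bounded_linear_imp_has_derivative[OF bounded_linear_vec_nth])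
    ultimately have "((\<lambda>x. \<omega> x t) has_derivative (\<lambda>v. \<Sum>k\<in>UNIV. b k (t *\<^sub>R x) * v $ k
        + frechet_derivative (b k) (at (t *\<^sub>R x)) (t *\<^sub>R v) * x $ k)) (at x)"
      unfolding \<omega>_def by (intro has_derivative_sum has_derivative_mult)
    moreover have "(\<Sum>k\<in>UNIV. b k (t *\<^sub>R x) * v $ k + frechet_derivative (b k) (at (t *\<^sub>R x)) (t *\<^sub>R v) * x $ k)
        = blinfun_apply (L x t) v" for v
    proof -
      have "(\<Sum>k\<in>UNIV. frechet_derivative (b k) (at (t *\<^sub>R x)) (t *\<^sub>R v) * x $ k)
          = (\<Sum>k\<in>UNIV. \<Sum>i\<in>UNIV. of_real t * v $ i * c k i (t *\<^sub>R x) * x $ k)"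
        by (simp add: Db scaleR_conv_of_real[where 'a = complex] sum_distrib_right)
      also have "\<dots> = (\<Sum>i\<in>UNIV. \<Sum>k\<in>UNIV. of_real t * v $ i * c k i (t *\<^sub>R x) * x $ k)"
        by (rule sum.swap)
      \<comment> \<open>Here closedness enters, exchanging the two indices of the partial
        derivatives.\<close>
      also have "\<dots> = (\<Sum>i\<in>UNIV. v $ i * (of_real t * (\<Sum>k\<in>UNIV. x $ k * c i k (t *\<^sub>R x))))"
        by (simp add: sum_distrib_left c_sym[of _ _] mult_ac)
      finally show ?thesis
        by (simp add: L e_def sum.distrib distrib_left mult.commute[of "b _ _"])
    qed
    ultimately show ?thesis by (simp add: fun_eq_iff has_derivative_eq_rhs)
  qed
  have contL: "continuous_on (UNIV \<times> cbox 0 1) (\<lambda>(x, t). L x t)"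
  proof (rule continuous_on_blinfun_componentwise)
    fix i :: "complex ^ 'n"
    show "continuous_on (UNIV \<times> cbox 0 1) (\<lambda>p. blinfun_apply (case p of (x, t) \<Rightarrow> L x t) i)"
      unfolding case_prod_unfold L by (intro continuous_intros conte)
  qed
  have "(H has_derivative blinfun_apply (integral (cbox 0 1) (L x))) (at x within UNIV)" for x
    unfolding H_def
  proof (rule leibniz_rule[OF der_\<omega> _ contL])
    show "\<omega> x integrable_on cbox 0 1" for x
      unfolding \<omega>_def by (intro integrable_continuous continuous_intros cont') auto
  qed auto
  moreover have "blinfun_apply (integral (cbox 0 1) (L x)) v = (\<Sum>j\<in>UNIV. v $ j * b j x)" for x v
  proof -
    have pair: "continuous_on {0..1} (\<lambda>t::real. (x, t))" "(\<lambda>t. (x, t)) ` {0..1} \<subseteq> UNIV \<times> cbox 0 (1::real)"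
      by (auto intro!: continuous_on_Pair continuous_on_const continuous_on_id)
    have ce: "continuous_on {0..1} (e j x)" for j
      using continuous_on_compose2[OF conte pair, of j] by simp
    have "integral {0..1} (e j x) = b j x" for j
    proof -
      have "((\<lambda>t. of_real t * b j (t *\<^sub>R x)) has_vector_derivative e j x t) (at t within {0..1})" for t
      proof -
        have "((\<lambda>t. b j (0 + t *\<^sub>R x)) has_vector_derivative frechet_derivative (b j) (at (0 + t *\<^sub>R x)) x) (at t within {0..1})"
          by (rule has_vector_derivative_line[OF entireD(1)[OF b]])
        then have 1: "((\<lambda>t. b j (t *\<^sub>R x)) has_vector_derivative (\<Sum>i\<in>UNIV. x $ i * c j i (t *\<^sub>R x))) (at t within {0..1})"
          by (simp add: Db)
        have 2: "((\<lambda>t. complex_of_real t) has_vector_derivative 1) (at t within {0..1})"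
          by (auto intro!: derivative_eq_intros)
        show ?thesis using has_vector_derivative_mult[OF 2 1] by (simp add: e_def add.commute)
      qed
      from fundamental_theorem_of_calculus[OF zero_le_one this]
      show ?thesis by (simp add: integral_unique)
    qed
    moreover have "integral {0..1} (\<lambda>t. \<Sum>j\<in>UNIV. v $ j * e j x t) = (\<Sum>j\<in>UNIV. v $ j * integral {0..1} (e j x))"
      by (subst integral_sum) (auto intro!: integrable_continuous_real continuous_intros ce)
    moreover have "L x integrable_on cbox 0 1"
      using continuous_on_compose2[OF contL pair] by (intro integrable_continuous) simp
    ultimately show ?thesis by (simp add: blinfun_apply_integral L)
  qed
  then have "blinfun_apply (integral (cbox 0 1) (L x)) = (\<lambda>v. \<Sum>j\<in>UNIV. v $ j * b j x)" for x
    by (intro ext)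
  ultimately have DH: "(H has_derivative (\<lambda>v. \<Sum>j\<in>UNIV. v $ j * b j x)) (at x)" for x
    by simp
  show thesis
  proof
    show "entire H"
      by (rule entireI[OF DH]) (simp add: sum_distrib_left mult.assoc)
    show "H 0 = 0" by (simp add: H_def \<omega>_def)
    show "frechet_derivative H (at z) (axis k 1) = b k z" for k z
      unfolding frechet_derivative_eq[OF DH] by (simp add: axis_def if_distrib[of "\<lambda>a. a * _"] cong: if_cong)
  qed
qed

text \<open>The conjugates b k of the antiholomorphic derivatives of f are entire because f is
  pluriharmonic, and closed because second derivatives commute. Their primitive H is such that f -
  cnj H has vanishing antiholomorphic derivatives.\<close>

lemma pluriharmonic_decomposition:
  fixes f :: "complex ^ 'n \<Rightarrow> complex"
  assumes f: "pluriharmonic f"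
  obtains g h where "entire g" "entire h" "h 0 = 0" "f = (\<lambda>z. g z + cnj (h z))"
proof -
  have C2f: "C2 f" and ph: "d_z j (d_zbar k f) z = 0" for j k z
    using f by (auto simp: pluriharmonic_def)
  have C1f: "C1 f" and C1D: "C1 (\<lambda>z. frechet_derivative f (at z) w)" for w
    using C2f by (auto simp: C2_def)
  have zb: "d_zbar k f = (\<lambda>z. (1/2) * frechet_derivative f (at z) (axis k 1)
      + (\<i>/2) * frechet_derivative f (at z) (axis k \<i>))" for k
    by (auto simp: d_zbar_def fun_eq_iff field_simps)
  have C1zb: "C1 (d_zbar k f)" for k
    unfolding zb by (intro C1_add C1_cmult C1D)
  define b where "b = (\<lambda>k z. cnj (d_zbar k f z))"
  have C1b: "C1 (b k)" for k unfolding b_def by (intro C1_cnj C1zb)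
  have b: "entire (b k)" for k
    by (rule entire_if_d_zbar_zero[OF C1b]) (simp add: b_def d_zbar_cnj C1zb ph)
  have sym: "d_zbar j (d_zbar k f) z = d_zbar k (d_zbar j f) z" for j k z
  proof -
    define S where "S = (\<lambda>u v. frechet_derivative (\<lambda>z. frechet_derivative f (at z) u) (at z) v)"
    have S: "S u v = S v u" for u v unfolding S_def by (rule C2_second_derivative_symmetric[OF C2f])
    have fd: "frechet_derivative (d_zbar k f) (at z) v = (1/2) * S (axis k 1) v + (\<i>/2) * S (axis k \<i>) v" for k v
      unfolding zb S_def frechet_derivative_add[OF C1_cmult[OF C1D] C1_cmult[OF C1D]]
        frechet_derivative_cmult[OF C1D] ..
    have dd: "d_zbar j (d_zbar k f) z = (S (axis k 1) (axis j 1) + \<i> * S (axis k \<i>) (axis j 1)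
        + \<i> * S (axis k 1) (axis j \<i>) - S (axis k \<i>) (axis j \<i>)) / 4" for j k
      unfolding d_zbar_def[of j] fd by (simp add: field_simps)
    show ?thesis
      unfolding dd S[of "axis k 1" "axis j 1"] S[of "axis k \<i>" "axis j 1"]
        S[of "axis k 1" "axis j \<i>"] S[of "axis k \<i>" "axis j \<i>"]
      by (simp add: add_ac)
  qed
  have "frechet_derivative (b k) (at z) (axis j 1) = cnj (d_zbar j (d_zbar k f) z)" for j k z
    using d_z_entire[OF b[of k], of j z] by (simp add: b_def d_z_cnj C1zb)
  then have closed: "frechet_derivative (b k) (at z) (axis j 1) = frechet_derivative (b j) (at z) (axis k 1)" for j k z
    using sym by simp
  obtain H where H: "entire H" "H 0 = 0" "\<And>k z. frechet_derivative H (at z) (axis k 1) = b k z"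
    using holomorphic_primitive[of b, OF b closed] by blast
  define g where "g = (\<lambda>z. f z + (-1) * cnj (H z))"
  have C1H: "C1 (\<lambda>z. cnj (H z))" by (intro C1_cnj entire_C1 H)
  have "entire g"
  proof (rule entire_if_d_zbar_zero)
    show "C1 g" unfolding g_def by (intro C1_add C1_cmult C1f C1H)
    show "d_zbar j g z = 0" for j z
      unfolding g_def
      by (simp only: d_zbar_add[OF C1f C1_cmult[OF C1H]] d_zbar_cmult[OF C1H] d_zbar_cnj[OF entire_C1[OF H(1)]]
          d_z_entire[OF H(1)] H(3)) (simp add: b_def)
  qed
  moreover have "f = (\<lambda>z. g z + cnj (H z))" by (simp add: g_def)
  ultimately show thesis using that H by blast
qed

section \<open>Toeplitz operators\<close>

lemma form_compact_subset: "\<lbrakk>form_compact V ip q; W \<subseteq> V\<rbrakk> \<Longrightarrow> form_compact W ip q"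
  unfolding form_compact_def by (meson subsetD)

text \<open>The target measure of J; absorbing the weight makes the Toeplitz form an ordinary inner
  product of square integrable functions.\<close>

definition weighted :: "real \<Rightarrow> (complex ^ 'n) measure \<Rightarrow> (complex ^ 'n) measure" where
  "weighted \<alpha> \<mu> = density \<mu> (\<lambda>z. ennreal (exp (- (norm z)\<^sup>2 / \<alpha>)))"

lemma sets_weighted [simp]: "sets (weighted \<alpha> \<mu>) = sets \<mu>"
  by (simp add: weighted_def)

lemma toeplitz_form_eq:
  assumes "sets \<mu> = sets borel" and f: "f \<in> borel_measurable borel" and g: "g \<in> borel_measurable borel"
  shows "toeplitz_form \<alpha> \<mu> f g = l2_inner (weighted \<alpha> \<mu>) f g"
    and "integrable \<mu> (\<lambda>z. f z * cnj (g z) * of_real (exp (- (norm z)\<^sup>2 / \<alpha>)))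
      \<longleftrightarrow> integrable (weighted \<alpha> \<mu>) (\<lambda>z. f z * cnj (g z))"
proof -
  note [measurable_cong] = assms(1)
  note [measurable] = f g
  have [measurable]: "(\<lambda>z :: complex ^ 'n. exp (- (norm z)\<^sup>2 / \<alpha>)) \<in> borel_measurable borel" by measurable
  have e: "f z * cnj (g z) * of_real (exp (- (norm z)\<^sup>2 / \<alpha>))
      = exp (- (norm z)\<^sup>2 / \<alpha>) *\<^sub>R (f z * cnj (g z))" for z
    by (simp only: scaleR_conv_of_real mult.commute)
  show "toeplitz_form \<alpha> \<mu> f g = l2_inner (weighted \<alpha> \<mu>) f g"
    unfolding toeplitz_form_def l2_inner_def weighted_def e
    by (rule integral_density[symmetric]) auto
  show "integrable \<mu> (\<lambda>z. f z * cnj (g z) * of_real (exp (- (norm z)\<^sup>2 / \<alpha>)))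
      \<longleftrightarrow> integrable (weighted \<alpha> \<mu>) (\<lambda>z. f z * cnj (g z))"
    unfolding weighted_def e by (rule integrable_density[symmetric]) auto
qed

text \<open>The diagonal controls everything: Cauchy-Schwarz in the weighted space recovers absolute
  convergence and the two-argument bound from square integrability and a bound on the quadratic
  form.\<close>

lemma toeplitz_bounded_iff:
  assumes \<mu>: "sets \<mu> = sets borel" and meas: "H \<subseteq> borel_measurable borel"
    and H: "psd_form fun_scale H (l2_inner (gauss_measure \<alpha>))"
  shows "toeplitz_bounded \<alpha> H \<mu> \<longleftrightarrow> (\<forall>f\<in>H. square_integrable (weighted \<alpha> \<mu>) f) \<and>
    (\<exists>C. \<forall>f\<in>H. Re (toeplitz_form \<alpha> \<mu> f f) \<le> C * Re (l2_inner (gauss_measure \<alpha>) f f))"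
proof -
  interpret psd_form fun_scale H "l2_inner (gauss_measure \<alpha>)" by (rule H)
  define \<mu>' where "\<mu>' = weighted \<alpha> \<mu>"
  have meas_f: "f \<in> borel_measurable borel" if "f \<in> H" for f using meas that by auto
  have sets': "sets \<mu>' = sets borel" using \<mu> by (simp add: \<mu>'_def)
  have meas': "f \<in> borel_measurable \<mu>'" if "f \<in> H" for f
    using meas_f[OF that] measurable_cong_sets[OF sets' refl] by blast
  have form: "toeplitz_form \<alpha> \<mu> f g = l2_inner \<mu>' f g" if "f \<in> H" "g \<in> H" for f g
    unfolding \<mu>'_def using toeplitz_form_eq(1)[OF \<mu>] meas_f that by blast
  have integ: "integrable \<mu> (\<lambda>z. f z * cnj (g z) * of_real (exp (- (norm z)\<^sup>2 / \<alpha>)))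
      \<longleftrightarrow> integrable \<mu>' (\<lambda>z. f z * cnj (g z))" if "f \<in> H" "g \<in> H" for f g
    unfolding \<mu>'_def using toeplitz_form_eq(2)[OF \<mu>] meas_f that by blast
  show ?thesis
    unfolding \<mu>'_def[symmetric]
  proof (intro iffI conjI ballI)
    assume T: "toeplitz_bounded \<alpha> H \<mu>"
    show "square_integrable \<mu>' f" if f: "f \<in> H" for f
    proof -
      have "integrable \<mu>' (\<lambda>z. f z * cnj (f z))"
        using T f integ[OF f f] by (simp add: toeplitz_bounded_def)
      then have "integrable \<mu>' (\<lambda>z. complex_of_real ((cmod (f z))\<^sup>2))"
        by (simp only: complex_norm_square)
      then have "integrable \<mu>' (\<lambda>z. Re (complex_of_real ((cmod (f z))\<^sup>2)))" by (rule integrable_Re)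
      then have "integrable \<mu>' (\<lambda>z. (cmod (f z))\<^sup>2)" by (simp only: Re_complex_of_real)
      then show ?thesis using meas'[OF f] by (simp add: square_integrable_def)
    qed
    obtain C where C: "\<And>f g. \<lbrakk>f \<in> H; g \<in> H\<rbrakk> \<Longrightarrow> cmod (toeplitz_form \<alpha> \<mu> f g)
        \<le> C * l2_norm (gauss_measure \<alpha>) f * l2_norm (gauss_measure \<alpha>) g"
      using T unfolding toeplitz_bounded_def by blast
    have "Re (toeplitz_form \<alpha> \<mu> f f) \<le> C * nq f" if f: "f \<in> H" for f
    proof -
      have "Re (toeplitz_form \<alpha> \<mu> f f) \<le> C * (l2_norm (gauss_measure \<alpha>) f * l2_norm (gauss_measure \<alpha>) f)"
        using C[OF f f] complex_Re_le_cmod[of "toeplitz_form \<alpha> \<mu> f f"] by (simp add: mult.assoc)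
      also have "\<dots> = C * nq f" using nonneg[OF f] by (simp add: l2_norm_eq)
      finally show ?thesis .
    qed
    then show "\<exists>C. \<forall>f\<in>H. Re (toeplitz_form \<alpha> \<mu> f f) \<le> C * nq f" by blast
  next
    assume R: "(\<forall>f\<in>H. square_integrable \<mu>' f) \<and> (\<exists>C. \<forall>f\<in>H. Re (toeplitz_form \<alpha> \<mu> f f) \<le> C * nq f)"
    then obtain C where C: "\<And>f. f \<in> H \<Longrightarrow> Re (toeplitz_form \<alpha> \<mu> f f) \<le> C * nq f" by blast
    interpret q: psd_form fun_scale H "l2_inner \<mu>'"
      by (rule psd_form_l2[OF subspace_V]) (use R in blast)
    have C': "q.nq f \<le> \<bar>C\<bar> * nq f" if f: "f \<in> H" for f
    proof -
      have "q.nq f \<le> C * nq f" using C[OF f] form[OF f f] by simp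
      also have "\<dots> \<le> \<bar>C\<bar> * nq f" using nonneg[OF f] by (intro mult_right_mono) auto
      finally show ?thesis .
    qed
    have "cmod (toeplitz_form \<alpha> \<mu> f g) \<le> \<bar>C\<bar> * l2_norm (gauss_measure \<alpha>) f * l2_norm (gauss_measure \<alpha>) g"
      if f: "f \<in> H" and g: "g \<in> H" for f g
    proof -
      have "cmod (toeplitz_form \<alpha> \<mu> f g) \<le> sqrt (q.nq f) * sqrt (q.nq g)"
        using q.cmod_le[OF f g] form[OF f g] by simp
      also have "\<dots> \<le> sqrt (\<bar>C\<bar> * nq f) * sqrt (\<bar>C\<bar> * nq g)"
        using C'[OF f] C'[OF g] q.nonneg[OF g] nonneg[OF f] by (intro mult_mono) auto
      also have "\<dots> = \<bar>C\<bar> * l2_norm (gauss_measure \<alpha>) f * l2_norm (gauss_measure \<alpha>) g"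
        by (simp add: l2_norm_eq real_sqrt_mult mult_ac)
      finally show ?thesis .
    qed
    moreover have "integrable \<mu>' (\<lambda>z. f z * cnj (g z))" if "f \<in> H" "g \<in> H" for f g
      using R that square_integrable_mult_cnj by blast
    ultimately show "toeplitz_bounded \<alpha> H \<mu>"
      unfolding toeplitz_bounded_def using integ by blast
  qed
qed

lemma toeplitz_form_pair:
  assumes \<mu>: "sets \<mu> = sets borel" and meas: "H \<subseteq> borel_measurable borel"
    and H: "hilbert_form fun_scale H (l2_inner (gauss_measure \<alpha>))"
    and bdd: "toeplitz_bounded \<alpha> H \<mu>"
  shows "form_pair fun_scale H (l2_inner (gauss_measure \<alpha>)) (toeplitz_form \<alpha> \<mu>)"
proof -
  interpret hilbert_form fun_scale H "l2_inner (gauss_measure \<alpha>)" by (rule H)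
  have iff: "(\<forall>f\<in>H. square_integrable (weighted \<alpha> \<mu>) f) \<and>
    (\<exists>C. \<forall>f\<in>H. Re (toeplitz_form \<alpha> \<mu> f f) \<le> C * nq f)"
    using toeplitz_bounded_iff[OF \<mu> meas psd_form_axioms] bdd by blast
  interpret q: psd_form fun_scale H "l2_inner (weighted \<alpha> \<mu>)"
    by (rule psd_form_l2[OF subspace_V]) (use iff in blast)
  have form: "toeplitz_form \<alpha> \<mu> f g = l2_inner (weighted \<alpha> \<mu>) f g" if "f \<in> H" "g \<in> H" for f g
    using toeplitz_form_eq(1)[OF \<mu>, of f g \<alpha>] meas that by blast
  show ?thesis
  proof unfold_locales
    show "toeplitz_form \<alpha> \<mu> y x = cnj (toeplitz_form \<alpha> \<mu> x y)" if "x \<in> H" "y \<in> H" for x y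
      unfolding form[OF that] form[OF that(2,1)] by (rule q.sym[OF that])
    show "\<exists>C. \<forall>f\<in>H. Re (toeplitz_form \<alpha> \<mu> f f) \<le> C * nq f" using iff by blast
  qed (simp_all add: form subspace_V q.add_left q.scale_left q.nonneg)
qed

lemma toeplitz_op_represents:
  assumes "form_pair fun_scale H (l2_inner (gauss_measure \<alpha>)) (toeplitz_form \<alpha> \<mu>)" and f: "f \<in> H"
  shows "toeplitz_op \<alpha> H \<mu> f \<in> H"
    and "g \<in> H \<Longrightarrow> l2_inner (gauss_measure \<alpha>) (toeplitz_op \<alpha> H \<mu> f) g = toeplitz_form \<alpha> \<mu> f g"
proof -
  interpret form_pair fun_scale H "l2_inner (gauss_measure \<alpha>)" "toeplitz_form \<alpha> \<mu>" by fact
  have "\<exists>!h. h \<in> H \<and> (\<forall>g\<in>H. l2_inner (gauss_measure \<alpha>) h g = toeplitz_form \<alpha> \<mu> f g)"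
  proof (rule ex_ex1I)
    show "\<exists>h. h \<in> H \<and> (\<forall>g\<in>H. l2_inner (gauss_measure \<alpha>) h g = toeplitz_form \<alpha> \<mu> f g)"
      using represents_exists f by blast
    show "h = h'" if "h \<in> H \<and> (\<forall>g\<in>H. l2_inner (gauss_measure \<alpha>) h g = toeplitz_form \<alpha> \<mu> f g)"
      "h' \<in> H \<and> (\<forall>g\<in>H. l2_inner (gauss_measure \<alpha>) h' g = toeplitz_form \<alpha> \<mu> f g)" for h h'
      using that by (intro ip.ext_left) auto
  qed
  from theI'[OF this]
  show "toeplitz_op \<alpha> H \<mu> f \<in> H"
    "g \<in> H \<Longrightarrow> l2_inner (gauss_measure \<alpha>) (toeplitz_op \<alpha> H \<mu> f) g = toeplitz_form \<alpha> \<mu> f g"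
    unfolding toeplitz_op_def by blast+
qed

lemma toeplitz_in_ideal_iff:
  assumes \<mu>: "sets \<mu> = sets borel" and meas: "H \<subseteq> borel_measurable borel"
    and H: "hilbert_form fun_scale H (l2_inner (gauss_measure \<alpha>))"
  shows "toeplitz_in_ideal \<Phi> \<alpha> H \<mu> \<longleftrightarrow> toeplitz_bounded \<alpha> H \<mu> \<and>
    form_compact H (l2_inner (gauss_measure \<alpha>)) (toeplitz_form \<alpha> \<mu>) \<and> toeplitz_norm \<Phi> \<alpha> H \<mu> < \<infinity>"
proof (cases "toeplitz_bounded \<alpha> H \<mu>")
  case True
  note fp = toeplitz_form_pair[OF \<mu> meas H True]
  show ?thesis
    unfolding toeplitz_in_ideal_def symm_ideal_def toeplitz_norm_def mem_Collect_eq
    using compact_operator_iff[OF fp, of "toeplitz_op \<alpha> H \<mu>"] toeplitz_op_represents[OF fp] True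
    by blast
qed (simp add: toeplitz_in_ideal_def)

lemma toeplitz_sv_eq:
  assumes fp: "form_pair fun_scale H (l2_inner (gauss_measure \<alpha>)) (toeplitz_form \<alpha> \<mu>)"
    and e: "eigensystem H (l2_inner (gauss_measure \<alpha>)) (toeplitz_form \<alpha> \<mu>) e l"
  shows "toeplitz_sv \<alpha> H \<mu> = l"
  unfolding toeplitz_sv_def
  by (rule singular_values_eq[OF fp _ _ e]) (use toeplitz_op_represents[OF fp] in blast)+

section \<open>Comparison of symmetric norms\<close>

definition trunc :: "nat \<Rightarrow> (nat \<Rightarrow> real) \<Rightarrow> nat \<Rightarrow> real" where
  "trunc N s k = (if k < N then s k else 0)"

lemma toeplitz_norm_eq:
  "toeplitz_norm \<Phi> \<alpha> H \<mu> = (SUP N\<in>{1..}. ereal (\<Phi> (trunc N (toeplitz_sv \<alpha> H \<mu>))))"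
  unfolding toeplitz_norm_def ideal_norm_def toeplitz_sv_def trunc_def[abs_def] ..

lemma toeplitz_norm_nonneg:
  assumes \<Phi>: "symmetric_norming \<Phi>"
  shows "0 \<le> toeplitz_norm \<Phi> \<alpha> H \<mu>"
proof -
  have "trunc 1 (toeplitz_sv \<alpha> H \<mu>) \<in> fin_supp"
    by (auto simp: fin_supp_def trunc_def)
  then have "0 \<le> ereal (\<Phi> (trunc 1 (toeplitz_sv \<alpha> H \<mu>)))"
    using \<Phi> by (simp add: symmetric_norming_def)
  also have "\<dots> \<le> toeplitz_norm \<Phi> \<alpha> H \<mu>"
    unfolding toeplitz_norm_eq by (rule SUP_upper) simp
  finally show ?thesis .
qed

lemma toeplitz_norm_le:
  assumes \<Phi>: "symmetric_norming \<Phi>" and c: "0 \<le> c"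
    and s: "decseq (toeplitz_sv \<alpha> H \<mu>)" "\<And>k. 0 \<le> toeplitz_sv \<alpha> H \<mu> k" "\<And>k. 0 \<le> toeplitz_sv \<alpha> H' \<mu> k"
    and le: "\<And>N. (\<Sum>k<N. toeplitz_sv \<alpha> H \<mu> k) \<le> c * (\<Sum>k<N. toeplitz_sv \<alpha> H' \<mu> k)"
  shows "toeplitz_norm \<Phi> \<alpha> H \<mu> \<le> ereal c * toeplitz_norm \<Phi> \<alpha> H' \<mu>"
  unfolding toeplitz_norm_eq[of \<Phi> \<alpha> H]
proof (rule SUP_least)
  fix N :: nat assume N: "N \<in> {1..}"
  define x where "x = trunc N (toeplitz_sv \<alpha> H \<mu>)"
  define y where "y = trunc N (toeplitz_sv \<alpha> H' \<mu>)"
  have fin: "trunc N t \<in> fin_supp" for t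
    unfolding fin_supp_def mem_Collect_eq
    by (rule finite_subset[of _ "{..<N}"]) (auto simp: trunc_def)
  \<comment> \<open>Partial sums of a truncation are again partial sums of the original sequence, so
    the hypothesis at min m N gives every dominance inequality.\<close>
  have sum_trunc: "(\<Sum>k<m. trunc N t k) = (\<Sum>k<min m N. t k)" for m t
    by (rule sum.mono_neutral_cong_right) (auto simp: trunc_def)
  have "\<Phi> x \<le> \<Phi> (\<lambda>k. c * y k)"
  proof (rule symmetric_norming_dominance[OF \<Phi>])
    show "x \<in> fin_supp" by (simp add: x_def fin)
    show "decseq x"
      unfolding decseq_def
    proof (intro allI impI)
      fix i j :: nat assume "i \<le> j"
      then show "x j \<le> x i" using decseqD[OF s(1), of i j] s(2) by (simp add: x_def trunc_def)
    qed
    show "0 \<le> x k" for k using s(2) by (simp add: x_def trunc_def)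
    show "(\<lambda>k. c * y k) \<in> fin_supp"
      unfolding fin_supp_def mem_Collect_eq
      by (rule finite_subset[of _ "{..<N}"]) (auto simp: trunc_def y_def)
    show "0 \<le> c * y k" for k using s(3) c by (simp add: y_def trunc_def)
    show "(\<Sum>k<m. x k) \<le> (\<Sum>k<m. c * y k)" for m
      using le[of "min m N"] unfolding sum_distrib_left[symmetric] x_def y_def sum_trunc .
  qed
  also have "\<dots> = c * \<Phi> y" using \<Phi> fin c by (simp add: symmetric_norming_def y_def)
  finally have "ereal (\<Phi> x) \<le> ereal c * ereal (\<Phi> y)" by simp
  also have "\<dots> \<le> ereal c * toeplitz_norm \<Phi> \<alpha> H' \<mu>"
    unfolding toeplitz_norm_eq y_def using c N
    by (intro ereal_mult_left_mono SUP_upper) auto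
  finally show "ereal (\<Phi> (trunc N (toeplitz_sv \<alpha> H \<mu>))) \<le> ereal c * toeplitz_norm \<Phi> \<alpha> H' \<mu>"
    by (simp add: x_def)
qed

lemma fock_space_measurable: "fock_space \<alpha> \<subseteq> borel_measurable borel"
  by (auto simp: fock_space_def entire_measurable)

text \<open>The condition h 0 = 0 assigns constants to the holomorphic part, which makes the sum
  orthogonal and the decomposition unique.\<close>

lemma ph_space_eq:
  assumes \<alpha>: "\<alpha> > 0"
  shows "ph_space \<alpha> = {\<lambda>z. g z + cnj (h z) |g h. g \<in> fock_space \<alpha> \<and> h \<in> fock_space \<alpha> \<and> h 0 = 0}"
proof (intro set_eqI iffI)
  fix f :: "complex ^ 'n \<Rightarrow> complex"
  assume "f \<in> ph_space \<alpha>"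
  then have f: "pluriharmonic f" "square_integrable (gauss_measure \<alpha>) f" by (auto simp: ph_space_def)
  obtain g h where gh: "entire g" "entire h" "h 0 = 0" "f = (\<lambda>z. g z + cnj (h z))"
    by (rule pluriharmonic_decomposition[OF f(1)])
  have "square_integrable (gauss_measure \<alpha>) g \<and> square_integrable (gauss_measure \<alpha>) h"
    by (rule square_integrable_split[OF \<alpha> gh(1,2,3)]) (use f gh in simp)
  then show "f \<in> {\<lambda>z. g z + cnj (h z) |g h. g \<in> fock_space \<alpha> \<and> h \<in> fock_space \<alpha> \<and> h 0 = 0}"
    using gh by (auto simp: fock_space_def)
next
  fix f :: "complex ^ 'n \<Rightarrow> complex"
  assume "f \<in> {\<lambda>z. g z + cnj (h z) |g h. g \<in> fock_space \<alpha> \<and> h \<in> fock_space \<alpha> \<and> h 0 = 0}"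
  then show "f \<in> ph_space \<alpha>"
    by (auto simp: ph_space_def fock_space_def pluriharmonic_entire_add_cnj square_integrable_add
        square_integrable_cnj)
qed

text \<open>The parameter \<open>tn\<close> only serves to fix the type \<open>'n\<close> in the abbreviations.\<close>

context
  fixes \<alpha> :: real and tn :: "'n::finite itself"
  assumes \<alpha>: "\<alpha> > 0"
begin

abbreviation (input) "Fock \<equiv> (fock_space \<alpha> :: (complex ^ 'n \<Rightarrow> complex) set)"
abbreviation (input) "PH \<equiv> (ph_space \<alpha> :: (complex ^ 'n \<Rightarrow> complex) set)"
abbreviation (input) "gip \<equiv> l2_inner (gauss_measure \<alpha> :: (complex ^ 'n) measure)"

lemma ph_spaceE:
  assumes "u \<in> PH"
  obtains g h where "g \<in> Fock" "h \<in> Fock" "h 0 = 0" "u = (\<lambda>z. g z + cnj (h z))"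
  using assms unfolding ph_space_eq[OF \<alpha>] by blast

lemma ph_spaceI: "\<lbrakk>g \<in> Fock; h \<in> Fock; h 0 = 0\<rbrakk> \<Longrightarrow> (\<lambda>z. g z + cnj (h z)) \<in> PH"
  unfolding ph_space_eq[OF \<alpha>] by blast

lemma fock_subset_ph: "Fock \<subseteq> PH"
proof
  fix g assume "g \<in> Fock"
  then show "g \<in> PH" using ph_spaceI[OF _ fock_space_const[OF \<alpha>, of 0], of g] by simp
qed

text \<open>The constant cnj (h 0) moves to the holomorphic summand, leaving the conjugate of h - h
  0.\<close>

lemma cnj_fock_in_ph: "h \<in> Fock \<Longrightarrow> (\<lambda>z. cnj (h z)) \<in> PH"
  using ph_spaceI[OF fock_space_const[OF \<alpha>, of "cnj (h 0)"] fock_space_diff[OF _ fock_space_const[OF \<alpha>]], of h "h 0"]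
  by simp

lemma ph_space_measurable: "PH \<subseteq> borel_measurable borel"
proof
  fix u assume "u \<in> PH"
  then obtain g h where gh: "g \<in> Fock" "h \<in> Fock" "u = (\<lambda>z. g z + cnj (h z))" by (rule ph_spaceE)
  then have [measurable]: "g \<in> borel_measurable borel" "h \<in> borel_measurable borel"
    using fock_space_measurable by auto
  show "u \<in> borel_measurable borel" unfolding gh(3) by measurable
qed

lemma subspace_ph_space: "module.subspace fun_scale PH"
proof -
  interpret vector_space "fun_scale :: complex \<Rightarrow> (complex ^ 'n \<Rightarrow> complex) \<Rightarrow> _"
    by (rule vector_space_fun_scale)
  show ?thesis
    unfolding subspace_def
  proof (intro conjI ballI allI)
    show "0 \<in> PH" using fock_space_const[OF \<alpha>, of 0] fock_subset_ph by (auto simp: zero_fun_def)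
  next
    fix u v assume "u \<in> PH" "v \<in> PH"
    then obtain g h g' h' where gh: "g \<in> Fock" "h \<in> Fock" "h 0 = 0" "u = (\<lambda>z. g z + cnj (h z))"
      "g' \<in> Fock" "h' \<in> Fock" "h' 0 = 0" "v = (\<lambda>z. g' z + cnj (h' z))"
      by (elim ph_spaceE)
    have "(\<lambda>z. (g z + g' z) + cnj (h z + h' z)) \<in> PH"
      using gh by (intro ph_spaceI fock_space_add) auto
    also have "(\<lambda>z. (g z + g' z) + cnj (h z + h' z)) = u + v" by (auto simp: gh)
    finally show "u + v \<in> PH" .
  next
    fix c u assume "u \<in> PH"
    then obtain g h where gh: "g \<in> Fock" "h \<in> Fock" "h 0 = 0" "u = (\<lambda>z. g z + cnj (h z))" by (rule ph_spaceE)
    have "(\<lambda>z. c * g z + cnj (cnj c * h z)) \<in> PH"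
      using gh by (intro ph_spaceI fock_space_cmult) auto
    also have "(\<lambda>z. c * g z + cnj (cnj c * h z)) = fun_scale c u" by (auto simp: gh algebra_simps)
    finally show "fun_scale c u \<in> PH" .
  qed
qed

text \<open>Both cross terms are means of products vanishing at 0. The second summand has its
  arguments reversed because conjugation reverses inner products.\<close>

lemma ph_inner:
  assumes g: "g \<in> Fock" "g' \<in> Fock" and h: "h \<in> Fock" "h' \<in> Fock" and z: "h 0 = 0" "h' 0 = 0"
  shows "gip (\<lambda>z. g z + cnj (h z)) (\<lambda>z. g' z + cnj (h' z)) = gip g g' + gip h' h"
proof -
  have sq: "square_integrable (gauss_measure \<alpha>) f" if "f \<in> Fock" for f using that by (simp add: fock_space_def)
  have int: "integrable (gauss_measure \<alpha>) (\<lambda>z. g z * cnj (g' z))"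
    "integrable (gauss_measure \<alpha>) (\<lambda>z. g z * h' z)"
    "integrable (gauss_measure \<alpha>) (\<lambda>z. cnj (h z * g' z))"
    "integrable (gauss_measure \<alpha>) (\<lambda>z. h' z * cnj (h z))"
    by (intro square_integrable_mult_cnj square_integrable_mult Bochner_Integration.integrable_cnj sq g h)+
  have "gip (\<lambda>z. g z + cnj (h z)) (\<lambda>z. g' z + cnj (h' z))
    = (\<integral>z. g z * cnj (g' z) + g z * h' z + cnj (h z * g' z) + h' z * cnj (h z) \<partial>gauss_measure \<alpha>)"
    by (simp add: l2_inner_def algebra_simps)
  also have "\<dots> = gip g g' + (\<integral>z. g z * h' z \<partial>gauss_measure \<alpha>)
      + (\<integral>z. cnj (h z * g' z) \<partial>gauss_measure \<alpha>) + gip h' h"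
    using int by (simp only: l2_inner_def Bochner_Integration.integral_add Bochner_Integration.integrable_add)
  also have "(\<integral>z. g z * h' z \<partial>gauss_measure \<alpha>) = 0" using fock_space_mean[OF \<alpha> g(1) h(2)] z by simp
  also have "(\<integral>z. cnj (h z * g' z) \<partial>gauss_measure \<alpha>) = 0"
    unfolding Bochner_Integration.integral_cnj using fock_space_mean[OF \<alpha> h(1) g(2)] z by simp
  finally show ?thesis by simp
qed

lemma hilbert_form_ph_space: "hilbert_form fun_scale PH gip"
proof -
  interpret F: hilbert_form fun_scale Fock gip by (rule hilbert_form_fock_space[OF \<alpha>])
  interpret psd_form fun_scale PH gip
    by (rule psd_form_l2[OF subspace_ph_space]) (simp add: ph_space_def)
  have nq: "nq (\<lambda>z. g z + cnj (h z)) = nq g + nq h" if "g \<in> Fock" "h \<in> Fock" "h 0 = 0" for g h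
    using ph_inner[of g g h h] that by simp
  show ?thesis
  proof
    fix u assume u: "u \<in> PH" "nq u = 0"
    then obtain g h where gh: "g \<in> Fock" "h \<in> Fock" "h 0 = 0" "u = (\<lambda>z. g z + cnj (h z))" by (elim ph_spaceE)
    have "nq g + nq h = 0" using u nq[OF gh(1,2,3)] gh(4) by simp
    then have "nq g = 0" "nq h = 0" using F.nonneg[OF gh(1)] F.nonneg[OF gh(2)] by linarith+
    then have "g = 0" "h = 0" using F.definite gh by auto
    then show "u = 0" using gh(4) by (auto simp: fun_eq_iff)
  next
    fix U :: "nat \<Rightarrow> complex ^ 'n \<Rightarrow> complex"
    assume U: "\<And>k. U k \<in> PH"
      and cau: "\<And>e. e > 0 \<Longrightarrow> \<exists>N. \<forall>m\<ge>N. \<forall>n\<ge>N. nq (U m - U n) < e"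
    have "\<exists>g h. g \<in> Fock \<and> h \<in> Fock \<and> h 0 = 0 \<and> U k = (\<lambda>z. g z + cnj (h z))" for k
      using ph_spaceE[OF U[of k]] by metis
    then obtain G H where G: "\<And>k. G k \<in> Fock" and H: "\<And>k. H k \<in> Fock" and H0: "\<And>k. H k 0 = 0"
      and UGH: "\<And>k. U k = (\<lambda>z. G k z + cnj (H k z))" by metis
    have split: "nq (U m - (\<lambda>z. g z + cnj (h z))) = nq (G m - g) + nq (H m - h)"
      if "g \<in> Fock" "h \<in> Fock" "h 0 = 0" for m g h
    proof -
      have "U m - (\<lambda>z. g z + cnj (h z)) = (\<lambda>z. (G m - g) z + cnj ((H m - h) z))"
        by (auto simp: UGH)
      then show ?thesis using nq[of "G m - g" "H m - h"] G H H0 that by simp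
    qed
    have le: "nq (G m - G n) \<le> nq (U m - U n)" "nq (H m - H n) \<le> nq (U m - U n)" for m n
      using split[OF G[of n] H[of n] H0, of m] F.nonneg[of "G m - G n"] F.nonneg[of "H m - H n"] G H
      by (simp_all add: UGH[of n])
    obtain g where g: "g \<in> Fock" "(\<lambda>k. nq (G k - g)) \<longlonglongrightarrow> 0"
      using F.complete[of G] G cau le(1) by (meson le_less_trans)
    obtain h where h: "h \<in> Fock" "(\<lambda>k. nq (H k - h)) \<longlonglongrightarrow> 0"
      using F.complete[of H] H cau le(2) by (meson le_less_trans)
    \<comment> \<open>The normalization survives the limit because evaluation at 0 is continuous,
      being the inner product with the kernel at 0.\<close>
    have "h 0 = 0"
    proof -
      define K where "K = nq (fock_kernel \<alpha> 0)"
      have "(cmod (h 0))\<^sup>2 \<le> nq (H k - h) * K" for k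
        using F.cauchy_schwarz[of "H k - h" "fock_kernel \<alpha> 0"] H h fock_kernel_in_fock_space[OF \<alpha>, of 0]
          fock_kernel_reproducing[OF \<alpha>, of "H k - h" 0] H0[of k] by (simp add: K_def)
      moreover have "(\<lambda>k. nq (H k - h) * K) \<longlonglongrightarrow> 0"
        using tendsto_mult_right[OF h(2), of K] by simp
      ultimately have "(cmod (h 0))\<^sup>2 \<le> 0" by (intro LIMSEQ_le_const[of _ 0]) auto
      then show ?thesis by simp
    qed
    then have "(\<lambda>k. nq (U k - (\<lambda>z. g z + cnj (h z)))) \<longlonglongrightarrow> 0"
      using tendsto_add[OF g(2) h(2)] by (simp add: split g h)
    then show "\<exists>u\<in>PH. (\<lambda>k. nq (U k - u)) \<longlonglongrightarrow> 0"
      by (intro bexI[of _ "\<lambda>z. g z + cnj (h z)"] ph_spaceI g h \<open>h 0 = 0\<close>)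
  qed
qed

text \<open>The form sees conj h only through |h|^2, so it takes the same diagonal value as at h.
  The parallelogram bound then costs a factor 2, while the norm splits exactly over g and h.\<close>

lemma toeplitz_bounded_fock_iff_ph:
  assumes \<mu>: "sets \<mu> = sets borel"
  shows "toeplitz_bounded \<alpha> Fock \<mu> \<longleftrightarrow> toeplitz_bounded \<alpha> PH \<mu>"
proof
  assume "toeplitz_bounded \<alpha> PH \<mu>"
  then show "toeplitz_bounded \<alpha> Fock \<mu>"
    using fock_subset_ph unfolding toeplitz_bounded_def by (meson subsetD)
next
  assume T: "toeplitz_bounded \<alpha> Fock \<mu>"
  interpret F: hilbert_form fun_scale Fock gip by (rule hilbert_form_fock_space[OF \<alpha>])
  interpret P: hilbert_form fun_scale PH gip by (rule hilbert_form_ph_space)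
  define \<mu>' where "\<mu>' = weighted \<alpha> \<mu>"
  obtain C where sqF: "\<And>f. f \<in> Fock \<Longrightarrow> square_integrable \<mu>' f"
    and C: "\<And>f. f \<in> Fock \<Longrightarrow> Re (toeplitz_form \<alpha> \<mu> f f) \<le> C * F.nq f"
    using T toeplitz_bounded_iff[OF \<mu> fock_space_measurable F.psd_form_axioms] unfolding \<mu>'_def by blast
  have sqP: "square_integrable \<mu>' u" if "u \<in> PH" for u
    using that by (elim ph_spaceE) (simp add: square_integrable_add square_integrable_cnj sqF)
  interpret q: psd_form fun_scale PH "l2_inner \<mu>'"
    by (rule psd_form_l2[OF subspace_ph_space sqP])
  have form: "toeplitz_form \<alpha> \<mu> f g = l2_inner \<mu>' f g" if "f \<in> PH" "g \<in> PH" for f g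
    unfolding \<mu>'_def using toeplitz_form_eq(1)[OF \<mu>, of f g \<alpha>] ph_space_measurable that by blast
  have "Re (toeplitz_form \<alpha> \<mu> u u) \<le> (2 * C) * F.nq u" if u: "u \<in> PH" for u
  proof -
    obtain g h where gh: "g \<in> Fock" "h \<in> Fock" "h 0 = 0" "u = (\<lambda>z. g z + cnj (h z))" using u by (rule ph_spaceE)
    have P': "g \<in> PH" "h \<in> PH" "(\<lambda>z. cnj (h z)) \<in> PH"
      using gh fock_subset_ph cnj_fock_in_ph by auto
    have "q.nq u \<le> 2 * q.nq g + 2 * q.nq (\<lambda>z. cnj (h z))"
      using q.nq_add_le[OF P'(1,3)] by (simp add: gh(4) plus_fun_def)
    also have "q.nq (\<lambda>z. cnj (h z)) = q.nq h" by (simp add: l2_inner_self)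
    also have "2 * q.nq g + 2 * q.nq h \<le> 2 * (C * F.nq g) + 2 * (C * F.nq h)"
      using C[OF gh(1)] C[OF gh(2)] form P' by simp
    also have "\<dots> = (2 * C) * F.nq u"
      using ph_inner[OF gh(1,1,2,2,3,3)] by (simp add: gh(4) algebra_simps)
    finally show ?thesis using form[OF u u] by simp
  qed
  then show "toeplitz_bounded \<alpha> PH \<mu>"
    using toeplitz_bounded_iff[OF \<mu> ph_space_measurable P.psd_form_axioms] sqP unfolding \<mu>'_def by blast
qed

text \<open>Holomorphic and antiholomorphic parts are bounded separately by orthogonality; a
  subsequence is extracted for the first, then a further one for the second, and the parallelogram
  bound recombines them.\<close>

lemma form_compact_fock_iff_ph:
  assumes \<mu>: "sets \<mu> = sets borel" and bdd: "toeplitz_bounded \<alpha> PH \<mu>"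
  shows "form_compact Fock gip (toeplitz_form \<alpha> \<mu>) \<longleftrightarrow> form_compact PH gip (toeplitz_form \<alpha> \<mu>)"
proof
  assume "form_compact PH gip (toeplitz_form \<alpha> \<mu>)"
  then show "form_compact Fock gip (toeplitz_form \<alpha> \<mu>)" by (rule form_compact_subset[OF _ fock_subset_ph])
next
  assume comp: "form_compact Fock gip (toeplitz_form \<alpha> \<mu>)"
  interpret P: form_pair fun_scale PH gip "toeplitz_form \<alpha> \<mu>"
    by (rule toeplitz_form_pair[OF \<mu> ph_space_measurable hilbert_form_ph_space bdd])
  interpret F: hilbert_form fun_scale Fock gip by (rule hilbert_form_fock_space[OF \<alpha>])
  have cnj_q: "P.q.nq (\<lambda>z. cnj (h z)) = P.q.nq h" if "h \<in> Fock" for h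
  proof -
    have "h \<in> borel_measurable borel" "(\<lambda>z. cnj (h z)) \<in> borel_measurable borel"
      using that fock_space_measurable cnj_fock_in_ph ph_space_measurable by blast+
    then show ?thesis by (simp add: toeplitz_form_eq(1)[OF \<mu>] l2_inner_self)
  qed
  show "form_compact PH gip (toeplitz_form \<alpha> \<mu>)"
    unfolding form_compact_def
  proof (intro allI impI, elim conjE exE)
    fix U :: "nat \<Rightarrow> complex ^ 'n \<Rightarrow> complex" and b
    assume U: "\<forall>k. U k \<in> PH" and b: "\<forall>k. P.ip.nq (U k) \<le> b"
    have "\<exists>g h. g \<in> Fock \<and> h \<in> Fock \<and> h 0 = 0 \<and> U k = (\<lambda>z. g z + cnj (h z))" for k
      using ph_spaceE[OF U[rule_format, of k]] by metis
    then obtain G H where G: "\<And>k. G k \<in> Fock" and H: "\<And>k. H k \<in> Fock" and H0: "\<And>k. H k 0 = 0"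
      and UGH: "\<And>k. U k = (\<lambda>z. G k z + cnj (H k z))" by metis
    have nqU: "P.ip.nq (U k) = P.ip.nq (G k) + P.ip.nq (H k)" for k
      unfolding UGH using ph_inner[of "G k" "G k" "H k" "H k"] G H H0 by simp
    have Gb: "P.ip.nq (G k) \<le> b" and Hb: "P.ip.nq (H k) \<le> b" for k
      using b[rule_format, of k] nqU[of k] F.nonneg[OF G[of k]] F.nonneg[OF H[of k]] by linarith+
    obtain r1 :: "nat \<Rightarrow> nat" where r1: "strict_mono r1" "\<forall>e>0. \<exists>N. \<forall>m\<ge>N. \<forall>n\<ge>N.
        P.q.nq (G (r1 m) - G (r1 n)) < e"
      using form_compactD[of Fock gip "toeplitz_form \<alpha> \<mu>" G b, OF comp G Gb] by blast
    obtain r2 :: "nat \<Rightarrow> nat" where r2: "strict_mono r2" "\<forall>e>0. \<exists>N. \<forall>m\<ge>N. \<forall>n\<ge>N.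
        P.q.nq (H (r1 (r2 m)) - H (r1 (r2 n))) < e"
      using form_compactD[of Fock gip "toeplitz_form \<alpha> \<mu>" "\<lambda>k. H (r1 k)" b, OF comp H Hb] by blast
    have "\<exists>N. \<forall>m\<ge>N. \<forall>n\<ge>N. P.q.nq (U (r1 (r2 m)) - U (r1 (r2 n))) < e" if e: "0 < e" for e
    proof -
      obtain N1 where N1: "\<And>m n. \<lbrakk>m \<ge> N1; n \<ge> N1\<rbrakk> \<Longrightarrow> P.q.nq (G (r1 m) - G (r1 n)) < e / 4"
        using r1(2)[rule_format, of "e / 4"] e by auto
      obtain N2 where N2: "\<And>m n. \<lbrakk>m \<ge> N2; n \<ge> N2\<rbrakk> \<Longrightarrow> P.q.nq (H (r1 (r2 m)) - H (r1 (r2 n))) < e / 4"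
        using r2(2)[rule_format, of "e / 4"] e by auto
      have "P.q.nq (U (r1 (r2 m)) - U (r1 (r2 n))) < e" if mn: "m \<ge> max N1 N2" "n \<ge> max N1 N2" for m n
      proof -
        define g where "g = G (r1 (r2 m)) - G (r1 (r2 n))"
        define h where "h = H (r1 (r2 m)) - H (r1 (r2 n))"
        have gh: "g \<in> Fock" "h \<in> Fock" using G H by (simp_all add: g_def h_def)
        have "U (r1 (r2 m)) - U (r1 (r2 n)) = g + (\<lambda>z. cnj (h z))"
          by (auto simp: UGH g_def h_def)
        moreover have "P.q.nq (g + (\<lambda>z. cnj (h z))) \<le> 2 * P.q.nq g + 2 * P.q.nq (\<lambda>z. cnj (h z))"
          using gh fock_subset_ph cnj_fock_in_ph by (intro P.q.nq_add_le) auto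
        moreover have "r2 m \<ge> N1" "r2 n \<ge> N1"
          using mn seq_suble[OF r2(1), of m] seq_suble[OF r2(1), of n] by auto
        then have "P.q.nq g < e / 4" unfolding g_def by (rule N1)
        moreover have "P.q.nq h < e / 4" unfolding h_def using mn by (intro N2) auto
        ultimately show ?thesis using cnj_q[OF gh(2)] by simp
      qed
      then show ?thesis by blast
    qed
    moreover have "strict_mono (\<lambda>k. r1 (r2 k))"
      using strict_mono_compose[OF r1(1) r2(1)] by (simp add: o_def)
    ultimately show "\<exists>r :: nat \<Rightarrow> nat. strict_mono r \<and> (\<forall>e>0. \<exists>N. \<forall>m\<ge>N. \<forall>n\<ge>N.
        P.q.nq (U (r m) - U (r n)) < e)"
      by blast
  qed
qed

text \<open>For the upper bound, project each pluriharmonic eigenvector u k to Fock space and to its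
  conjugate W. The two squared norms add up to at least that of u k, and
  \<open>ky_fan_projection\<close> bounds each weighted sum by the top Fock eigenvalues.\<close>

lemma toeplitz_sv_majorization:
  assumes \<mu>: "sets \<mu> = sets borel" and bdd: "toeplitz_bounded \<alpha> PH \<mu>"
    and comp: "form_compact PH gip (toeplitz_form \<alpha> \<mu>)"
  shows "decseq (toeplitz_sv \<alpha> Fock \<mu>)" "\<And>k. 0 \<le> toeplitz_sv \<alpha> Fock \<mu> k"
    and "decseq (toeplitz_sv \<alpha> PH \<mu>)" "\<And>k. 0 \<le> toeplitz_sv \<alpha> PH \<mu> k"
    and "(\<Sum>k<N. toeplitz_sv \<alpha> Fock \<mu> k) \<le> (\<Sum>k<N. toeplitz_sv \<alpha> PH \<mu> k)"
    and "(\<Sum>k<N. toeplitz_sv \<alpha> PH \<mu> k) \<le> 2 * (\<Sum>k<N. toeplitz_sv \<alpha> Fock \<mu> k)"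
proof -
  define q where "q = toeplitz_form \<alpha> \<mu>"
  have bddF: "toeplitz_bounded \<alpha> Fock \<mu>" using bdd toeplitz_bounded_fock_iff_ph[OF \<mu>] by simp
  have fpF: "form_pair fun_scale Fock gip q"
    unfolding q_def by (rule toeplitz_form_pair[OF \<mu> fock_space_measurable hilbert_form_fock_space[OF \<alpha>] bddF])
  have fpP: "form_pair fun_scale PH gip q"
    unfolding q_def by (rule toeplitz_form_pair[OF \<mu> ph_space_measurable hilbert_form_ph_space bdd])
  interpret F: form_pair fun_scale Fock gip q by (rule fpF)
  interpret P: form_pair fun_scale PH gip q by (rule fpP)
  obtain e t where e: "eigensystem Fock gip q e t"
    using F.eigensystem_exists form_compact_subset[OF comp fock_subset_ph] unfolding q_def by blast
  obtain u l where u: "eigensystem PH gip q u l"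
    using P.eigensystem_exists comp unfolding q_def by blast
  have sv: "toeplitz_sv \<alpha> Fock \<mu> = t" "toeplitz_sv \<alpha> PH \<mu> = l"
    using toeplitz_sv_eq fpF e fpP u unfolding q_def by blast+
  note E = F.eigensystemD[OF e]
  note U = P.eigensystemD[OF u]
  show "decseq (toeplitz_sv \<alpha> Fock \<mu>)" "\<And>k. 0 \<le> toeplitz_sv \<alpha> Fock \<mu> k"
    "decseq (toeplitz_sv \<alpha> PH \<mu>)" "\<And>k. 0 \<le> toeplitz_sv \<alpha> PH \<mu> k"
    unfolding sv by (rule E U)+
  have eP: "e k \<in> PH" for k using E(1) fock_subset_ph by blast
  \<comment> \<open>Fock eigenvectors are admissible test vectors in the larger space, and the form
    takes the values t k there.\<close>
  have "(\<Sum>k<N. P.q.nq (e k)) \<le> (\<Sum>k<N. l k)"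
    by (rule P.ky_fan[OF u]) (simp add: P.ip.orthonormal_or_zero_def eP E(6,7))
  moreover have "P.q.nq (e k) = t k" for k using E(5)[OF E(1)] E(7)[of k] by simp
  ultimately show "(\<Sum>k<N. toeplitz_sv \<alpha> Fock \<mu> k) \<le> (\<Sum>k<N. toeplitz_sv \<alpha> PH \<mu> k)"
    by (simp add: sv)
  have "\<exists>g h. g \<in> Fock \<and> h \<in> Fock \<and> h 0 = 0 \<and> u k = (\<lambda>z. g z + cnj (h z))" for k
    using ph_spaceE[OF U(1)[of k]] by metis
  then obtain g h where g: "\<And>k. g k \<in> Fock" and h: "\<And>k. h k \<in> Fock" and h0: "\<And>k. h k 0 = 0"
    and ugh: "\<And>k. u k = (\<lambda>z. g k z + cnj (h k z))" by metis
  have zero: "(\<lambda>z. 0) \<in> Fock" by (rule fock_space_const[OF \<alpha>])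
  have sum1: "(\<Sum>k<N. l k * P.ip.nq (g k)) \<le> (\<Sum>k<N. t k)"
  proof (rule P.ky_fan_projection[OF u fock_subset_ph F.ip.subspace_V e])
    fix k w assume "w \<in> Fock"
    then show "gip (u k) w = gip (g k) w"
      using ph_inner[OF g[of k] _ h[of k] zero h0, of w] F.ip.zero_left[OF h[of k]]
      by (simp add: ugh zero_fun_def)
  qed (rule g)
  define W where "W = (\<lambda>f z. cnj (f z)) ` Fock"
  \<comment> \<open>The conjugate of p k is the projection of u k to W. The constant g k 0 of the
    holomorphic part belongs to W as well and must be included.\<close>
  define p where "p = (\<lambda>k z. h k z + cnj (g k 0))"
  have pF: "p k \<in> Fock" for k unfolding p_def by (intro fock_space_add h fock_space_const[OF \<alpha>])
  have WP: "W \<subseteq> PH" unfolding W_def using cnj_fock_in_ph by blast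
  have ip_cnj: "gip (\<lambda>z. cnj (f z)) (\<lambda>z. cnj (f' z)) = gip f' f" for f f'
    by (simp add: l2_inner_def mult.commute)
  have meas: "f \<in> borel_measurable borel" "(\<lambda>z. cnj (f z)) \<in> borel_measurable borel" if "f \<in> Fock" for f
    using that fock_space_measurable cnj_fock_in_ph ph_space_measurable by blast+
  have q_cnj: "q (\<lambda>z. cnj (f z)) (\<lambda>z. cnj (f' z)) = q f' f" if "f \<in> Fock" "f' \<in> Fock" for f f'
    unfolding q_def using meas that by (simp add: toeplitz_form_eq(1)[OF \<mu>] l2_inner_def mult.commute)
  have inW: "(\<lambda>z. cnj (f z)) \<in> W" if "f \<in> Fock" for f using that by (auto simp: W_def)
  have subW: "F.ip.subspace W"
    unfolding F.ip.subspace_def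
  proof (intro conjI ballI allI)
    show "0 \<in> W" using inW[OF zero] by (simp add: zero_fun_def)
  next
    fix x y assume "x \<in> W" "y \<in> W"
    then obtain f f' where ff: "f \<in> Fock" "f' \<in> Fock" "x = (\<lambda>z. cnj (f z))" "y = (\<lambda>z. cnj (f' z))"
      unfolding W_def by blast
    have eq: "x + y = (\<lambda>z. cnj (f z + f' z))" by (auto simp: ff)
    show "x + y \<in> W" unfolding eq by (rule inW[OF fock_space_add[OF ff(1,2)]])
  next
    fix c x assume "x \<in> W"
    then obtain f where ff: "f \<in> Fock" "x = (\<lambda>z. cnj (f z))" unfolding W_def by blast
    have eq: "fun_scale c x = (\<lambda>z. cnj (cnj c * f z))" by (auto simp: ff)
    show "fun_scale c x \<in> W" unfolding eq by (rule inW[OF fock_space_cmult[OF ff(1)]])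
  qed
  \<comment> \<open>Conjugation swaps the arguments of both forms, so it carries the Fock
    eigensystem to W with the same real eigenvalues.\<close>
  have eW: "eigensystem W gip q (\<lambda>k z. cnj (e k z)) t"
    unfolding eigensystem_def
  proof (intro conjI allI ballI impI)
    show "(\<lambda>z. cnj (e k z)) \<in> W" for k by (rule inW[OF E(1)])
    show "decseq t" "t \<longlonglongrightarrow> 0" "0 \<le> t k" for k by (rule E)+
  next
    fix k x assume "x \<in> W"
    then obtain f where f: "f \<in> Fock" "x = (\<lambda>z. cnj (f z))" unfolding W_def by blast
    have "q f (e k) = of_real (t k) * gip f (e k)"
      using E(5)[OF f(1), of k] F.q.sym[OF E(1) f(1), of k] F.ip.sym[OF E(1) f(1), of k] by simp
    then show "q (\<lambda>z. cnj (e k z)) x = of_real (t k) * gip (\<lambda>z. cnj (e k z)) x"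
      unfolding f(2) ip_cnj q_cnj[OF E(1) f(1)] .
  next
    show "gip (\<lambda>z. cnj (e j z)) (\<lambda>z. cnj (e k z)) = 0" if "j \<noteq> k" for j k
      unfolding ip_cnj using E(6)[of k j] that by simp
    show "Re (gip (\<lambda>z. cnj (e k z)) (\<lambda>z. cnj (e k z))) = (if t k = 0 then 0 else 1)" for k
      unfolding ip_cnj by (rule E(7))
  next
    fix k x assume "x \<in> W" and o: "\<forall>j<k. gip x (\<lambda>z. cnj (e j z)) = 0"
    then obtain f where f: "f \<in> Fock" "x = (\<lambda>z. cnj (f z))" unfolding W_def by blast
    have "gip f (e j) = 0" if "j < k" for j
      using o that F.ip.sym[OF E(1) f(1), of j] unfolding f(2) ip_cnj by simp
    then show "Re (q x x) \<le> t k * Re (gip x x)"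
      unfolding f(2) ip_cnj q_cnj[OF f(1) f(1)] by (intro E(8) f(1))
  qed
  have const: "(\<lambda>z. a) \<in> Fock" for a by (rule fock_space_const[OF \<alpha>])
  have sum2: "(\<Sum>k<N. l k * P.ip.nq (\<lambda>z. cnj (p k z))) \<le> (\<Sum>k<N. t k)"
  proof (rule P.ky_fan_projection[OF u WP subW eW])
    show "(\<lambda>z. cnj (p k z)) \<in> W" for k by (rule inW[OF pF])
    fix k w assume "w \<in> W"
    then obtain f where f: "f \<in> Fock" "w = (\<lambda>z. cnj (f z))" unfolding W_def by blast
    \<comment> \<open>The part of u k left outside W: it is holomorphic and vanishes at 0, hence is
      orthogonal to all conjugates of Fock functions.\<close>
    define d where "d = (\<lambda>z. g k z - g k 0)"
    have dF: "d \<in> Fock" unfolding d_def by (intro fock_space_diff g const)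
    have dP: "d \<in> PH" and cP: "(\<lambda>z. cnj (p k z)) \<in> PH" and wP: "w \<in> PH"
      using dF fock_subset_ph cnj_fock_in_ph pF f by auto
    have "u k = d + (\<lambda>z. cnj (p k z))" by (auto simp: ugh d_def p_def)
    then have "gip (u k) w = gip d w + gip (\<lambda>z. cnj (p k z)) w"
      using P.ip.add_left[OF dP cP wP] by simp
    also have "gip d w = 0"
      using fock_space_mean[OF \<alpha> dF f(1)] by (simp add: l2_inner_def f(2) d_def)
    finally show "gip (u k) w = gip (\<lambda>z. cnj (p k z)) w" by simp
  qed
  \<comment> \<open>The inequality absorbs the doubly counted constant, since adding a constant
    orthogonal to h k only increases the norm. Where l k = 0 the eigenvector is null and both sides
    vanish.\<close>
  have "l k \<le> l k * P.ip.nq (g k) + l k * P.ip.nq (\<lambda>z. cnj (p k z))" for k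
  proof -
    have "gip (h k) (\<lambda>z. cnj (g k 0)) = 0"
      using fock_space_mean[OF \<alpha> h[of k] const[of "g k 0"]] h0[of k] by (simp add: l2_inner_def)
    then have "P.ip.nq (p k) = P.ip.nq (h k) + P.ip.nq (\<lambda>z. cnj (g k 0))"
      using F.ip.nq_add[OF h[of k] const[of "cnj (g k 0)"]] by (simp add: p_def plus_fun_def)
    then have "P.ip.nq (h k) \<le> P.ip.nq (\<lambda>z. cnj (p k z))"
      using F.ip.nonneg[OF const[of "cnj (g k 0)"]] by (simp add: ip_cnj)
    moreover have "P.ip.nq (u k) = P.ip.nq (g k) + P.ip.nq (h k)"
      unfolding ugh using ph_inner[OF g[of k] g[of k] h[of k] h[of k]] h0 by simp
    ultimately have "l k * P.ip.nq (u k) \<le> l k * (P.ip.nq (g k) + P.ip.nq (\<lambda>z. cnj (p k z)))"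
      using U(3)[of k] by (intro mult_left_mono) auto
    moreover have "l k * P.ip.nq (u k) = l k" using U(7)[of k] by simp
    ultimately show ?thesis by (simp add: distrib_left)
  qed
  then have "(\<Sum>k<N. l k) \<le> (\<Sum>k<N. l k * P.ip.nq (g k) + l k * P.ip.nq (\<lambda>z. cnj (p k z)))"
    by (intro sum_mono)
  also have "\<dots> \<le> 2 * (\<Sum>k<N. t k)" using sum1 sum2 by (simp add: sum.distrib)
  finally show "(\<Sum>k<N. toeplitz_sv \<alpha> PH \<mu> k) \<le> 2 * (\<Sum>k<N. toeplitz_sv \<alpha> Fock \<mu> k)" by (simp add: sv)
qed

lemma toeplitz_comparison:
  assumes \<mu>: "sets \<mu> = sets borel" and \<Phi>: "symmetric_norming \<Phi>"
    and bdd: "toeplitz_bounded \<alpha> PH \<mu>" and comp: "form_compact PH gip (toeplitz_form \<alpha> \<mu>)"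
  shows "toeplitz_norm \<Phi> \<alpha> Fock \<mu> \<le> toeplitz_norm \<Phi> \<alpha> PH \<mu>"
    and "toeplitz_norm \<Phi> \<alpha> PH \<mu> \<le> 2 * toeplitz_norm \<Phi> \<alpha> Fock \<mu>"
proof -
  note maj = toeplitz_sv_majorization[OF \<mu> bdd comp]
  have "toeplitz_norm \<Phi> \<alpha> Fock \<mu> \<le> ereal 1 * toeplitz_norm \<Phi> \<alpha> PH \<mu>"
    by (rule toeplitz_norm_le[OF \<Phi>]) (use maj in simp_all)
  then show "toeplitz_norm \<Phi> \<alpha> Fock \<mu> \<le> toeplitz_norm \<Phi> \<alpha> PH \<mu>" by simp
  have "toeplitz_norm \<Phi> \<alpha> PH \<mu> \<le> ereal 2 * toeplitz_norm \<Phi> \<alpha> Fock \<mu>"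
    by (rule toeplitz_norm_le[OF \<Phi>]) (use maj in simp_all)
  then show "toeplitz_norm \<Phi> \<alpha> PH \<mu> \<le> 2 * toeplitz_norm \<Phi> \<alpha> Fock \<mu>" by simp
qed

lemma toeplitz_in_ideal_fock_iff_ph:
  assumes \<mu>: "sets \<mu> = sets borel" and \<Phi>: "symmetric_norming \<Phi>"
  shows "toeplitz_in_ideal \<Phi> \<alpha> Fock \<mu> \<longleftrightarrow> toeplitz_in_ideal \<Phi> \<alpha> PH \<mu>"
proof (cases "toeplitz_bounded \<alpha> PH \<mu> \<and> form_compact PH gip (toeplitz_form \<alpha> \<mu>)")
  case True
  have "toeplitz_norm \<Phi> \<alpha> Fock \<mu> < \<infinity> \<longleftrightarrow> toeplitz_norm \<Phi> \<alpha> PH \<mu> < \<infinity>"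
  proof
    assume "toeplitz_norm \<Phi> \<alpha> Fock \<mu> < \<infinity>"
    then have "2 * toeplitz_norm \<Phi> \<alpha> Fock \<mu> < \<infinity>"
      using toeplitz_norm_nonneg[OF \<Phi>, of \<alpha> Fock \<mu>] by (cases "toeplitz_norm \<Phi> \<alpha> Fock \<mu>") auto
    then show "toeplitz_norm \<Phi> \<alpha> PH \<mu> < \<infinity>"
      using toeplitz_comparison(2)[OF \<mu> \<Phi>] True by (meson le_less_trans)
  next
    assume "toeplitz_norm \<Phi> \<alpha> PH \<mu> < \<infinity>"
    then show "toeplitz_norm \<Phi> \<alpha> Fock \<mu> < \<infinity>"
      using toeplitz_comparison(1)[OF \<mu> \<Phi>] True by (meson le_less_trans)
  qed
  then show ?thesis
    using True toeplitz_bounded_fock_iff_ph[OF \<mu>] form_compact_fock_iff_ph[OF \<mu>]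
    by (simp add: toeplitz_in_ideal_iff[OF \<mu> fock_space_measurable hilbert_form_fock_space[OF \<alpha>]]
        toeplitz_in_ideal_iff[OF \<mu> ph_space_measurable hilbert_form_ph_space])
next
  case False
  then show ?thesis
    using toeplitz_bounded_fock_iff_ph[OF \<mu>] form_compact_fock_iff_ph[OF \<mu>]
    by (auto simp: toeplitz_in_ideal_iff[OF \<mu> fock_space_measurable hilbert_form_fock_space[OF \<alpha>]]
        toeplitz_in_ideal_iff[OF \<mu> ph_space_measurable hilbert_form_ph_space])
qed

end

text \<open>At a point mass the form is w f(a) cnj (g(a)) with w = exp (-|a|^2 / \<alpha>). If
  \<kappa> reproduces evaluation at a and K = \<kappa> a is its squared norm, the only nonzero
  eigenvalue is w K, with eigenvector \<kappa> / sqrt K. By the normalization of \<Phi> every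
  symmetric norm equals w K.\<close>

lemma point_mass_toeplitz:
  fixes H :: "(complex ^ 'n \<Rightarrow> complex) set"
  assumes \<Phi>: "symmetric_norming \<Phi>" and meas: "H \<subseteq> borel_measurable borel"
    and H: "hilbert_form fun_scale H (l2_inner (gauss_measure \<alpha>))"
    and \<kappa>: "\<kappa> \<in> H" "\<And>f. f \<in> H \<Longrightarrow> l2_inner (gauss_measure \<alpha>) f \<kappa> = f a"
    and K: "\<kappa> a = of_real K" "0 < K"
  shows "toeplitz_norm \<Phi> \<alpha> H (return borel a) = ereal (exp (- (norm a)\<^sup>2 / \<alpha>) * K)"
    and "toeplitz_in_ideal \<Phi> \<alpha> H (return borel a)"
proof -
  interpret H: hilbert_form fun_scale H "l2_inner (gauss_measure \<alpha>)" by (rule H)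
  define \<mu> where "\<mu> = return borel a"
  define w where "w = exp (- (norm a)\<^sup>2 / \<alpha>)"
  have \<mu>: "sets \<mu> = sets borel" by (simp add: \<mu>_def)
  have w: "0 < w" by (simp add: w_def)
  have nqk: "H.nq \<kappa> = K" using \<kappa>(2)[OF \<kappa>(1)] K(1) by simp
  have cs: "(cmod (f a))\<^sup>2 \<le> H.nq f * K" if "f \<in> H" for f
    using H.cauchy_schwarz[OF that \<kappa>(1)] \<kappa>(2)[OF that] nqk by simp
  define q where "q = toeplitz_form \<alpha> \<mu>"
  have q: "q f g = f a * cnj (g a) * of_real w" if "f \<in> H" "g \<in> H" for f g
  proof -
    have [measurable]: "f \<in> borel_measurable borel" "g \<in> borel_measurable borel" using that meas by auto
    show ?thesis unfolding q_def toeplitz_form_def \<mu>_def w_def by (rule integral_return) auto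
  qed
  have qq: "Re (q f f) = w * (cmod (f a))\<^sup>2" if "f \<in> H" for f
    unfolding q[OF that that] complex_norm_square[symmetric] of_real_mult[symmetric] Re_complex_of_real
    by (rule mult.commute)
  have bdd: "toeplitz_bounded \<alpha> H \<mu>"
  proof -
    have "square_integrable (weighted \<alpha> \<mu>) f" if "f \<in> H" for f
    proof -
      have [measurable]: "f \<in> borel_measurable borel" using that meas by auto
      have [measurable_cong]: "sets (weighted \<alpha> \<mu>) = sets borel" by (simp add: \<mu>)
      have "(\<integral>\<^sup>+z. ennreal ((cmod (f z))\<^sup>2) \<partial>weighted \<alpha> \<mu>) = ennreal w * ennreal ((cmod (f a))\<^sup>2)"
        unfolding weighted_def w_def \<mu>_def by (subst nn_integral_density, simp_all) (subst nn_integral_return, simp_all)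
      also have "\<dots> = ennreal (w * (cmod (f a))\<^sup>2)" using w by (simp add: ennreal_mult)
      finally show ?thesis using w by (intro square_integrable_nn_integral(1)) auto
    qed
    moreover have "Re (toeplitz_form \<alpha> \<mu> f f) \<le> (w * K) * H.nq f" if "f \<in> H" for f
      using cs[OF that] qq[OF that] w unfolding q_def by (simp add: mult_ac mult_left_mono)
    ultimately show ?thesis
      using toeplitz_bounded_iff[OF \<mu> meas H.psd_form_axioms] by blast
  qed
  have fp: "form_pair fun_scale H (l2_inner (gauss_measure \<alpha>)) q"
    unfolding q_def by (rule toeplitz_form_pair[OF \<mu> meas H bdd])
  define e where "e = (\<lambda>k :: nat. if k = 0 then fun_scale (of_real (1 / sqrt K)) \<kappa> else 0)"
  define t where "t = (\<lambda>k :: nat. if k = 0 then w * K else 0)"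
  have eH: "e k \<in> H" for k
    by (cases "k = 0") (simp_all only: e_def simp_thms if_True if_False H.scale_V \<kappa>(1) H.zero_V)
  have e0: "l2_inner (gauss_measure \<alpha>) f (e 0) = of_real (1 / sqrt K) * f a" if f: "f \<in> H" for f
  proof -
    have "e 0 = fun_scale (of_real (1 / sqrt K)) \<kappa>" by (simp only: e_def simp_thms if_True)
    show ?thesis unfolding \<open>e 0 = _\<close> H.scale_right[OF \<kappa>(1) f] \<kappa>(2)[OF f] by simp
  qed
  have e0a: "e 0 a = of_real (sqrt K)"
  proof -
    have "e 0 a = of_real (1 / sqrt K * K)" by (simp add: e_def K(1))
    also have "1 / sqrt K * K = sqrt K" using real_div_sqrt[of K] K(2) by simp
    finally show ?thesis .
  qed
  have "eigensystem H (l2_inner (gauss_measure \<alpha>)) q e t"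
    unfolding eigensystem_def
  proof (intro conjI allI ballI impI)
    show "e k \<in> H" for k by (rule eH)
    show "decseq t" using w K(2) by (auto simp: decseq_def t_def)
    show "0 \<le> t k" for k using w K(2) by (simp add: t_def)
    show "t \<longlonglongrightarrow> 0"
      by (rule tendsto_eventually) (auto simp: t_def eventually_sequentially intro!: exI[of _ 1])
    show "q (e k) f = of_real (t k) * l2_inner (gauss_measure \<alpha>) (e k) f" if f: "f \<in> H" for k f
    proof (cases "k = 0")
      case True
      have "l2_inner (gauss_measure \<alpha>) (e 0) f = cnj (of_real (1 / sqrt K) * f a)"
        using H.sym[OF f eH[of 0]] e0[OF f] by simp
      then have "of_real (t 0) * l2_inner (gauss_measure \<alpha>) (e 0) f
          = of_real (w * (K * (1 / sqrt K))) * cnj (f a)"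
        by (simp only: t_def simp_thms if_True complex_cnj_mult complex_cnj_complex_of_real
            of_real_mult mult.assoc)
      also have "K * (1 / sqrt K) = sqrt K" using real_div_sqrt[of K] K(2) by simp
      finally have "of_real (t 0) * l2_inner (gauss_measure \<alpha>) (e 0) f
          = of_real w * of_real (sqrt K) * cnj (f a)"
        by (simp only: of_real_mult)
      then show ?thesis using True q[OF eH f, of 0] e0a by (simp add: mult_ac)
    next
      case False
      then show ?thesis using q[OF H.zero_V f] by (simp add: e_def t_def)
    qed
    show "l2_inner (gauss_measure \<alpha>) (e j) (e k) = 0" if "j \<noteq> k" for j k
    proof -
      have "e j = 0 \<or> e k = 0" using that by (auto simp: e_def)
      then show ?thesis using H.zero_left[OF eH[of k]] H.zero_right[OF eH[of j]] by metis
    qed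
    show "Re (l2_inner (gauss_measure \<alpha>) (e k) (e k)) = (if t k = 0 then 0 else 1)" for k
    proof (cases "k = 0")
      case True
      have "l2_inner (gauss_measure \<alpha>) (e 0) (e 0) = of_real (1 / sqrt K * sqrt K)"
        unfolding e0[OF eH] e0a of_real_mult ..
      then show ?thesis using True K(2) w by (simp add: t_def)
    next
      case False
      then show ?thesis by (simp add: e_def t_def)
    qed
    show "Re (q f f) \<le> t k * H.nq f" if f: "f \<in> H" and o: "\<forall>j<k. l2_inner (gauss_measure \<alpha>) f (e j) = 0" for k f
    proof (cases "k = 0")
      case True
      then show ?thesis using qq[OF f] cs[OF f] w by (simp add: t_def mult_ac mult_left_mono)
    next
      case False
      then have "f a = 0" using o[rule_format, of 0] e0[OF f] K(2) by simp
      then show ?thesis using qq[OF f] False by (simp add: t_def)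
    qed
  qed
  then have sv: "toeplitz_sv \<alpha> H \<mu> = t" using toeplitz_sv_eq fp unfolding q_def by blast
  have \<Phi>t: "\<Phi> (trunc N t) = w * K" if "N \<ge> 1" for N
  proof -
    define \<delta> :: "nat \<Rightarrow> real" where "\<delta> = (\<lambda>k. if k = 0 then 1 else 0)"
    have "trunc N t = (\<lambda>k. (w * K) * \<delta> k)" using that by (auto simp: trunc_def t_def \<delta>_def)
    moreover have "\<delta> \<in> fin_supp" by (auto simp: fin_supp_def \<delta>_def)
    then have "\<Phi> (\<lambda>k. (w * K) * \<delta> k) = \<bar>w * K\<bar> * \<Phi> \<delta>" using \<Phi> by (simp add: symmetric_norming_def)
    moreover have "\<Phi> \<delta> = 1" using \<Phi> by (simp add: symmetric_norming_def \<delta>_def)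
    ultimately show ?thesis using w K(2) by simp
  qed
  have norm: "toeplitz_norm \<Phi> \<alpha> H \<mu> = ereal (w * K)"
    unfolding toeplitz_norm_eq sv using \<Phi>t by (intro SUP_eq_const) auto
  then show "toeplitz_norm \<Phi> \<alpha> H (return borel a) = ereal (exp (- (norm a)\<^sup>2 / \<alpha>) * K)"
    by (simp add: \<mu>_def w_def)
  have "form_compact H (l2_inner (gauss_measure \<alpha>)) q"
  proof (rule H.form_compact_functional[where \<phi> = "\<lambda>f. of_real (sqrt w) * f a"])
    show "(cmod (of_real (sqrt w) * f a))\<^sup>2 \<le> (w * K) * H.nq f" if "f \<in> H" for f
      using cs[OF that] w by (simp add: norm_mult power_mult_distrib mult_ac mult_left_mono)
    show "Re (q f f) = (cmod (of_real (sqrt w) * f a))\<^sup>2" if "f \<in> H" for f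
      using qq[OF that] w by (simp add: norm_mult power_mult_distrib)
  qed (simp add: right_diff_distrib)
  then show "toeplitz_in_ideal \<Phi> \<alpha> H (return borel a)"
    using toeplitz_in_ideal_iff[OF \<mu> meas H, of \<Phi>] bdd norm unfolding q_def \<mu>_def by simp
qed

lemma point_mass_fock:
  assumes \<alpha>: "\<alpha> > 0" and \<Phi>: "symmetric_norming \<Phi>"
  shows "toeplitz_norm \<Phi> \<alpha> (fock_space \<alpha>) (return borel a) = 1"
    and "toeplitz_in_ideal \<Phi> \<alpha> (fock_space \<alpha>) (return borel a)"
proof -
  note pm = point_mass_toeplitz[OF \<Phi> fock_space_measurable hilbert_form_fock_space[OF \<alpha>]
      fock_kernel_in_fock_space[OF \<alpha>] fock_kernel_reproducing[OF \<alpha>] fock_kernel_diag exp_gt_zero]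
  show "toeplitz_norm \<Phi> \<alpha> (fock_space \<alpha>) (return borel a) = 1"
    using pm(1)[of a] by (simp add: exp_minus)
  show "toeplitz_in_ideal \<Phi> \<alpha> (fock_space \<alpha>) (return borel a)" using pm(2)[of a] .
qed

text \<open>The reproducing kernel of the orthogonal sum is k + cnj (k - 1): the kernel of functions
  vanishing at 0 is k minus that of the constants. Its value at a is 2 exp (|a|^2 / \<alpha>) - 1,
  which the weight turns into the stated ratio.\<close>

lemma point_mass_ph:
  assumes \<alpha>: "\<alpha> > 0" and \<Phi>: "symmetric_norming \<Phi>"
  shows "toeplitz_norm \<Phi> \<alpha> (ph_space \<alpha>) (return borel a) = ereal (2 - exp (- (norm a)\<^sup>2 / \<alpha>))"
proof -
  define k where "k = fock_kernel \<alpha> a"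
  define k0 where "k0 = (\<lambda>z. k z - 1)"
  define K where "K = 2 * exp ((norm a)\<^sup>2 / \<alpha>) - 1"
  have kF: "k \<in> fock_space \<alpha>" unfolding k_def by (rule fock_kernel_in_fock_space[OF \<alpha>])
  have k0F: "k0 \<in> fock_space \<alpha>" unfolding k0_def by (rule fock_space_diff[OF kF fock_space_const[OF \<alpha>]])
  have k00: "k0 0 = 0" by (simp add: k0_def k_def fock_kernel_def herm_def)
  interpret F: hilbert_form fun_scale "fock_space \<alpha>" "l2_inner (gauss_measure \<alpha>)"
    by (rule hilbert_form_fock_space[OF \<alpha>])
  have "toeplitz_norm \<Phi> \<alpha> (ph_space \<alpha>) (return borel a) = ereal (exp (- (norm a)\<^sup>2 / \<alpha>) * K)"
  proof (rule point_mass_toeplitz(1)[OF \<Phi> ph_space_measurable[OF \<alpha>] hilbert_form_ph_space[OF \<alpha>]])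
    show "(\<lambda>z. k z + cnj (k0 z)) \<in> ph_space \<alpha>" by (rule ph_spaceI[OF \<alpha> kF k0F k00])
    show "l2_inner (gauss_measure \<alpha>) f (\<lambda>z. k z + cnj (k0 z)) = f a" if f: "f \<in> ph_space \<alpha>" for f
    proof -
      obtain g h where gh: "g \<in> fock_space \<alpha>" "h \<in> fock_space \<alpha>" "h 0 = 0" "f = (\<lambda>z. g z + cnj (h z))"
        by (rule ph_spaceE[OF \<alpha> f])
      have one: "(\<lambda>z. 1) \<in> fock_space \<alpha>" by (rule fock_space_const[OF \<alpha>])
      have "k0 = k - (\<lambda>z. 1)" by (auto simp: k0_def)
      then have "l2_inner (gauss_measure \<alpha>) k0 h = l2_inner (gauss_measure \<alpha>) k h - l2_inner (gauss_measure \<alpha>) (\<lambda>z. 1) h"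
        using F.diff_left[OF kF one gh(2)] by simp
      also have "l2_inner (gauss_measure \<alpha>) k h = cnj (h a)"
        using F.sym[OF gh(2) kF] fock_kernel_reproducing[OF \<alpha> gh(2), of a] by (simp add: k_def)
      also have "l2_inner (gauss_measure \<alpha>) (\<lambda>z. 1) h = 0"
        using F.sym[OF gh(2) one] fock_space_mean[OF \<alpha> gh(2) one] gh(3) by (simp add: l2_inner_def)
      finally show ?thesis
        unfolding gh(4) ph_inner[OF \<alpha> gh(1) kF gh(2) k0F gh(3) k00]
        using fock_kernel_reproducing[OF \<alpha> gh(1), of a] by (simp add: k_def)
    qed
    show "k a + cnj (k0 a) = of_real K" by (simp add: k_def k0_def K_def fock_kernel_diag)
    have "1 \<le> exp ((norm a)\<^sup>2 / \<alpha>)" using \<alpha> by simp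
    then show "0 < K" unfolding K_def by linarith
  qed
  moreover have "exp (- (norm a)\<^sup>2 / \<alpha>) * K = 2 - exp (- (norm a)\<^sup>2 / \<alpha>)"
    by (simp add: K_def right_diff_distrib exp_minus)
  ultimately show ?thesis by simp
qed

theorem corollary1p2:
  fixes \<alpha> :: real and \<mu> :: "(complex ^ 'n::finite) measure"
    and \<Phi> :: "(nat \<Rightarrow> real) \<Rightarrow> real"
  assumes "\<alpha> > 0" and "sets \<mu> = sets borel" and "symmetric_norming \<Phi>"
  shows
    "(toeplitz_in_ideal \<Phi> \<alpha> (fock_space \<alpha>) \<mu> \<longleftrightarrow> toeplitz_in_ideal \<Phi> \<alpha> (ph_space \<alpha>) \<mu>) \<and>
     (toeplitz_in_ideal \<Phi> \<alpha> (fock_space \<alpha>) \<mu> \<and> toeplitz_in_ideal \<Phi> \<alpha> (ph_space \<alpha>) \<mu> \<longrightarrow>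
        toeplitz_norm \<Phi> \<alpha> (fock_space \<alpha>) \<mu> \<le> toeplitz_norm \<Phi> \<alpha> (ph_space \<alpha>) \<mu> \<and>
        toeplitz_norm \<Phi> \<alpha> (ph_space \<alpha>) \<mu> \<le> 2 * toeplitz_norm \<Phi> \<alpha> (fock_space \<alpha>) \<mu> \<and>
        (\<forall>N\<ge>1. (\<Sum>k<N. toeplitz_sv \<alpha> (ph_space \<alpha>) \<mu> k)
                  \<le> 2 * (\<Sum>k<N. toeplitz_sv \<alpha> (fock_space \<alpha>) \<mu> k))) \<and>
     (\<forall>c::real. c < 1 \<longrightarrow>
        \<not> (\<forall>\<nu> :: (complex ^ 'n) measure. sets \<nu> = sets borel \<and>
              toeplitz_in_ideal \<Phi> \<alpha> (fock_space \<alpha>) \<nu> \<and> toeplitz_in_ideal \<Phi> \<alpha> (ph_space \<alpha>) \<nu> \<longrightarrow>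
              toeplitz_norm \<Phi> \<alpha> (fock_space \<alpha>) \<nu>
                \<le> ereal c * toeplitz_norm \<Phi> \<alpha> (ph_space \<alpha>) \<nu>)) \<and>
     (\<forall>c::real. c < 2 \<longrightarrow>
        \<not> (\<forall>\<nu> :: (complex ^ 'n) measure. sets \<nu> = sets borel \<and>
              toeplitz_in_ideal \<Phi> \<alpha> (fock_space \<alpha>) \<nu> \<and> toeplitz_in_ideal \<Phi> \<alpha> (ph_space \<alpha>) \<nu> \<longrightarrow>
              toeplitz_norm \<Phi> \<alpha> (ph_space \<alpha>) \<nu>
                \<le> ereal c * toeplitz_norm \<Phi> \<alpha> (fock_space \<alpha>) \<nu>))"
proof (intro conjI allI impI notI)
  note \<alpha> = assms(1) and \<mu> = assms(2) and \<Phi> = assms(3)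
  show "toeplitz_in_ideal \<Phi> \<alpha> (fock_space \<alpha>) \<mu> \<longleftrightarrow> toeplitz_in_ideal \<Phi> \<alpha> (ph_space \<alpha>) \<mu>"
    by (rule toeplitz_in_ideal_fock_iff_ph[OF \<alpha> \<mu> \<Phi>])
  {
    assume "toeplitz_in_ideal \<Phi> \<alpha> (fock_space \<alpha>) \<mu> \<and> toeplitz_in_ideal \<Phi> \<alpha> (ph_space \<alpha>) \<mu>"
    then have P: "toeplitz_bounded \<alpha> (ph_space \<alpha>) \<mu>"
      "form_compact (ph_space \<alpha>) (l2_inner (gauss_measure \<alpha>)) (toeplitz_form \<alpha> \<mu>)"
      using toeplitz_in_ideal_iff[OF \<mu> ph_space_measurable[OF \<alpha>] hilbert_form_ph_space[OF \<alpha>]] by blast+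
    show "toeplitz_norm \<Phi> \<alpha> (fock_space \<alpha>) \<mu> \<le> toeplitz_norm \<Phi> \<alpha> (ph_space \<alpha>) \<mu>"
      and "toeplitz_norm \<Phi> \<alpha> (ph_space \<alpha>) \<mu> \<le> 2 * toeplitz_norm \<Phi> \<alpha> (fock_space \<alpha>) \<mu>"
      by (rule toeplitz_comparison[OF \<alpha> \<mu> \<Phi> P])+
    show "(\<Sum>k<N. toeplitz_sv \<alpha> (ph_space \<alpha>) \<mu> k) \<le> 2 * (\<Sum>k<N. toeplitz_sv \<alpha> (fock_space \<alpha>) \<mu> k)" for N
      by (rule toeplitz_sv_majorization(6)[OF \<alpha> \<mu> P])
  }
  have pm: "toeplitz_in_ideal \<Phi> \<alpha> (fock_space \<alpha>) (return borel a) \<and>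
      toeplitz_in_ideal \<Phi> \<alpha> (ph_space \<alpha>) (return borel a)" for a :: "complex ^ 'n"
    using point_mass_fock(2)[OF \<alpha> \<Phi>, of a] toeplitz_in_ideal_fock_iff_ph[OF \<alpha> _ \<Phi>, of "return borel a"] by simp
  {
    fix c :: real
    assume c: "c < 1" and all: "\<forall>\<nu> :: (complex ^ 'n) measure. sets \<nu> = sets borel \<and>
      toeplitz_in_ideal \<Phi> \<alpha> (fock_space \<alpha>) \<nu> \<and> toeplitz_in_ideal \<Phi> \<alpha> (ph_space \<alpha>) \<nu> \<longrightarrow>
      toeplitz_norm \<Phi> \<alpha> (fock_space \<alpha>) \<nu> \<le> ereal c * toeplitz_norm \<Phi> \<alpha> (ph_space \<alpha>) \<nu>"
    \<comment> \<open>At the origin both norms equal 1, so the assumed bound would read 1 \<le>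
      c.\<close>
    have "toeplitz_norm \<Phi> \<alpha> (fock_space \<alpha>) (return borel (0 :: complex ^ 'n))
        \<le> ereal c * toeplitz_norm \<Phi> \<alpha> (ph_space \<alpha>) (return borel (0 :: complex ^ 'n))"
      using all[rule_format, of "return borel 0"] pm[of 0] by simp
    then show False
      using c unfolding point_mass_fock(1)[OF \<alpha> \<Phi>] point_mass_ph[OF \<alpha> \<Phi>] by simp
  }
  {
    fix c :: real
    assume c: "c < 2" and all: "\<forall>\<nu> :: (complex ^ 'n) measure. sets \<nu> = sets borel \<and>
      toeplitz_in_ideal \<Phi> \<alpha> (fock_space \<alpha>) \<nu> \<and> toeplitz_in_ideal \<Phi> \<alpha> (ph_space \<alpha>) \<nu> \<longrightarrow>
      toeplitz_norm \<Phi> \<alpha> (ph_space \<alpha>) \<nu> \<le> ereal c * toeplitz_norm \<Phi> \<alpha> (fock_space \<alpha>) \<nu>"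
    \<comment> \<open>s is to be |a|^2 / \<alpha>. It must be positive and exceed - ln (2 - c), so
      that exp (-s) < 2 - c and the norm 2 - exp (-s) exceeds c.\<close>
    define s where "s = max 0 (- ln (2 - c)) + 1"
    have s: "0 < s" "- s < ln (2 - c)" by (auto simp: s_def)
    obtain a :: "complex ^ 'n" where a: "norm a = sqrt (\<alpha> * s)"
      using vector_choose_size[of "sqrt (\<alpha> * s)"] \<alpha> s(1) by auto
    have "(norm a)\<^sup>2 / \<alpha> = s" using a \<alpha> s(1) by simp
    moreover have "exp (- s) < exp (ln (2 - c))" using s(2) by simp
    ultimately have lt: "exp (- (norm a)\<^sup>2 / \<alpha>) < 2 - c" using c by simp
    have "toeplitz_norm \<Phi> \<alpha> (ph_space \<alpha>) (return borel a)
        \<le> ereal c * toeplitz_norm \<Phi> \<alpha> (fock_space \<alpha>) (return borel a)"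
      using all[rule_format, of "return borel a"] pm[of a] by simp
    then show False
      using lt unfolding point_mass_fock(1)[OF \<alpha> \<Phi>] point_mass_ph[OF \<alpha> \<Phi>] by simp
  }
qed

end
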